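(* Consider the integration problem $I_s$, $s\in\mathbb{N}$, over the Hermite spaces $\mathcal{H}(K_{s,\boldsymbol{a},\boldsymbol{b},\omega})$, where $\omega\in(0,1)$ and the weight sequences $\boldsymbol{a}=\{a_j\}_{j\ge1}$, $\boldsymbol{b}=\{b_j\}_{j\ge1}$ of real numbers satisfy $1\le a_1\le a_2\le a_3\le\cdots$ and $1\le b_1\le b_2\le b_3\le\cdots$. (The notions EXP, UEXP, EC-WT, EC-PT, EC-SPT and the quantities $p^*(s)$, $p^*$, $\tau^*$ are defined in the context.) 1. EXP holds for all such $\boldsymbol{a}$ and $\boldsymbol{b}$, and for every $s\in\mathbb{N}$ $$p^{*}(s)=\frac{1}{B(s)}\quad\text{with}\quad B(s):=\sum_{j=1}^s\frac{1}{b_j}.$$ 2. The following assertions are equivalent: (a) the sequence $\{1/b_j\}_{j\ge1}$ is summable, i.e. $B:=\sum_{j=1}^\infty \frac{1}{b_j}<\infty$; (b) we have UEXP; (c) we have EC-PT; (d) we have EC-SPT. If one of these assertions holds, then $p^*=1/B$ and the exponent $\tau^*$ of EC-SPT is $B$. 3. EC-WT implies that $\lim_{j\to\infty}a_j2^{b_j}=\infty$. 4. A sufficient condition for EC-WT is that there exist $\eta>0$ and $\beta>0$ such that $$a_j2^{b_j}\ge\beta\, j^{1+\eta}\quad\text{for all } j\in\mathbb{N}.$$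
   Context: $\mathbb{N}=\{1,2,\ldots\}$, $\mathbb{N}_0=\{0,1,2,\ldots\}$; $\log$ is the natural logarithm. Hermite polynomials: for $k\in\mathbb{N}_0$, $H_k(x)=\frac{(-1)^k}{\sqrt{k!}}e^{x^2/2}\frac{d^k}{dx^k}e^{-x^2/2}$; for $\boldsymbol{k}=(k_1,\ldots,k_s)\in\mathbb{N}_0^s$ and $\boldsymbol{x}\in\mathbb{R}^s$, $H_{\boldsymbol{k}}(\boldsymbol{x})=\prod_{j=1}^s H_{k_j}(x_j)$. Let $\varphi_s(\boldsymbol{x})=(2\pi)^{-s/2}\exp(-\boldsymbol{x}\cdot\boldsymbol{x}/2)$ be the density of the standard Gaussian measure on $\mathbb{R}^s$. Hermite space: for $\omega\in(0,1)$ and sequences $\boldsymbol{a},\boldsymbol{b}$ as in the claim, $\mathcal{H}(K_{s,\boldsymbol{a},\boldsymbol{b},\omega})$ is the reproducing kernel Hilbert space of functions on $\mathbb{R}^s$ with kernel $K_{s,\boldsymbol{a},\boldsymbol{b},\omega}(\boldsymbol{x},\boldsymbol{y})=\sum_{\boldsymbol{k}\in\mathbb{N}_0^s}\omega^{\sum_{j=1}^s a_jk_j^{b_j}}H_{\boldsymbol{k}}(\boldsymbol{x})H_{\boldsymbol{k}}(\boldsymbol{y})$ and inner product $\langle f,g\rangle=\sum_{\boldsymbol{k}\in\mathbb{N}_0^s}\omega^{-\sum_{j=1}^s a_jk_j^{b_j}}\widehat f(\boldsymbol{k})\widehat g(\boldsymbol{k})$, where $\widehat f(\boldsymbol{k})=\int_{\mathbb{R}^s}f(\boldsymbol{x})H_{\boldsymbol{k}}(\boldsymbol{x})\varphi_s(\boldsymbol{x})\,d\boldsymbol{x}$.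 Its norm is $\|f\|=\langle f,f\rangle^{1/2}$. Integration problem: $I_s(f)=\int_{\mathbb{R}^s}f(\boldsymbol{x})\varphi_s(\boldsymbol{x})\,d\boldsymbol{x}$ for $f\in\mathcal{H}(K_{s,\boldsymbol{a},\boldsymbol{b},\omega})$. Linear algorithms: $A_{n,s}(f)=\sum_{i=1}^n\alpha_if(\boldsymbol{x}_i)$ with $\boldsymbol{x}_i\in\mathbb{R}^s$, $\alpha_i\in\mathbb{R}$ (for $n=0$ the zero algorithm). Worst-case error: $e(A_{n,s},K_{s,\boldsymbol{a},\boldsymbol{b},\omega})=\sup_{\|f\|\le1}|I_s(f)-A_{n,s}(f)|$, the supremum being over $f\in\mathcal{H}(K_{s,\boldsymbol{a},\boldsymbol{b},\omega})$. The $n$th minimal worst-case error is $e(n,s)=\inf_{A_{n,s}}e(A_{n,s},K_{s,\boldsymbol{a},\boldsymbol{b},\omega})$, the infimum over all linear algorithms using $n$ function evaluations. Information complexity: $n(\varepsilon,s)=\min\{n: e(n,s)\le\varepsilon\}$ for $\varepsilon\in(0,1)$. Exponential convergence (EXP): there exist $q\in(0,1)$ and functions $p,C,C_1:\mathbb{N}\to(0,\infty)$ such that $e(n,s)\le C(s)\,q^{(n/C_1(s))^{p(s)}}$ for all $s,n\in\mathbb{N}$. The largest rate is $p^*(s)=\sup\{p\in(0,\infty): \exists\, C,C_1\in(0,\infty)\text{ such that }\forall n\in\mathbb{N}: e(n,s)\le Cq^{(n/C_1)^p}\}$. Uniform exponential convergence (UEXP): EXP holds with $p$ a constant function, $p(s)=p>0$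 for all $s$. The largest rate is $p^*=\sup\{p\in(0,\infty):\exists\, C,C_1:\mathbb{N}\to(0,\infty)\text{ such that }\forall n,s\in\mathbb{N}: e(n,s)\le C(s)q^{(n/C_1(s))^p}\}$. (In both definitions $q\in(0,1)$; its choice is immaterial as it can be absorbed into $C_1$.) EC-WT: $\lim_{s+\log\varepsilon^{-1}\to\infty}\frac{\log n(\varepsilon,s)}{s+\log\varepsilon^{-1}}=0$ (with $\log0=0$ by convention). EC-PT: there exist $c,\tau_1,\tau_2\ge0$ with $n(\varepsilon,s)\le c\,s^{\tau_1}(1+\log\varepsilon^{-1})^{\tau_2}$ for all $s\in\mathbb{N}$, $\varepsilon\in(0,1)$. EC-SPT: there exist $c,\tau\ge0$ with $n(\varepsilon,s)\le c\,(1+\log\varepsilon^{-1})^{\tau}$ for all $s\in\mathbb{N}$, $\varepsilon\in(0,1)$. The exponent $\tau^*$ of EC-SPT is the infimum of all $\tau\ge0$ for which such a $c\in[0,\infty)$ exists. *)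

theory Defs
  imports "HOL-Analysis.Analysis"
begin

section \<open>Reproducing kernel Hilbert spaces of functions\<close>

text \<open>
  A space of real functions on \<open>X\<close> is a set of functions that vanish outside \<open>X\<close>, so that
  equality in the space is equality on \<open>X\<close> and the vector space operations are pointwise.
  Nothing is required of \<open>ip\<close> on functions that are not in \<open>H\<close>.
\<close>

locale hilbert_function_space =
  fixes X :: "'x set"
    and H :: "('x \<Rightarrow> real) set"
    and ip :: "('x \<Rightarrow> real) \<Rightarrow> ('x \<Rightarrow> real) \<Rightarrow> real"
  assumes zero_outside: "\<And>f x. f \<in> H \<Longrightarrow> x \<notin> X \<Longrightarrow> f x = 0"
    and zero_mem: "(\<lambda>x. 0) \<in> H"
    and add_mem: "\<And>f g. f \<in> H \<Longrightarrow> g \<in> H \<Longrightarrow> (\<lambda>x. f x + g x) \<in> H"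
    and scale_mem: "\<And>c f. f \<in> H \<Longrightarrow> (\<lambda>x. c * f x) \<in> H"
    and ip_sym: "\<And>f g. f \<in> H \<Longrightarrow> g \<in> H \<Longrightarrow> ip f g = ip g f"
    and ip_add: "\<And>f g h. f \<in> H \<Longrightarrow> g \<in> H \<Longrightarrow> h \<in> H \<Longrightarrow>
                   ip (\<lambda>x. f x + g x) h = ip f h + ip g h"
    and ip_scale: "\<And>c f g. f \<in> H \<Longrightarrow> g \<in> H \<Longrightarrow> ip (\<lambda>x. c * f x) g = c * ip f g"
    and ip_pos: "\<And>f. f \<in> H \<Longrightarrow> f \<noteq> (\<lambda>x. 0) \<Longrightarrow> ip f f > 0"
    and complete:
      "\<And>F :: nat \<Rightarrow> 'x \<Rightarrow> real.
         (\<And>n. F n \<in> H) \<Longrightarrow>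
         (\<And>e. e > 0 \<Longrightarrow> \<exists>N. \<forall>m\<ge>N. \<forall>n\<ge>N.
            sqrt (ip (\<lambda>x. F m x - F n x) (\<lambda>x. F m x - F n x)) < e) \<Longrightarrow>
         \<exists>f\<in>H. (\<lambda>n. sqrt (ip (\<lambda>x. F n x - f x) (\<lambda>x. F n x - f x))) \<longlonglongrightarrow> 0"

definition kernel_section :: "'x set \<Rightarrow> ('x \<Rightarrow> 'x \<Rightarrow> real) \<Rightarrow> 'x \<Rightarrow> 'x \<Rightarrow> real" where
  "kernel_section X K y = (\<lambda>x. if x \<in> X then K x y else 0)"

locale rkhs = hilbert_function_space X H ip
  for X :: "'x set"
    and K :: "'x \<Rightarrow> 'x \<Rightarrow> real"
    and H :: "('x \<Rightarrow> real) set"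
    and ip :: "('x \<Rightarrow> real) \<Rightarrow> ('x \<Rightarrow> real) \<Rightarrow> real" +
  assumes kernel_mem: "\<And>y. y \<in> X \<Longrightarrow> kernel_section X K y \<in> H"
    and reproducing: "\<And>f y. f \<in> H \<Longrightarrow> y \<in> X \<Longrightarrow> f y = ip f (kernel_section X K y)"


section \<open>Gaussian measure and Hermite polynomials\<close>

text \<open>
  Points of \<open>s\<close>-dimensional Euclidean space and multi-indices are functions on \<open>nat\<close> whose
  coordinates are those with index in \<open>{1..s}\<close>, in the extensional encoding of
  \<^const>\<open>PiE\<close>; Lebesgue measure on such points is \<open>PiM {1..s} (\<lambda>_. lborel)\<close>.
\<close>

definition points :: "nat \<Rightarrow> (nat \<Rightarrow> real) set" where
  "points s = (\<Pi>\<^sub>E j\<in>{1..s}. UNIV)"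

definition multi_indices :: "nat \<Rightarrow> (nat \<Rightarrow> nat) set" where
  "multi_indices s = (\<Pi>\<^sub>E j\<in>{1..s}. UNIV)"

definition gauss_density :: "nat \<Rightarrow> (nat \<Rightarrow> real) \<Rightarrow> real" where
  "gauss_density s x = (2 * pi) powr (- (real s / 2)) * exp (- (\<Sum>j=1..s. x j * x j) / 2)"

definition gauss_integral :: "nat \<Rightarrow> ((nat \<Rightarrow> real) \<Rightarrow> real) \<Rightarrow> real" where
  "gauss_integral s f = (\<integral>x. f x * gauss_density s x \<partial>(\<Pi>\<^sub>M j\<in>{1..s}. lborel))"

definition hermite1 :: "nat \<Rightarrow> real \<Rightarrow> real" where
  "hermite1 k x =
     (-1) ^ k / sqrt (fact k) * exp (x\<^sup>2 / 2) * (deriv ^^ k) (\<lambda>t. exp (- t\<^sup>2 / 2)) x"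

definition hermite :: "nat \<Rightarrow> (nat \<Rightarrow> nat) \<Rightarrow> (nat \<Rightarrow> real) \<Rightarrow> real" where
  "hermite s k x = (\<Prod>j=1..s. hermite1 (k j) (x j))"

definition hermite_coeff :: "nat \<Rightarrow> ((nat \<Rightarrow> real) \<Rightarrow> real) \<Rightarrow> (nat \<Rightarrow> nat) \<Rightarrow> real" where
  "hermite_coeff s f k = gauss_integral s (\<lambda>x. f x * hermite s k x)"


section \<open>Hermite spaces\<close>

definition weight_exponent ::
  "(nat \<Rightarrow> real) \<Rightarrow> (nat \<Rightarrow> real) \<Rightarrow> nat \<Rightarrow> (nat \<Rightarrow> nat) \<Rightarrow> real" where
  "weight_exponent a b s k = (\<Sum>j=1..s. a j * real (k j) powr b j)"

definition hermite_kernel ::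
  "real \<Rightarrow> (nat \<Rightarrow> real) \<Rightarrow> (nat \<Rightarrow> real) \<Rightarrow> nat \<Rightarrow> (nat \<Rightarrow> real) \<Rightarrow> (nat \<Rightarrow> real) \<Rightarrow> real" where
  "hermite_kernel \<omega> a b s x y =
     (\<Sum>\<^sub>\<infinity>k\<in>multi_indices s. \<omega> powr weight_exponent a b s k * hermite s k x * hermite s k y)"

definition hermite_ip ::
  "real \<Rightarrow> (nat \<Rightarrow> real) \<Rightarrow> (nat \<Rightarrow> real) \<Rightarrow> nat \<Rightarrow>
   ((nat \<Rightarrow> real) \<Rightarrow> real) \<Rightarrow> ((nat \<Rightarrow> real) \<Rightarrow> real) \<Rightarrow> real" where
  "hermite_ip \<omega> a b s f g =
     (\<Sum>\<^sub>\<infinity>k\<in>multi_indices s.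
        \<omega> powr (- weight_exponent a b s k) * hermite_coeff s f k * hermite_coeff s g k)"

text \<open>
  A reproducing kernel Hilbert space is determined by its kernel, which justifies the
  definite description.
\<close>

definition hermite_space ::
  "real \<Rightarrow> (nat \<Rightarrow> real) \<Rightarrow> (nat \<Rightarrow> real) \<Rightarrow> nat \<Rightarrow> ((nat \<Rightarrow> real) \<Rightarrow> real) set" where
  "hermite_space \<omega> a b s =
     (THE H. rkhs (points s) (hermite_kernel \<omega> a b s) H (hermite_ip \<omega> a b s))"

definition hermite_norm ::
  "real \<Rightarrow> (nat \<Rightarrow> real) \<Rightarrow> (nat \<Rightarrow> real) \<Rightarrow> nat \<Rightarrow> ((nat \<Rightarrow> real) \<Rightarrow> real) \<Rightarrow> real" where
  "hermite_norm \<omega> a b s f = sqrt (hermite_ip \<omega> a b s f f)"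


section \<open>Worst-case error and information complexity\<close>

definition linear_algorithm ::
  "nat \<Rightarrow> (nat \<Rightarrow> real) \<Rightarrow> (nat \<Rightarrow> nat \<Rightarrow> real) \<Rightarrow> ((nat \<Rightarrow> real) \<Rightarrow> real) \<Rightarrow> real" where
  "linear_algorithm n \<alpha> x f = (\<Sum>i=1..n. \<alpha> i * f (x i))"

text \<open>
  Integration and point evaluations are bounded functionals on the Hermite space, so the
  supremum below is that of a nonempty bounded set of reals; the infimum in the definition of
  the minimal error is over a nonempty set of nonnegative reals.
\<close>

definition worst_case_error ::
  "real \<Rightarrow> (nat \<Rightarrow> real) \<Rightarrow> (nat \<Rightarrow> real) \<Rightarrow> nat \<Rightarrow> (((nat \<Rightarrow> real) \<Rightarrow> real) \<Rightarrow> real) \<Rightarrow> real" where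
  "worst_case_error \<omega> a b s A =
     (SUP f\<in>{f \<in> hermite_space \<omega> a b s. hermite_norm \<omega> a b s f \<le> 1}. \<bar>gauss_integral s f - A f\<bar>)"

definition min_error ::
  "real \<Rightarrow> (nat \<Rightarrow> real) \<Rightarrow> (nat \<Rightarrow> real) \<Rightarrow> nat \<Rightarrow> nat \<Rightarrow> real" where
  "min_error \<omega> a b n s =
     Inf {worst_case_error \<omega> a b s (linear_algorithm n \<alpha> x) | \<alpha> x. \<forall>i\<in>{1..n}. x i \<in> points s}"

definition info_complexity ::
  "real \<Rightarrow> (nat \<Rightarrow> real) \<Rightarrow> (nat \<Rightarrow> real) \<Rightarrow> real \<Rightarrow> nat \<Rightarrow> nat" where
  "info_complexity \<omega> a b \<epsilon> s = (LEAST n. min_error \<omega> a b n s \<le> \<epsilon>)"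


section \<open>Exponential convergence\<close>

definition EXP :: "real \<Rightarrow> (nat \<Rightarrow> real) \<Rightarrow> (nat \<Rightarrow> real) \<Rightarrow> bool" where
  "EXP \<omega> a b \<longleftrightarrow>
     (\<exists>q\<in>{0<..<1}. \<exists>p C C1 :: nat \<Rightarrow> real.
        (\<forall>s\<ge>1. p s > 0 \<and> C s > 0 \<and> C1 s > 0) \<and>
        (\<forall>s\<ge>1. \<forall>n\<ge>1. min_error \<omega> a b n s \<le> C s * q powr ((real n / C1 s) powr p s)))"

definition UEXP :: "real \<Rightarrow> (nat \<Rightarrow> real) \<Rightarrow> (nat \<Rightarrow> real) \<Rightarrow> bool" where
  "UEXP \<omega> a b \<longleftrightarrow>
     (\<exists>q\<in>{0<..<1}. \<exists>p>0. \<exists>C C1 :: nat \<Rightarrow> real.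
        (\<forall>s\<ge>1. C s > 0 \<and> C1 s > 0) \<and>
        (\<forall>s\<ge>1. \<forall>n\<ge>1. min_error \<omega> a b n s \<le> C s * q powr ((real n / C1 s) powr p)))"

text \<open>
  The rates and the exponent are extended reals, so that a supremum over an unbounded set is
  \<open>\<infinity>\<close> and an infimum over the empty set is \<open>\<infinity>\<close>. The base \<open>q\<close> is a parameter of the rates.
\<close>

definition exp_rate ::
  "real \<Rightarrow> (nat \<Rightarrow> real) \<Rightarrow> (nat \<Rightarrow> real) \<Rightarrow> real \<Rightarrow> nat \<Rightarrow> ereal" where
  "exp_rate \<omega> a b q s =
     (SUP p\<in>{p. p > 0 \<and> (\<exists>C>0. \<exists>C1>0. \<forall>n\<ge>1.
                  min_error \<omega> a b n s \<le> C * q powr ((real n / C1) powr p))}. ereal p)"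

definition uexp_rate ::
  "real \<Rightarrow> (nat \<Rightarrow> real) \<Rightarrow> (nat \<Rightarrow> real) \<Rightarrow> real \<Rightarrow> ereal" where
  "uexp_rate \<omega> a b q =
     (SUP p\<in>{p. p > 0 \<and> (\<exists>C C1 :: nat \<Rightarrow> real.
                  (\<forall>s\<ge>1. C s > 0 \<and> C1 s > 0) \<and>
                  (\<forall>n\<ge>1. \<forall>s\<ge>1.
                     min_error \<omega> a b n s \<le> C s * q powr ((real n / C1 s) powr p)))}. ereal p)"


section \<open>Tractability\<close>

text \<open>The convention \<open>log 0 = 0\<close> is that of \<^const>\<open>ln\<close> on the reals.\<close>

definition EC_WT :: "real \<Rightarrow> (nat \<Rightarrow> real) \<Rightarrow> (nat \<Rightarrow> real) \<Rightarrow> bool" where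
  "EC_WT \<omega> a b \<longleftrightarrow>
     ((\<lambda>(\<epsilon>, s). ln (real (info_complexity \<omega> a b \<epsilon> s)) / (real s + ln (1 / \<epsilon>))) \<longlongrightarrow> 0)
       (inf (filtercomap (\<lambda>(\<epsilon>, s). real s + ln (1 / \<epsilon>)) at_top)
            (principal ({0<..<1} \<times> {1..})))"

definition EC_PT :: "real \<Rightarrow> (nat \<Rightarrow> real) \<Rightarrow> (nat \<Rightarrow> real) \<Rightarrow> bool" where
  "EC_PT \<omega> a b \<longleftrightarrow>
     (\<exists>c\<ge>0. \<exists>\<tau>1\<ge>0. \<exists>\<tau>2\<ge>0. \<forall>s\<ge>1. \<forall>\<epsilon>\<in>{0<..<1}.
        real (info_complexity \<omega> a b \<epsilon> s) \<le> c * real s powr \<tau>1 * (1 + ln (1 / \<epsilon>)) powr \<tau>2)"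

definition EC_SPT_with :: "real \<Rightarrow> (nat \<Rightarrow> real) \<Rightarrow> (nat \<Rightarrow> real) \<Rightarrow> real \<Rightarrow> bool" where
  "EC_SPT_with \<omega> a b \<tau> \<longleftrightarrow>
     (\<exists>c\<ge>0. \<forall>s\<ge>1. \<forall>\<epsilon>\<in>{0<..<1}.
        real (info_complexity \<omega> a b \<epsilon> s) \<le> c * (1 + ln (1 / \<epsilon>)) powr \<tau>)"

definition EC_SPT :: "real \<Rightarrow> (nat \<Rightarrow> real) \<Rightarrow> (nat \<Rightarrow> real) \<Rightarrow> bool" where
  "EC_SPT \<omega> a b \<longleftrightarrow> (\<exists>\<tau>\<ge>0. EC_SPT_with \<omega> a b \<tau>)"

definition EC_SPT_exponent :: "real \<Rightarrow> (nat \<Rightarrow> real) \<Rightarrow> (nat \<Rightarrow> real) \<Rightarrow> ereal" where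
  "EC_SPT_exponent \<omega> a b = (INF \<tau>\<in>{\<tau>. \<tau> \<ge> 0 \<and> EC_SPT_with \<omega> a b \<tau>}. ereal \<tau>)"

end

theory Submission
  imports Defs "HOL-Probability.Distributions" "HOL-Real_Asymp.Real_Asymp"
begin

text \<open>
  Write \<open>e(n,s)\<close> for the minimal error, \<open>E\<close> for the Gaussian mean and \<open>H\<^sub>k\<close> for the Hermite
  polynomials. Everything follows from two estimates for \<open>e(n,s)\<close>:

  \<^item> \<open>min_error_upper\<close>: if all \<open>m j \<ge> 1\<close> and \<open>(\<Prod>j=1..s. m j) \<le> n\<close>, then
    \<open>e(n,s)\<^sup>2 \<le> (\<Prod>j=1..s. 1 + M * \<omega> powr (a j * (2 * m j) powr b j / 2)) - 1\<close>,
    where \<open>M\<close> depends on \<open>\<omega>\<close> only;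
  \<^item> \<open>min_error_lower\<close>: if \<open>n < (\<Prod>j=1..s. t j + 1)\<close>, then
    \<open>e(n,s)\<^sup>2 \<ge> (\<Prod>j=1..s. \<omega> powr (a j * (2 * t j) powr b j) / D (t j))\<close>,
    where \<open>D t = exp (O(t log t))\<close>.

  The space. A function is in the Hermite space iff it is a series \<open>\<Sum>k. c\<^sub>k H\<^sub>k\<close> whose coefficients are
  square summable against the inverse weights (\<open>hermite_space_eq\<close>). The worst-case error of a linear
  rule \<open>A\<close> is then at most the weighted Euclidean norm of \<open>k \<mapsto> E(H\<^sub>k) - A(H\<^sub>k)\<close>
  (\<open>worst_case_error_bdd_above\<close>).

  The upper estimate. For a product of one-dimensional rules with \<open>A\<^sub>j(1) = 1\<close> the square of this norm
  is a product over \<open>j\<close> minus 1. The Gauss-Hermite rule with \<open>m\<close> nodes annihilates \<open>H\<^sub>k\<close> for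
  \<open>0 < k < 2m\<close>. For the other \<open>k\<close> half of the weight is spent on making the error small and the other
  half on summability, for which \<open>\<Sum>k. \<theta>\<^sup>k A(H\<^sub>k)\<^sup>2\<close> must be bounded independently of the number of
  nodes, for \<open>0 < \<theta> < 1\<close> (\<open>gauss_hermite_error_series\<close>). Two facts give this. On the diagonal,
  Mehler's kernel \<open>\<Sum>k. \<theta>\<^sup>k H\<^sub>k(x)\<^sup>2\<close> is a multiple of \<open>exp (\<theta> x\<^sup>2 / (1 + \<theta>))\<close>, because it solves a linear
  differential equation (\<open>hermite_diagonal_eq\<close>). And \<open>A(x\<^sup>i) \<le> E(x\<^sup>i)\<close> for every \<open>i\<close>, because both
  sides come from the same recurrence with nonnegative coefficients, truncated at \<open>n\<close> on the left
  (\<open>gauss_hermite_moment_le\<close>). As \<open>\<theta> / (1 + \<theta>) < 1/2\<close>, the mean of the exponential is finite.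

  The lower estimate. Among the \<open>\<Prod>j. (t\<^sub>j + 1)\<close> polynomials \<open>H\<^sub>k\<close> with \<open>k\<^sub>j \<le> t\<^sub>j\<close> there is a normalised
  combination \<open>f\<close> that vanishes at the \<open>n\<close> nodes. Its square has integral 1, is not seen by the rule, and
  its norm is controlled by the coefficients of the products \<open>H\<^sub>k H\<^sub>l\<close> in the Hermite basis.

  The choice of parameters. Put \<open>B s = (\<Sum>j=1..s. 1 / b j)\<close>. Letting \<open>m j\<close> be the integer part of
  \<open>n powr (p / b j)\<close> is admissible when \<open>p * B s \<le> 1\<close> and gives the rate \<open>p\<close> (\<open>err_exponential\<close>).
  Letting \<open>t j\<close> be the integer part of \<open>T powr (1 / b j)\<close> shows that fewer than \<open>T powr B s\<close> nodes
  cannot bring the error below \<open>exp (- O(T log T))\<close> (\<open>err_lower_growth\<close>), so for fixed \<open>s\<close> neither a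
  rate larger than \<open>1 / B s\<close> nor an exponent of tractability smaller than \<open>B s\<close> is possible. For
  accuracy \<open>\<epsilon>\<close> one takes \<open>m j\<close> about \<open>(c * (1 + ln (1 / \<epsilon>)) / a j) powr (1 / b j)\<close>, but at least 1. A
  coordinate with a single node still has an error governed by \<open>a j * 2 powr b j\<close>; these contributions
  can be summed over \<open>j\<close> both when \<open>1 / b j\<close> is summable and under the growth condition for weak
  tractability (\<open>err_le_of_summable_weights\<close>). If \<open>a j * 2 powr b j\<close> stays bounded, the choice
  \<open>t j = 1\<close> shows that fewer than \<open>2\<^sup>s\<close> nodes leave an error of at least \<open>\<kappa>\<^sup>s\<close> for some \<open>\<kappa> > 0\<close>, which
  rules out weak tractability (\<open>EC_WT_necessary\<close>).
\<close>

section \<open>Hermite polynomials and the one-dimensional Gaussian mean\<close>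

fun hermite_poly :: "nat \<Rightarrow> real poly" where
  "hermite_poly 0 = 1"
| "hermite_poly (Suc k) =
     smult (1 / sqrt (real (Suc k))) ([:0, 1:] * hermite_poly k - pderiv (hermite_poly k))"

text \<open>
  Induction on \<open>k\<close>: differentiating \<open>x H\<^sub>k - H\<^sub>k'\<close> reproduces \<open>H\<^sub>k\<close> once from the factor \<open>x\<close> and \<open>k\<close> times
  from the definition of \<open>H\<^sub>k\<close> itself.
\<close>

lemma pderiv_hermite_poly_Suc:
  "pderiv (hermite_poly (Suc k)) = smult (sqrt (real (Suc k))) (hermite_poly k)"
proof (induction k)
  case 0
  then show ?case by (simp add: pderiv_pCons)
next
  case (Suc k)
  let ?n = "real (Suc k)"
  have step: "smult (sqrt ?n) (hermite_poly (Suc k)) = [:0,1:] * hermite_poly k - pderiv (hermite_poly k)"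
    by (simp add: of_nat_Suc del: of_nat_Suc)
  have "pderiv ([:0,1:] * hermite_poly (Suc k) - pderiv (hermite_poly (Suc k)))
      = hermite_poly (Suc k) + [:0,1:] * smult (sqrt ?n) (hermite_poly k)
        - smult (sqrt ?n) (pderiv (hermite_poly k))"
    by (simp only: pderiv_diff pderiv_mult Suc pderiv_smult) (simp add: pderiv_pCons)
  also have "\<dots> = hermite_poly (Suc k) + smult (sqrt ?n) ([:0,1:] * hermite_poly k - pderiv (hermite_poly k))"
    by (simp add: smult_diff_right del: hermite_poly.simps)
  also have "\<dots> = hermite_poly (Suc k) + smult ?n (hermite_poly (Suc k))"
    by (simp only: step[symmetric] smult_smult) simp
  also have "\<dots> = smult (real (Suc (Suc k))) (hermite_poly (Suc k))"
    by (simp add: smult_add_left[symmetric] del: hermite_poly.simps)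
      (metis add.commute add.left_commute one_add_one smult_1_left smult_add_left)
  finally have *: "pderiv ([:0,1:] * hermite_poly (Suc k) - pderiv (hermite_poly (Suc k)))
     = smult (real (Suc (Suc k))) (hermite_poly (Suc k))" .
  show ?case
    unfolding hermite_poly.simps(2)[of "Suc k"] pderiv_smult *
    by (simp only: smult_smult) (simp add: real_div_sqrt del: of_nat_Suc hermite_poly.simps)
qed

lemma hermite_poly_recurrence:
  "[:0, 1:] * hermite_poly k =
     smult (sqrt (real (Suc k))) (hermite_poly (Suc k)) + smult (sqrt (real k)) (hermite_poly (k - 1))"
proof -
  have "smult (sqrt (real (Suc k))) (hermite_poly (Suc k)) = [:0,1:] * hermite_poly k - pderiv (hermite_poly k)"
    by (simp del: of_nat_Suc)
  moreover have "pderiv (hermite_poly k) = smult (sqrt (real k)) (hermite_poly (k - 1))"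
    by (cases k) (simp_all add: pderiv_hermite_poly_Suc del: hermite_poly.simps(2))
  ultimately show ?thesis by simp
qed

lemma poly_hermite_poly_recurrence:
  "x * poly (hermite_poly k) x =
     sqrt (real (Suc k)) * poly (hermite_poly (Suc k)) x + sqrt (real k) * poly (hermite_poly (k - 1)) x"
  using arg_cong[OF hermite_poly_recurrence[of k], of "\<lambda>p. poly p x"]
  by (simp only: poly_mult poly_add poly_smult) simp

lemma degree_hermite_poly: "degree (hermite_poly k) = k"
proof (induction k)
  case (Suc k)
  have "hermite_poly k \<noteq> 0"
    using Suc by (cases k) (auto simp del: hermite_poly.simps(2))
  then have "degree ([:0,1:] * hermite_poly k) = Suc k"
    using Suc by (simp add: degree_pCons_eq)
  moreover have "degree (pderiv (hermite_poly k)) < Suc k"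
    using degree_pderiv[of "hermite_poly k"] Suc by linarith
  ultimately have "degree ([:0,1:] * hermite_poly k - pderiv (hermite_poly k)) = Suc k"
    by (metis degree_add_eq_left degree_minus diff_conv_add_uminus)
  then show ?case by simp
qed simp

lemma hermite_poly_nonzero: "hermite_poly k \<noteq> 0"
  using degree_hermite_poly[of k] by (cases k) (auto simp del: hermite_poly.simps(2))

lemma deriv_gauss_iterated:
  "(deriv ^^ k) (\<lambda>t. exp (- t\<^sup>2 / 2)) =
     (\<lambda>t. (-1) ^ k * sqrt (fact k) * poly (hermite_poly k) t * exp (- t\<^sup>2 / 2))"
proof (induction k)
  case (Suc k)
  have "deriv (\<lambda>t. (-1) ^ k * sqrt (fact k) * poly (hermite_poly k) t * exp (- t\<^sup>2 / 2)) t =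
        (-1) ^ Suc k * sqrt (fact (Suc k)) * poly (hermite_poly (Suc k)) t * exp (- t\<^sup>2 / 2)" for t :: real
  proof -
    have "sqrt (fact k + fact k * real k) = sqrt (fact k) * sqrt (1 + real k)"
      by (simp add: real_sqrt_mult[symmetric] algebra_simps)
    then show ?thesis
      by (intro DERIV_imp_deriv)
        (auto intro!: derivative_eq_intros poly_DERIV simp: field_simps)
  qed
  with Suc show ?case by simp
qed simp

lemma hermite1_eq_poly: "hermite1 k x = poly (hermite_poly k) x"
proof -
  have "exp (x\<^sup>2 / 2) * exp (- x\<^sup>2 / 2) = 1" by (simp add: exp_add[symmetric])
  then show ?thesis
    unfolding hermite1_def deriv_gauss_iterated
    by (simp add: field_simps power_mult_distrib[symmetric] mult.left_commute)
qed

lemma hermite1_0: "hermite1 0 x = 1"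
  by (simp add: hermite1_eq_poly)

lemma hermite1_recurrence:
  "x * hermite1 k x = sqrt (real (Suc k)) * hermite1 (Suc k) x + sqrt (real k) * hermite1 (k - 1) x"
  unfolding hermite1_eq_poly by (rule poly_hermite_poly_recurrence)

lemma hermite1_has_derivative:
  "(hermite1 k has_field_derivative sqrt (real k) * hermite1 (k - 1) x) (at x within S)"
proof -
  have "pderiv (hermite_poly k) = smult (sqrt (real k)) (hermite_poly (k - 1))"
    by (cases k) (simp_all add: pderiv_hermite_poly_Suc del: hermite_poly.simps(2))
  then have "((\<lambda>x. poly (hermite_poly k) x) has_field_derivative sqrt (real k) * hermite1 (k - 1) x) (at x)"
    using poly_DERIV[of "hermite_poly k" x] by (simp add: hermite1_eq_poly)
  then show ?thesis
    by (metis has_field_derivative_at_within hermite1_eq_poly ext)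
qed

subsection \<open>Growth in the degree\<close>

text \<open>
  A majorant of \<open>\<bar>H\<^sub>k(x)\<bar>\<close> on \<open>\<bar>x\<bar> \<le> r\<close>. Its quotient of consecutive terms tends to 1, so it grows more slowly
  than any geometric progression; this is what series with weights \<open>\<theta>\<^sup>k\<close>, \<open>\<theta> < 1\<close>, require.
\<close>

definition hermite_majorant :: "nat \<Rightarrow> real \<Rightarrow> real" where
  "hermite_majorant k r = (\<Prod>i=1..k. 1 + r / sqrt (real i))"

lemma hermite_majorant_Suc:
  "hermite_majorant (Suc k) r = hermite_majorant k r * (1 + r / sqrt (real (Suc k)))"
  unfolding hermite_majorant_def by (simp add: prod.nat_ivl_Suc')

lemma hermite_majorant_pos: "r \<ge> 0 \<Longrightarrow> hermite_majorant k r > 0"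
  unfolding hermite_majorant_def by (intro prod_pos) (auto intro: add_pos_nonneg)

lemma hermite_majorant_mono: "0 \<le> r \<Longrightarrow> k \<le> l \<Longrightarrow> hermite_majorant k r \<le> hermite_majorant l r"
proof (induction l)
  case (Suc l)
  have "hermite_majorant l r \<le> hermite_majorant (Suc l) r"
    using hermite_majorant_pos[OF Suc.prems(1), of l] Suc.prems(1)
    by (simp add: hermite_majorant_Suc field_simps mult_nonneg_nonneg)
  with Suc show ?case by (cases "k = Suc l") auto
qed simp

text \<open>
  By the three-term recurrence \<open>\<bar>H\<^sub>k\<^sub>+\<^sub>1\<bar> \<le> \<bar>x\<bar> \<bar>H\<^sub>k\<bar> / \<surd>(k+1) + \<bar>H\<^sub>k\<^sub>-\<^sub>1\<bar>\<close>, and the majorant increases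
      with \<open>k\<close>.
\<close>

lemma hermite1_bound:
  assumes "\<bar>x\<bar> \<le> r"
  shows "\<bar>hermite1 k x\<bar> \<le> hermite_majorant k r"
proof (induction k rule: less_induct)
  case (less k)
  have r: "r \<ge> 0" using assms by linarith
  show ?case
  proof (cases k)
    case 0
    then show ?thesis by (simp add: hermite1_0 hermite_majorant_def)
  next
    case (Suc m)
    have s: "sqrt (real (Suc m)) > 0" by simp
    have h: "sqrt (real (Suc m)) * hermite1 (Suc m) x = x * hermite1 m x - sqrt (real m) * hermite1 (m - 1) x"
      using hermite1_recurrence[of x m] by linarith
    have m: "\<bar>hermite1 m x\<bar> \<le> hermite_majorant m r" using less Suc by auto
    have m1: "sqrt (real m) * \<bar>hermite1 (m - 1) x\<bar> \<le> sqrt (real (Suc m)) * hermite_majorant m r"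
    proof (cases m)
      case 0
      then show ?thesis using hermite_majorant_pos[OF r, of m] by simp
    next
      case (Suc l)
      have "\<bar>hermite1 (m - 1) x\<bar> \<le> hermite_majorant (m - 1) r" using less Suc \<open>k = Suc m\<close> by auto
      also have "\<dots> \<le> hermite_majorant m r" by (rule hermite_majorant_mono[OF r]) simp
      finally show ?thesis by (intro mult_mono) auto
    qed
    have "sqrt (real (Suc m)) * \<bar>hermite1 (Suc m) x\<bar> = \<bar>x * hermite1 m x - sqrt (real m) * hermite1 (m - 1) x\<bar>"
      unfolding h[symmetric] by (simp add: abs_mult del: of_nat_Suc)
    also have "\<dots> \<le> \<bar>x\<bar> * \<bar>hermite1 m x\<bar> + sqrt (real m) * \<bar>hermite1 (m - 1) x\<bar>"
      by (metis abs_mult abs_of_nonneg abs_triangle_ineq4 of_nat_0_le_iff real_sqrt_ge_zero)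
    also have "\<bar>x\<bar> * \<bar>hermite1 m x\<bar> \<le> r * hermite_majorant m r"
      using m assms r by (intro mult_mono) auto
    also note m1
    finally have "sqrt (real (Suc m)) * \<bar>hermite1 (Suc m) x\<bar> \<le> (r + sqrt (real (Suc m))) * hermite_majorant m r"
      by (simp add: algebra_simps)
    then have "\<bar>hermite1 (Suc m) x\<bar> \<le> (r + sqrt (real (Suc m))) * hermite_majorant m r / sqrt (real (Suc m))"
      using s by (simp add: pos_le_divide_eq mult.commute)
    also have "\<dots> = hermite_majorant (Suc m) r"
      using s by (simp add: hermite_majorant_Suc field_simps del: of_nat_Suc)
    finally show ?thesis using Suc by simp
  qed
qed

text \<open>
  The extra factor \<open>\<surd>(k+1)\<close> and the index \<open>k+1\<close> make the lemma applicable to the differentiated Mehler series.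
\<close>

lemma summable_power_hermite_majorant:
  assumes "0 < \<theta>" "\<theta> < 1" "0 \<le> r"
  shows "summable (\<lambda>k. sqrt (real (Suc k)) * (\<theta> ^ k * (hermite_majorant (Suc k) r)\<^sup>2))"
proof -
  let ?f = "\<lambda>k. sqrt (real (Suc k)) * (\<theta> ^ k * (hermite_majorant (Suc k) r)\<^sup>2)"
  let ?q = "\<lambda>k. sqrt (real (Suc (Suc k)) / real (Suc k)) * \<theta> * (1 + r / sqrt (real (Suc (Suc k))))\<^sup>2"
  have ratio: "?f (Suc k) = ?q k * ?f k" for k
  proof -
    have "?q k * ?f k = (sqrt (real (Suc (Suc k)) / real (Suc k)) * sqrt (real (Suc k))) *
        (\<theta> ^ Suc k * (hermite_majorant (Suc k) r * (1 + r / sqrt (real (Suc (Suc k)))))\<^sup>2)"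
      unfolding power_mult_distrib power_Suc by (simp only: mult_ac)
    also have "sqrt (real (Suc (Suc k)) / real (Suc k)) * sqrt (real (Suc k)) = sqrt (real (Suc (Suc k)))"
      by (simp add: real_sqrt_divide del: of_nat_Suc)
    finally show ?thesis by (simp only: hermite_majorant_Suc[of "Suc k"])
  qed
  have "?q \<longlonglongrightarrow> sqrt 1 * \<theta> * (1 + 0)\<^sup>2"
  proof (intro tendsto_intros)
    have "(\<lambda>k. 1 + 1 / real (Suc k)) \<longlonglongrightarrow> 1 + 0"
      by (intro tendsto_intros) (use LIMSEQ_inverse_real_of_nat in \<open>simp add: inverse_eq_divide\<close>)
    then show "(\<lambda>k. real (Suc (Suc k)) / real (Suc k)) \<longlonglongrightarrow> 1"
      by (simp add: field_simps)
    have "(\<lambda>k. r * sqrt (inverse (real (Suc (Suc k))))) \<longlonglongrightarrow> r * sqrt 0"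
      by (intro tendsto_intros) (rule LIMSEQ_Suc[OF LIMSEQ_inverse_real_of_nat])
    then show "(\<lambda>k. r / sqrt (real (Suc (Suc k)))) \<longlonglongrightarrow> 0"
      by (simp add: real_sqrt_inverse divide_inverse)
  qed
  then have lim: "?q \<longlonglongrightarrow> \<theta>" by simp
  obtain c where c: "\<theta> < c" "c < 1" using assms dense by blast
  obtain N where N: "\<And>k. k \<ge> N \<Longrightarrow> ?q k < c"
    using order_tendstoD(2)[OF lim c(1)] unfolding eventually_sequentially by blast
  have nn: "?f k \<ge> 0" for k using assms by simp
  show ?thesis
  proof (rule summable_ratio_test[OF c(2)])
    fix n assume "n \<ge> N"
    then have "?q n * ?f n \<le> c * ?f n" using N[of n] nn[of n] by (intro mult_right_mono) auto
    then show "norm (?f (Suc n)) \<le> c * norm (?f n)"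
      using nn[of "Suc n"] nn[of n] ratio[of n] by (simp only: real_norm_def abs_of_nonneg)
  qed
qed

lemma summable_power_hermite1_sq:
  assumes "0 < \<theta>" "\<theta> < 1"
  shows "summable (\<lambda>k. \<theta> ^ k * (hermite1 k x)\<^sup>2)"
proof (rule summable_comparison_test'[OF summable_power_hermite_majorant[OF assms, of "\<bar>x\<bar>"], of 0])
  fix k
  have "\<bar>hermite1 k x\<bar> \<le> hermite_majorant (Suc k) \<bar>x\<bar>"
    using hermite1_bound[of x "\<bar>x\<bar>" k] hermite_majorant_mono[of "\<bar>x\<bar>" k "Suc k"] by linarith
  then have "(hermite1 k x)\<^sup>2 \<le> (hermite_majorant (Suc k) \<bar>x\<bar>)\<^sup>2"
    by (metis abs_ge_zero power2_abs power_mono)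
  then have "\<theta> ^ k * (hermite1 k x)\<^sup>2 \<le> 1 * (\<theta> ^ k * (hermite_majorant (Suc k) \<bar>x\<bar>)\<^sup>2)"
    using assms by (simp add: mult_left_mono)
  also have "\<dots> \<le> sqrt (real (Suc k)) * (\<theta> ^ k * (hermite_majorant (Suc k) \<bar>x\<bar>)\<^sup>2)"
    using assms by (intro mult_right_mono) auto
  finally show "norm (\<theta> ^ k * (hermite1 k x)\<^sup>2) \<le> \<dots>"
    using assms by simp
qed simp

subsection \<open>The Gaussian mean of a polynomial\<close>

definition gauss_mean :: "real poly \<Rightarrow> real" where
  "gauss_mean p = (\<integral>x. poly p x * std_normal_density x \<partial>lborel)"

lemma integrable_poly_gauss: "integrable lborel (\<lambda>x. poly p x * std_normal_density x)"
proof -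
  have "integrable lborel (\<lambda>x. \<Sum>i\<le>degree p. coeff p i * (std_normal_density x * x ^ i))"
    by (intro Bochner_Integration.integrable_sum integrable_mult_right integrable_std_normal_moment)
  moreover have "(\<lambda>x. poly p x * std_normal_density x) =
      (\<lambda>x. \<Sum>i\<le>degree p. coeff p i * (std_normal_density x * x ^ i))"
    unfolding poly_altdef sum_distrib_right by (simp add: mult_ac)
  ultimately show ?thesis by (simp only:)
qed

lemma gauss_mean_add: "gauss_mean (p + q) = gauss_mean p + gauss_mean q"
  unfolding gauss_mean_def
  by (simp add: distrib_right Bochner_Integration.integral_add integrable_poly_gauss)

lemma gauss_mean_smult: "gauss_mean (smult c p) = c * gauss_mean p"
  unfolding gauss_mean_def by (simp add: mult.assoc)

lemma gauss_mean_0 [simp]: "gauss_mean 0 = 0"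
  unfolding gauss_mean_def by simp

lemma gauss_mean_diff: "gauss_mean (p - q) = gauss_mean p - gauss_mean q"
  using gauss_mean_add[of "p - q" q] by simp

lemma gauss_mean_sum: "gauss_mean (sum f A) = (\<Sum>i\<in>A. gauss_mean (f i))"
  by (induction A rule: infinite_finite_induct) (simp_all add: gauss_mean_add)

lemma gauss_mean_nonneg: "(\<And>x. poly p x \<ge> 0) \<Longrightarrow> gauss_mean p \<ge> 0"
  unfolding gauss_mean_def by (intro integral_nonneg_AE) auto

lemma gauss_mean_monom_even: "gauss_mean (monom 1 (2 * k)) = fact (2 * k) / (2 ^ k * fact k)"
  unfolding gauss_mean_def poly_monom using integral_std_normal_moment_even[of k] by (simp add: mult.commute)

lemma gauss_mean_monom_odd: "gauss_mean (monom 1 (2 * k + 1)) = 0"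
  unfolding gauss_mean_def poly_monom using integral_std_normal_moment_odd[of k] by (simp add: mult.commute)

lemma gauss_mean_1 [simp]: "gauss_mean 1 = 1"
  using gauss_mean_monom_even[of 0] by (simp add: monom_0 one_pCons)

text \<open>
  Integration by parts against the Gaussian density; for monomials it is the recurrence of the Gaussian moments.
\<close>

lemma gauss_mean_times_x: "gauss_mean ([:0, 1:] * p) = gauss_mean (pderiv p)"
proof -
  have mono: "gauss_mean (monom 1 (Suc i)) = real i * gauss_mean (monom 1 (i - 1))" for i
  proof (cases "even i")
    case True
    then obtain k where k: "i = 2 * k" by (auto elim: evenE)
    have "gauss_mean (monom 1 (Suc i)) = 0" using gauss_mean_monom_odd[of k] k by simp
    moreover have "real i * gauss_mean (monom 1 (i - 1)) = 0"
    proof (cases k)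
      case (Suc l)
      have "i - 1 = 2 * l + 1" using k Suc by simp
      then show ?thesis using gauss_mean_monom_odd[of l] by simp
    qed (use k in simp)
    ultimately show ?thesis by simp
  next
    case False
    then obtain k where k: "i = 2 * k + 1" by (auto elim: oddE)
    have 1: "Suc i = 2 * Suc k" using k by simp
    have 2: "i - 1 = 2 * k" using k by simp
    show ?thesis unfolding 1 2 gauss_mean_monom_even
      by (simp add: k field_simps del: of_nat_Suc) (simp add: algebra_simps)
  qed
  have p: "p = (\<Sum>i\<le>degree p. smult (coeff p i) (monom 1 i))"
    by (simp add: smult_monom poly_as_sum_of_monoms)
  have "gauss_mean ([:0, 1:] * p) = (\<Sum>i\<le>degree p. coeff p i * gauss_mean (monom 1 (Suc i)))"
  proof -
    have "[:0, 1:] * p = (\<Sum>i\<le>degree p. smult (coeff p i) (monom 1 (Suc i)))"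
      using arg_cong[OF p, of "(*) [:0, 1:]"] unfolding sum_distrib_left
      by (simp add: monom_Suc)
    then show ?thesis by (simp add: gauss_mean_sum gauss_mean_smult)
  qed
  also have "\<dots> = (\<Sum>i\<le>degree p. coeff p i * (real i * gauss_mean (monom 1 (i - 1))))"
    by (simp add: mono)
  also have "\<dots> = gauss_mean (pderiv p)"
  proof -
    have "pderiv p = (\<Sum>i\<le>degree p. smult (coeff p i) (smult (real i) (monom 1 (i - 1))))"
    proof -
      have "pderiv (sum f A) = (\<Sum>i\<in>A. pderiv (f i))" for f :: "nat \<Rightarrow> real poly" and A
        by (induction A rule: infinite_finite_induct) (simp_all add: pderiv_add)
      then show ?thesis
        using arg_cong[OF p, of pderiv] by (simp add: pderiv_smult pderiv_monom smult_monom mult.commute)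
    qed
    then show ?thesis by (simp add: gauss_mean_sum gauss_mean_smult mult.assoc)
  qed
  finally show ?thesis .
qed

text \<open>
  Multiplication by \<open>x\<close> minus differentiation is the adjoint of differentiation with respect to \<open>E\<close>. All
  orthogonality relations below are obtained by moving derivatives with this identity.
\<close>

lemma gauss_mean_hermite_Suc:
  "sqrt (real (Suc k)) * gauss_mean (hermite_poly (Suc k) * p) = gauss_mean (hermite_poly k * pderiv p)"
proof -
  have "smult (sqrt (real (Suc k))) (hermite_poly (Suc k)) = [:0,1:] * hermite_poly k - pderiv (hermite_poly k)"
    by (simp del: of_nat_Suc)
  then have "smult (sqrt (real (Suc k))) (hermite_poly (Suc k) * p)
      = [:0,1:] * (hermite_poly k * p) - pderiv (hermite_poly k) * p"
    by (metis mult.assoc mult_smult_left left_diff_distrib)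
  then have "sqrt (real (Suc k)) * gauss_mean (hermite_poly (Suc k) * p)
     = gauss_mean (pderiv (hermite_poly k * p)) - gauss_mean (pderiv (hermite_poly k) * p)"
    by (metis gauss_mean_smult gauss_mean_diff gauss_mean_times_x)
  then show ?thesis
    by (simp add: pderiv_mult gauss_mean_add mult.commute)
qed

lemma gauss_mean_hermite_low_degree:
  "degree p < k \<Longrightarrow> gauss_mean (hermite_poly k * p) = 0"
proof (induction k arbitrary: p)
  case (Suc k)
  have "gauss_mean (hermite_poly k * pderiv p) = 0"
  proof (cases "degree p = 0")
    case True
    then show ?thesis by (simp add: pderiv_eq_0_iff[THEN iffD2])
  next
    case False
    then show ?thesis using Suc by (intro Suc.IH) (simp add: degree_pderiv)
  qed
  then show ?case using gauss_mean_hermite_Suc[of k p] by simp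
qed simp

lemma gauss_mean_orthonormal:
  "gauss_mean (hermite_poly k * hermite_poly l) = (if k = l then 1 else 0)"
proof (induction k arbitrary: l)
  case 0
  show ?case using gauss_mean_hermite_low_degree[of 1 l] by (cases l) auto
next
  case (Suc k)
  show ?case
  proof (cases l)
    case 0
    then show ?thesis using gauss_mean_hermite_low_degree[of 1 "Suc k"] by simp
  next
    case (Suc m)
    have "sqrt (real (Suc k)) * gauss_mean (hermite_poly (Suc k) * hermite_poly l) =
        sqrt (real (Suc m)) * (if k = m then 1 else 0)"
      unfolding gauss_mean_hermite_Suc Suc pderiv_hermite_poly_Suc mult_smult_right gauss_mean_smult Suc.IH ..
    then show ?thesis using Suc by (auto split: if_splits simp del: of_nat_Suc hermite_poly.simps)
  qed
qed

lemma gauss_mean_hermite: "gauss_mean (hermite_poly k) = (if k = 0 then 1 else 0)"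
  using gauss_mean_orthonormal[of k 0] by simp

lemma gauss_mean_triple_recurrence:
  "sqrt (real (Suc k)) * gauss_mean (hermite_poly (Suc k) * (hermite_poly l * hermite_poly m)) =
     sqrt (real l) * gauss_mean (hermite_poly k * (hermite_poly (l - 1) * hermite_poly m)) +
     sqrt (real m) * gauss_mean (hermite_poly k * (hermite_poly l * hermite_poly (m - 1)))"
proof -
  have d: "pderiv (hermite_poly k) = smult (sqrt (real k)) (hermite_poly (k - 1))" for k
    by (cases k) (simp_all add: pderiv_hermite_poly_Suc del: hermite_poly.simps(2))
  show ?thesis
    unfolding gauss_mean_hermite_Suc pderiv_mult d
    by (simp add: gauss_mean_add[symmetric] gauss_mean_smult[symmetric] algebra_simps del: hermite_poly.simps)
qed

text \<open>
  The recurrence for \<open>E(H\<^sub>k H\<^sub>l H\<^sub>m)\<close> has nonnegative coefficients of size at most \<open>l + m\<close> in total. The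
  resulting bound is crude, but its logarithm is of order \<open>k log (l + m)\<close>, which is negligible for the rates.
\<close>

lemma gauss_mean_triple_bounds:
  "0 \<le> gauss_mean (hermite_poly k * (hermite_poly l * hermite_poly m)) \<and>
   gauss_mean (hermite_poly k * (hermite_poly l * hermite_poly m)) \<le> real (l + m) ^ k"
proof (induction k arbitrary: l m)
  case 0
  show ?case by (simp add: gauss_mean_orthonormal)
next
  case (Suc k)
  let ?c = "\<lambda>k l m. gauss_mean (hermite_poly k * (hermite_poly l * hermite_poly m))"
  have sq: "sqrt (real l) \<le> real l" for l :: nat
    by (cases l) (auto intro!: real_le_lsqrt simp: power2_eq_square algebra_simps)
  have "sqrt (real (Suc k)) * ?c (Suc k) l m \<ge> 0"
    unfolding gauss_mean_triple_recurrence using Suc by (intro add_nonneg_nonneg mult_nonneg_nonneg) auto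
  then have 1: "?c (Suc k) l m \<ge> 0"
    by (simp add: zero_le_mult_iff del: hermite_poly.simps of_nat_Suc)
  have b: "?c k (l - 1) m \<le> real (l + m) ^ k" "?c k l (m - 1) \<le> real (l + m) ^ k"
    using Suc[of "l - 1" m] Suc[of l "m - 1"]
    by (meson diff_le_self add_mono order.refl of_nat_mono of_nat_0_le_iff power_mono order_trans)+
  have "?c (Suc k) l m \<le> sqrt (real (Suc k)) * ?c (Suc k) l m"
    using 1 by (simp add: mult_le_cancel_right1 del: hermite_poly.simps of_nat_Suc)
  also have "\<dots> \<le> real l * real (l + m) ^ k + real m * real (l + m) ^ k"
    unfolding gauss_mean_triple_recurrence using Suc b sq
    by (intro add_mono mult_mono) auto
  also have "\<dots> = real (l + m) ^ Suc k" by (simp add: algebra_simps)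
  finally show ?case using 1 by simp
qed

section \<open>Gauss-Hermite quadrature\<close>

subsection \<open>Real roots of the Hermite polynomials\<close>

text \<open>
  Rolle's theorem on a half-line. If \<open>f(a + 1) \<noteq> 0\<close>, then far out \<open>\<bar>f\<bar>\<close> is smaller than there, so
  \<open>f\<^sup>2\<close> has an interior maximum at a point where \<open>f\<close> does not vanish.
\<close>

lemma critical_point_right_of_zero:
  fixes f f' :: "real \<Rightarrow> real"
  assumes der: "\<And>x. (f has_field_derivative f' x) (at x)"
    and lim: "(f \<longlongrightarrow> 0) at_top" and "f a = 0"
  shows "\<exists>c>a. f' c = 0"
proof (cases "f (a + 1) = 0")
  case True
  have "\<exists>c>a. c < a + 1 \<and> DERIV f c :> 0"
    using True assms(3) der
    by (intro Rolle) (auto intro: DERIV_isCont DERIV_continuous_on has_field_derivative_at_within simp: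
        real_differentiable_def)
  then obtain c where "c > a" "DERIV f c :> 0" by blast
  then show ?thesis using der DERIV_unique by blast
next
  case False
  have "eventually (\<lambda>d. \<bar>f d\<bar> < \<bar>f (a + 1)\<bar> \<and> d > a + 1) at_top"
    using tendstoD[OF lim, of "\<bar>f (a + 1)\<bar>"] False eventually_gt_at_top[of "a + 1"]
    by (auto elim!: eventually_elim2 simp: dist_real_def)
  then obtain d where d: "\<bar>f d\<bar> < \<bar>f (a + 1)\<bar>" "d > a + 1"
    by (auto simp: eventually_at_top_linorder)
  have cont: "continuous_on {a..d} (\<lambda>x. (f x)\<^sup>2)"
    using der by (intro continuous_intros DERIV_continuous_on) (auto intro: has_field_derivative_at_within)
  obtain c where c: "c \<in> {a..d}" "\<And>y. y \<in> {a..d} \<Longrightarrow> (f y)\<^sup>2 \<le> (f c)\<^sup>2"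
    using continuous_attains_sup[OF compact_Icc _ cont] d by auto
  have big: "(f (a + 1))\<^sup>2 \<le> (f c)\<^sup>2" using c(2)[of "a + 1"] d by auto
  then have nz: "f c \<noteq> 0" using False by auto
  have "c \<noteq> a" using nz assms(3) by auto
  moreover have "c \<noteq> d" using big d(1) by (metis abs_le_square_iff not_le)
  ultimately have int: "a < c" "c < d" using c(1) by auto
  have "DERIV (\<lambda>x. (f x)\<^sup>2) c :> 2 * f c * f' c"
    by (auto intro!: derivative_eq_intros der)
  moreover have "\<forall>y. \<bar>c - y\<bar> < min (c - a) (d - c) \<longrightarrow> (f y)\<^sup>2 \<le> (f c)\<^sup>2"
    by (intro allI impI c(2)) (auto simp: abs_if split: if_splits)
  ultimately have "2 * f c * f' c = 0"
    using int by (intro DERIV_local_max[of "\<lambda>x. (f x)\<^sup>2" _ c "min (c - a) (d - c)"]) auto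
  then show ?thesis using nz int by auto
qed

lemma critical_point_left_of_zero:
  fixes f f' :: "real \<Rightarrow> real"
  assumes der: "\<And>x. (f has_field_derivative f' x) (at x)"
    and lim: "(f \<longlongrightarrow> 0) at_bot" and "f a = 0"
  shows "\<exists>c<a. f' c = 0"
proof -
  have "((\<lambda>x. f (- x)) has_field_derivative - f' (- x)) (at x)" for x
    using DERIV_mirror[of f "f' (- x)" x] der by simp
  moreover have "((\<lambda>x. f (- x)) \<longlongrightarrow> 0) at_top"
    using lim by (simp add: filterlim_at_bot_mirror)
  ultimately have "\<exists>c>-a. - f' (- c) = 0"
    using assms(3) by (intro critical_point_right_of_zero[of "\<lambda>x. f (- x)" "\<lambda>x. - f' (- x)"]) auto
  then obtain c where "c > - a" "f' (- c) = 0" by auto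
  then show ?thesis by (intro exI[of _ "- c"]) auto
qed

lemma critical_points_right_of_zeros:
  fixes f f' :: "real \<Rightarrow> real"
  assumes der: "\<And>x. (f has_field_derivative f' x) (at x)"
    and lim: "(f \<longlongrightarrow> 0) at_top"
    and "finite X" "X \<noteq> {}" "\<And>x. x \<in> X \<Longrightarrow> f x = 0"
  shows "\<exists>Y. finite Y \<and> card Y = card X \<and> (\<forall>y\<in>Y. f' y = 0 \<and> Min X < y)"
  using assms(3-)
proof (induction X rule: finite_linorder_min_induct)
  case (insert b A)
  show ?case
  proof (cases "A = {}")
    case True
    obtain c where "c > b" "f' c = 0"
      using critical_point_right_of_zero[OF der lim, of b] insert.prems by auto
    then show ?thesis using True by (intro exI[of _ "{c}"]) auto
  next
    case False
    obtain Y where Y: "finite Y" "card Y = card A" "\<forall>y\<in>Y. f' y = 0 \<and> Min A < y"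
      using insert False by auto
    have mA: "Min A \<in> A" using insert(1) False by simp
    then have b: "b < Min A" using insert by auto
    have "\<exists>c>b. c < Min A \<and> DERIV f c :> 0"
      using b insert.prems mA der
      by (intro Rolle) (auto intro: DERIV_isCont DERIV_continuous_on has_field_derivative_at_within
          simp: real_differentiable_def)
    then obtain c where c: "c > b" "c < Min A" "f' c = 0" using der DERIV_unique by blast
    have "c \<notin> Y" using Y(3) c by auto
    moreover have "Min (insert b A) = b" using insert(1,2) by (intro Min_eqI) auto
    ultimately show ?thesis
      using Y c insert b by (intro exI[of _ "insert c Y"]) auto
  qed
qed simp

text \<open>
  One critical point between neighbouring zeros and one on each unbounded side.
\<close>

lemma more_critical_points_than_zeros:
  fixes f f' :: "real \<Rightarrow> real"
  assumes der: "\<And>x. (f has_field_derivative f' x) (at x)"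
    and lim: "(f \<longlongrightarrow> 0) at_top" "(f \<longlongrightarrow> 0) at_bot"
    and X: "finite X" "X \<noteq> {}" "\<And>x. x \<in> X \<Longrightarrow> f x = 0"
  shows "\<exists>Y. finite Y \<and> card Y = Suc (card X) \<and> (\<forall>y\<in>Y. f' y = 0)"
proof -
  obtain Y where Y: "finite Y" "card Y = card X" "\<forall>y\<in>Y. f' y = 0 \<and> Min X < y"
    using critical_points_right_of_zeros[OF der lim(1) X] by blast
  obtain c where c: "c < Min X" "f' c = 0"
    using critical_point_left_of_zero[OF der lim(2), of "Min X"] X by auto
  have "c \<notin> Y" using Y(3) c by auto
  then show ?thesis using Y c by (intro exI[of _ "insert c Y"]) auto
qed

lemma poly_times_gauss_tendsto_0:
  fixes p :: "real poly"
  shows "((\<lambda>x. poly p x * exp (- x\<^sup>2 / 2)) \<longlongrightarrow> 0) at_top"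
    and "((\<lambda>x. poly p x * exp (- x\<^sup>2 / 2)) \<longlongrightarrow> 0) at_bot"
proof -
  have top: "((\<lambda>x. poly p x * exp (- x\<^sup>2 / 2)) \<longlongrightarrow> 0) at_top" for p :: "real poly"
  proof -
    have "((\<lambda>x::real. \<Sum>i\<le>degree p. coeff p i * (x ^ i * exp (- x\<^sup>2 / 2))) \<longlongrightarrow> (\<Sum>i\<le>degree p. coeff p i *
        0)) at_top"
      by (intro tendsto_intros) real_asymp
    then show ?thesis by (simp add: poly_altdef sum_distrib_right mult.assoc)
  qed
  show "((\<lambda>x. poly p x * exp (- x\<^sup>2 / 2)) \<longlongrightarrow> 0) at_top" by (rule top)
  show "((\<lambda>x. poly p x * exp (- x\<^sup>2 / 2)) \<longlongrightarrow> 0) at_bot"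
    using top[of "pcompose p [:0, -1:]"] by (simp add: filterlim_at_bot_mirror poly_pcompose)
qed

text \<open>
  The derivative of \<open>H\<^sub>n exp (- x\<^sup>2 / 2)\<close> is a nonzero multiple of \<open>H\<^sub>n\<^sub>+\<^sub>1 exp (- x\<^sup>2 / 2)\<close>,
      and both tend to 0 at
  infinity. So each step from \<open>n\<close> to \<open>n + 1\<close> produces one more root.
\<close>

lemma hermite_poly_real_roots:
  "\<exists>X. finite X \<and> card X = n \<and> (\<forall>x\<in>X. poly (hermite_poly n) x = 0)"
proof (induction n)
  case (Suc n)
  show ?case
  proof (cases "n = 0")
    case True
    then show ?thesis by (intro exI[of _ "{0}"]) (simp add: pderiv_1)
  next
    case False
    obtain X where X: "finite X" "card X = n" "\<forall>x\<in>X. poly (hermite_poly n) x = 0"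
      using Suc by blast
    let ?f = "\<lambda>x. poly (hermite_poly n) x * exp (- x\<^sup>2 / 2)"
    let ?f' = "\<lambda>x. - (sqrt (real (Suc n)) * poly (hermite_poly (Suc n)) x) * exp (- x\<^sup>2 / 2)"
    have "(?f has_field_derivative ?f' x) (at x)" for x
      by (auto intro!: derivative_eq_intros poly_DERIV simp: field_simps)
    then have "\<exists>Y. finite Y \<and> card Y = Suc (card X) \<and> (\<forall>y\<in>Y. ?f' y = 0)"
      by (rule more_critical_points_than_zeros[OF _ poly_times_gauss_tendsto_0]) (use X False in auto)
    then show ?thesis using X by (auto simp del: hermite_poly.simps)
  qed
qed (auto intro: exI[of _ "{}"])

subsection \<open>The quadrature rule\<close>

text \<open>
  Interpolation at the roots of \<open>H\<^sub>n\<close> is exact in degree below \<open>n\<close>. Dividing by \<open>H\<^sub>n\<close>, whose quotient part has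
  mean 0 by orthogonality, extends this to degree below \<open>2n\<close>. The weight of a node is the mean of the square
  of its Lagrange polynomial, hence positive.
\<close>

lemma gauss_hermite_rule:
  assumes "n \<ge> 1"
  shows "\<exists>X w. finite X \<and> card X = n \<and> (\<forall>x\<in>X. w x > 0 \<and> poly (hermite_poly n) x = 0) \<and>
     (\<forall>p. degree p < 2 * n \<longrightarrow> (\<Sum>x\<in>X. w x * poly p x) = gauss_mean p)"
proof -
  obtain X where X: "finite X" "card X = n" "\<forall>x\<in>X. poly (hermite_poly n) x = 0"
    using hermite_poly_real_roots by blast
  define l where "l x = (\<Prod>y\<in>X - {x}. smult (1 / (x - y)) [:- y, 1:])" for x
  define w where "w x = gauss_mean (l x)" for x
  have lval: "poly (l x) y = (if y = x then 1 else 0)" if "x \<in> X" "y \<in> X" for x y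
  proof (cases "y = x")
    case True
    then show ?thesis by (auto simp: l_def poly_prod diff_divide_distrib[symmetric] intro!: prod.neutral)
  next
    case False
    then show ?thesis using that X(1) by (auto simp: l_def poly_prod intro!: prod_zero)
  qed
  have ldeg: "degree (l x) < n" if "x \<in> X" for x
  proof -
    have "degree (l x) \<le> (\<Sum>y\<in>X - {x}. degree (smult (1 / (x - y)) [:- y, 1:]))"
      unfolding l_def by (rule degree_prod_sum_le[unfolded comp_def]) (use X in auto)
    also have "\<dots> \<le> (\<Sum>y\<in>X - {x}. 1)" by (intro sum_mono) simp
    also have "\<dots> = n - 1" using X that by simp
    finally show ?thesis using assms by linarith
  qed
  have low: "(\<Sum>x\<in>X. w x * poly p x) = gauss_mean p" if "degree p < n" for p
  proof -
    have "p = (\<Sum>x\<in>X. smult (poly p x) (l x))"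
    proof (rule poly_eqI_degree[of X])
      fix y assume y: "y \<in> X"
      then have "poly (\<Sum>x\<in>X. smult (poly p x) (l x)) y = (\<Sum>x\<in>X. if x = y then poly p x else 0)"
        unfolding poly_sum by (intro sum.cong) (auto simp: lval)
      then show "poly p y = poly (\<Sum>x\<in>X. smult (poly p x) (l x)) y" using X(1) y by simp
    next
      show "degree p < card X" using that X by simp
      show "degree (\<Sum>x\<in>X. smult (poly p x) (l x)) < card X"
        using ldeg X assms by (intro degree_sum_less) (auto intro: le_less_trans[OF degree_smult_le])
    qed
    then have "gauss_mean p = gauss_mean (\<Sum>x\<in>X. smult (poly p x) (l x))" by simp
    then show ?thesis by (simp add: gauss_mean_sum gauss_mean_smult w_def mult.commute)
  qed
  have exact: "(\<Sum>x\<in>X. w x * poly p x) = gauss_mean p" if "degree p < 2 * n" for p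
  proof -
    let ?h = "hermite_poly n"
    define q r where "q = p div ?h" and "r = p mod ?h"
    have p: "p = q * ?h + r" by (simp add: q_def r_def)
    have "degree r < n"
      using degree_mod_less'[of ?h p] hermite_poly_nonzero[of n] degree_hermite_poly[of n] assms
      by (cases "r = 0") (auto simp: r_def)
    moreover have "degree q < n"
    proof (cases "q = 0")
      case False
      have "q * ?h = p - r" using p by simp
      moreover have "degree (p - r) < 2 * n"
        using that \<open>degree r < n\<close> by (intro degree_diff_less) auto
      ultimately have "degree (q * ?h) < 2 * n" by simp
      then show ?thesis
        using degree_mult_eq[OF False hermite_poly_nonzero[of n]] degree_hermite_poly[of n] by linarith
    qed (use assms in simp)
    ultimately have "gauss_mean p = gauss_mean r" 
      unfolding p gauss_mean_add using gauss_mean_hermite_low_degree[of q n] by (simp add: mult.commute)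
    also have "\<dots> = (\<Sum>x\<in>X. w x * poly r x)" using low[OF \<open>degree r < n\<close>] by simp
    also have "\<dots> = (\<Sum>x\<in>X. w x * poly p x)"
      unfolding p using X by (intro sum.cong) auto
    finally show ?thesis by simp
  qed
  have "w x > 0" if x: "x \<in> X" for x
  proof -
    have "degree (l x * l x) < 2 * n"
      using ldeg[OF x] degree_mult_le[of "l x" "l x"] by linarith
    then have "gauss_mean (l x * l x) = (\<Sum>y\<in>X. if y = x then w y else 0)"
    proof -
      have "(\<Sum>y\<in>X. w y * poly (l x * l x) y) = (\<Sum>y\<in>X. if y = x then w y else 0)"
        using lval[OF x] by (intro sum.cong) auto
      then show ?thesis using exact[OF \<open>degree (l x * l x) < 2 * n\<close>] by (simp only:)
    qed
    then have w: "w x = gauss_mean (l x * l x)" using x X by simp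
    have "0 \<le> w x" unfolding w by (rule gauss_mean_nonneg) simp
    moreover have "w x \<noteq> 0"
    proof
      assume 0: "w x = 0"
      have nn: "AE y in lborel. 0 \<le> poly (l x * l x) y * std_normal_density y" by simp
      have "AE y in lborel. poly (l x * l x) y * std_normal_density y = 0"
        using 0 integral_nonneg_eq_0_iff_AE[OF integrable_poly_gauss nn]
        unfolding w gauss_mean_def by blast
      then have zero: "AE y in lborel. poly (l x * l x) y = 0"
        by (auto elim!: eventually_mono simp: normal_density_def)
      have "l x * l x \<noteq> 0" using lval[OF x x] by auto
      then have "finite {y. poly (l x * l x) y = 0}" by (rule poly_roots_finite)
      then have "AE y in lborel. y \<notin> {y. poly (l x * l x) y = 0}"
        by (intro AE_not_in countable_imp_null_set_lborel countable_finite)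
      with zero have "AE y::real in lborel. False" by eventually_elim auto
      then show False by (simp add: eventually_False ae_filter_eq_bot_iff)
    qed
    ultimately show ?thesis by simp
  qed
  then show ?thesis using X exact by (intro exI[of _ X] exI[of _ w]) auto
qed

subsection \<open>Moments of the quadrature rule\<close>

lemma gauss_mean_power_hermite_nonneg: "gauss_mean (monom 1 i * hermite_poly k) \<ge> 0"
proof (induction i arbitrary: k)
  case 0
  then show ?case by (simp add: gauss_mean_hermite monom_0 one_pCons[symmetric] del: hermite_poly.simps)
next
  case (Suc i)
  have "monom 1 (Suc i) * hermite_poly k = monom 1 i * ([:0,1:] * hermite_poly k)"
    by (simp add: monom_Suc)
  then show ?case
    unfolding hermite_poly_recurrence distrib_left mult_smult_right
    using Suc by (simp add: gauss_mean_add gauss_mean_smult del: hermite_poly.simps)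
qed

lemma gauss_mean_power_Suc_hermite:
  "gauss_mean (monom 1 (Suc i) * hermite_poly k) =
     sqrt (real (Suc k)) * gauss_mean (monom 1 i * hermite_poly (Suc k)) +
     sqrt (real k) * gauss_mean (monom 1 i * hermite_poly (k - 1))"
proof -
  have "monom 1 (Suc i) * hermite_poly k = monom 1 i * ([:0,1:] * hermite_poly k)"
    by (simp add: monom_Suc)
  then show ?thesis
    unfolding hermite_poly_recurrence distrib_left mult_smult_right
    by (simp add: gauss_mean_add gauss_mean_smult del: hermite_poly.simps)
qed

text \<open>
  The coefficient of \<open>H\<^sub>k\<close> in \<open>x\<^sup>i\<close> reduced modulo \<open>H\<^sub>n\<close>: the recurrence for multiplication by \<open>x\<close> with
  \<open>H\<^sub>n\<close> replaced by 0. Equivalently, powers of the \<open>n\<close>-th truncation of the Jacobi matrix.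
\<close>

fun reduced_power_coeff :: "nat \<Rightarrow> nat \<Rightarrow> nat \<Rightarrow> real" where
  "reduced_power_coeff n 0 k = (if k = 0 then 1 else 0)"
| "reduced_power_coeff n (Suc i) k =
     (if k < n then sqrt (real (Suc k)) * reduced_power_coeff n i (Suc k) +
        sqrt (real k) * reduced_power_coeff n i (k - 1) else 0)"

text \<open>
  Truncating a recurrence with nonnegative coefficients only removes nonnegative terms.
\<close>

lemma reduced_power_coeff_bounds:
  "0 \<le> reduced_power_coeff n i k \<and> reduced_power_coeff n i k \<le> gauss_mean (monom 1 i * hermite_poly k)"
proof (induction i arbitrary: k)
  case 0
  then show ?case by (simp add: gauss_mean_hermite monom_0 one_pCons[symmetric] del: hermite_poly.simps)
next
  case (Suc i)
  show ?case
  proof (cases "k < n")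
    case True
    then show ?thesis
      using Suc unfolding gauss_mean_power_Suc_hermite reduced_power_coeff.simps
      by (auto intro!: add_nonneg_nonneg mult_nonneg_nonneg add_mono mult_left_mono simp del: of_nat_Suc
          hermite_poly.simps)
  next
    case False
    then show ?thesis using gauss_mean_power_hermite_nonneg[of "Suc i" k] by simp
  qed
qed

lemma reduced_power_coeff_beyond: "n \<ge> 1 \<Longrightarrow> n \<le> k \<Longrightarrow> reduced_power_coeff n i k = 0"
  by (cases i) auto

lemma power_at_hermite_root:
  assumes "n \<ge> 1" "hermite1 n x = 0"
  shows "x ^ i = (\<Sum>k<n. reduced_power_coeff n i k * hermite1 k x)"
proof (induction i)
  case 0
  have "(\<Sum>k<n. reduced_power_coeff n 0 k * hermite1 k x) = (\<Sum>k<n. if k = 0 then 1 else 0)"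
    by (intro sum.cong) (auto simp: hermite1_0)
  then show ?case using assms by (simp add: sum.delta)
next
  case (Suc i)
  let ?d = "reduced_power_coeff n i"
  obtain m where n: "n = Suc m" using assms by (cases n) auto
  have "x ^ Suc i = (\<Sum>k<n. ?d k * (x * hermite1 k x))"
    unfolding power_Suc Suc sum_distrib_left by (simp add: mult_ac)
  also have "\<dots> = (\<Sum>k<n. ?d k * (sqrt (real (Suc k)) * hermite1 (Suc k) x)) +
                 (\<Sum>k<n. ?d k * (sqrt (real k) * hermite1 (k - 1) x))"
    unfolding hermite1_recurrence distrib_left sum.distrib ..
  also have "(\<Sum>k<n. ?d k * (sqrt (real (Suc k)) * hermite1 (Suc k) x)) =
             (\<Sum>k<n. sqrt (real k) * ?d (k - 1) * hermite1 k x)"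
  proof -
    have "(\<Sum>k<n. ?d k * (sqrt (real (Suc k)) * hermite1 (Suc k) x)) =
          (\<Sum>k<m. ?d k * (sqrt (real (Suc k)) * hermite1 (Suc k) x))"
      using assms(2) unfolding n sum.lessThan_Suc by simp
    also have "\<dots> = (\<Sum>k<n. sqrt (real k) * ?d (k - 1) * hermite1 k x)"
      unfolding n sum.lessThan_Suc_shift by (simp add: mult_ac)
    finally show ?thesis .
  qed
  also have "(\<Sum>k<n. ?d k * (sqrt (real k) * hermite1 (k - 1) x)) =
             (\<Sum>k<n. sqrt (real (Suc k)) * ?d (Suc k) * hermite1 k x)"
  proof -
    have "(\<Sum>k<n. ?d k * (sqrt (real k) * hermite1 (k - 1) x)) =
          (\<Sum>k<m. sqrt (real (Suc k)) * ?d (Suc k) * hermite1 k x)"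
      unfolding n sum.lessThan_Suc_shift by (simp add: mult_ac)
    also have "\<dots> = (\<Sum>k<n. sqrt (real (Suc k)) * ?d (Suc k) * hermite1 k x)"
      unfolding sum.lessThan_Suc n using reduced_power_coeff_beyond[of n "Suc m" i] n by simp
    finally show ?thesis .
  qed
  also have "(\<Sum>k<n. sqrt (real k) * ?d (k - 1) * hermite1 k x) +
        (\<Sum>k<n. sqrt (real (Suc k)) * ?d (Suc k) * hermite1 k x) =
      (\<Sum>k<n. reduced_power_coeff n (Suc i) k * hermite1 k x)"
    unfolding sum.distrib[symmetric] by (intro sum.cong) (auto simp: algebra_simps simp del: of_nat_Suc)
  finally show ?case .
qed

text \<open>
  Both \<open>A(x\<^sup>i)\<close> and \<open>E(x\<^sup>i)\<close> are the coefficient of \<open>H\<^sub>0\<close>, of the reduced power and of the power itself.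
\<close>

lemma gauss_hermite_moment_le:
  assumes "n \<ge> 1"
    and roots: "\<forall>x\<in>X. poly (hermite_poly n) x = 0"
    and exact: "\<forall>p. degree p < 2 * n \<longrightarrow> (\<Sum>x\<in>X. w x * poly p x) = gauss_mean p"
  shows "(\<Sum>x\<in>X. w x * x ^ i) \<le> gauss_mean (monom 1 i)"
proof -
  have "(\<Sum>x\<in>X. w x * x ^ i) = (\<Sum>x\<in>X. w x * (\<Sum>k<n. reduced_power_coeff n i k * hermite1 k x))"
    using roots power_at_hermite_root[OF assms(1)]
    by (intro sum.cong refl arg_cong2[where f="(*)"]) (auto simp: hermite1_eq_poly)
  also have "\<dots> = (\<Sum>k<n. reduced_power_coeff n i k * (\<Sum>x\<in>X. w x * hermite1 k x))"
    unfolding sum_distrib_left by (subst sum.swap) (simp add: mult_ac)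
  also have "\<dots> = (\<Sum>k<n. if k = 0 then reduced_power_coeff n i 0 else 0)"
    using exact by (intro sum.cong refl) (auto simp: hermite1_eq_poly degree_hermite_poly gauss_mean_hermite)
  also have "\<dots> = reduced_power_coeff n i 0"
    using assms by (simp add: sum.delta)
  also have "\<dots> \<le> gauss_mean (monom 1 i)"
    using reduced_power_coeff_bounds[of n i 0] by simp
  finally show ?thesis .
qed

section \<open>The error series of the one-dimensional rule\<close>

text \<open>
  The diagonal of Mehler's kernel.
\<close>

definition hermite_diagonal :: "real \<Rightarrow> real \<Rightarrow> real" where
  "hermite_diagonal \<theta> x = (\<Sum>k. \<theta> ^ k * (hermite1 k x)\<^sup>2)"

lemma summable_power_hermite1_product:
  assumes "0 < \<theta>" "\<theta> < 1"
  shows "summable (\<lambda>k. \<theta> ^ k * (sqrt (real (Suc k)) * hermite1 k x * hermite1 (Suc k) x))"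
    and "\<bar>x\<bar> \<le> r \<Longrightarrow> \<bar>\<theta> ^ k * (sqrt (real (Suc k)) * hermite1 k x * hermite1 (Suc k) x)\<bar> \<le>
      sqrt (real (Suc k)) * (\<theta> ^ k * (hermite_majorant (Suc k) r)\<^sup>2)"
proof -
  have bound: "\<bar>\<theta> ^ k * (sqrt (real (Suc k)) * hermite1 k x * hermite1 (Suc k) x)\<bar> \<le>
      sqrt (real (Suc k)) * (\<theta> ^ k * (hermite_majorant (Suc k) r)\<^sup>2)" if "\<bar>x\<bar> \<le> r" for k r
  proof -
    have r: "r \<ge> 0" using that by linarith
    have "\<bar>hermite1 k x\<bar> \<le> hermite_majorant (Suc k) r"
      using hermite1_bound[OF that, of k] hermite_majorant_mono[OF r, of k "Suc k"] by linarith
    then have "\<bar>hermite1 k x\<bar> * \<bar>hermite1 (Suc k) x\<bar> \<le> hermite_majorant (Suc k) r * hermite_majorant (Suc k) r"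
      using hermite1_bound[OF that, of "Suc k"] by (intro mult_mono) auto
    then have "(sqrt (real (Suc k)) * \<theta> ^ k) * (\<bar>hermite1 k x\<bar> * \<bar>hermite1 (Suc k) x\<bar>)
      \<le> (sqrt (real (Suc k)) * \<theta> ^ k) * (hermite_majorant (Suc k) r)\<^sup>2"
      unfolding power2_eq_square using assms by (intro mult_left_mono) auto
    then show ?thesis using assms by (simp add: abs_mult mult_ac del: of_nat_Suc)
  qed
  show "\<bar>x\<bar> \<le> r \<Longrightarrow> \<bar>\<theta> ^ k * (sqrt (real (Suc k)) * hermite1 k x * hermite1 (Suc k) x)\<bar> \<le>
      sqrt (real (Suc k)) * (\<theta> ^ k * (hermite_majorant (Suc k) r)\<^sup>2)"
    by (rule bound)
  show "summable (\<lambda>k. \<theta> ^ k * (sqrt (real (Suc k)) * hermite1 k x * hermite1 (Suc k) x))"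
    using bound[of "\<bar>x\<bar>"]
    by (intro summable_comparison_test'[OF summable_power_hermite_majorant[OF assms, of "\<bar>x\<bar>"], of 0]) auto
qed

text \<open>
  Let \<open>P = \<Sum>k. \<theta>\<^sup>k \<surd>(k+1) H\<^sub>k H\<^sub>k\<^sub>+\<^sub>1\<close>. Differentiating termwise gives \<open>g' = 2 \<theta> P\<close> for the diagonal \<open>g\<close>, and
  the three-term recurrence gives \<open>x g = (1 + \<theta>) P\<close>. Eliminating \<open>P\<close> yields the differential equation.
\<close>

lemma hermite_diagonal_has_derivative:
  assumes "0 < \<theta>" "\<theta> < 1"
  shows "(hermite_diagonal \<theta> has_field_derivative 2 * \<theta> / (1 + \<theta>) * x * hermite_diagonal \<theta> x) (at x)"
proof -
  define P where "P k x = \<theta> ^ k * (sqrt (real (Suc k)) * hermite1 k x * hermite1 (Suc k) x)" for k x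
  define f' where "f' k x = (if k = 0 then 0 else 2 * \<theta> * P (k - 1) x)" for k x
  define R where "R = \<bar>x\<bar> + 1"
  define L where "L k = sqrt (real (Suc k)) * (\<theta> ^ k * (hermite_majorant (Suc k) R)\<^sup>2)" for k
  have sumP: "summable (\<lambda>k. P k x)" for x
    unfolding P_def by (rule summable_power_hermite1_product(1)[OF assms])
  have sumL: "summable L" unfolding L_def
    by (rule summable_power_hermite_majorant[OF assms]) (simp add: R_def)
  have PL: "\<bar>P k y\<bar> \<le> L k" if "y \<in> {-R..R}" for k y
    unfolding P_def L_def using that by (intro summable_power_hermite1_product(2)[OF assms]) auto
  have der: "((\<lambda>x. \<theta> ^ k * (hermite1 k x)\<^sup>2) has_field_derivative f' k y) (at y within S)" for k y S
  proof -
    have "((\<lambda>x. \<theta> ^ k * (hermite1 k x)\<^sup>2) has_field_derivative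
       \<theta> ^ k * (2 * hermite1 k y * (sqrt (real k) * hermite1 (k - 1) y))) (at y within S)"
      by (auto intro!: derivative_eq_intros hermite1_has_derivative)
    moreover have "\<theta> ^ k * (2 * hermite1 k y * (sqrt (real k) * hermite1 (k - 1) y)) = f' k y"
      by (cases k) (simp_all add: f'_def P_def mult_ac del: of_nat_Suc)
    ultimately show ?thesis by simp
  qed
  have unif: "uniformly_convergent_on {-R..R} (\<lambda>n x. \<Sum>i<n. f' i x)"
  proof (rule Weierstrass_m_test')
    show "norm (f' n y) \<le> (case n of 0 \<Rightarrow> 0 | Suc m \<Rightarrow> 2 * \<theta> * L m)" if "y \<in> {-R..R}" for n y
      using PL[OF that] assms by (cases n) (auto simp: f'_def abs_mult)
    show "summable (\<lambda>n. case n of 0 \<Rightarrow> 0 | Suc m \<Rightarrow> 2 * \<theta> * L m)"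
      by (subst summable_Suc_iff[symmetric]) (simp add: sumL summable_mult)
  qed
  have int: "x \<in> interior {-R..R}" by (auto simp: R_def interior_atLeastAtMost_real)
  have "((\<lambda>x. \<Sum>k. \<theta> ^ k * (hermite1 k x)\<^sup>2) has_field_derivative (\<Sum>k. f' k x)) (at x)"
    using has_field_derivative_series'(2)[OF _ der unif _ _ int, of 0] summable_power_hermite1_sq[OF
        assms, of 0]
    by (simp add: R_def)
  then have D: "(hermite_diagonal \<theta> has_field_derivative (\<Sum>k. f' k x)) (at x)"
    unfolding hermite_diagonal_def[abs_def] .
  have shift: "(\<Sum>k. f' k x) = 2 * \<theta> * (\<Sum>k. P k x)"
  proof -
    have "(\<lambda>k. f' (Suc k) x) sums (2 * \<theta> * (\<Sum>k. P k x))"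
      unfolding f'_def using sumP by (simp add: sums_mult summable_sums)
    then have "(\<lambda>k. f' k x) sums (2 * \<theta> * (\<Sum>k. P k x) + f' 0 x)"
      by (rule sums_Suc)
    then show ?thesis by (simp add: f'_def sums_unique[symmetric])
  qed
  have "(\<lambda>k. \<theta> ^ k * (sqrt (real k) * hermite1 k x * hermite1 (k - 1) x)) sums (\<theta> * (\<Sum>k. P k x) + 0)"
  proof -
    have "(\<lambda>k. \<theta> * P k x) sums (\<theta> * (\<Sum>k. P k x))"
      using sumP by (simp add: sums_mult summable_sums)
    then have "(\<lambda>k. \<theta> ^ Suc k * (sqrt (real (Suc k)) * hermite1 (Suc k) x * hermite1 (Suc k -
        1) x)) sums (\<theta> * (\<Sum>k. P k x))"
      by (simp add: P_def mult_ac del: of_nat_Suc)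
    from sums_Suc[OF this] show ?thesis by simp
  qed
  note both = sums_add[OF summable_sums[OF sumP[of x]] this]
  have "(\<lambda>k. x * (\<theta> ^ k * (hermite1 k x)\<^sup>2)) sums ((\<Sum>k. P k x) + \<theta> * (\<Sum>k. P k x))"
  proof -
    have "P k x + \<theta> ^ k * (sqrt (real k) * hermite1 k x * hermite1 (k - 1) x) =
        x * (\<theta> ^ k * (hermite1 k x)\<^sup>2)" for k
    proof -
      have "x * (\<theta> ^ k * (hermite1 k x)\<^sup>2) = \<theta> ^ k * hermite1 k x * (x * hermite1 k x)"
        by (simp add: power2_eq_square)
      also have "\<dots> = P k x + \<theta> ^ k * (sqrt (real k) * hermite1 k x * hermite1 (k - 1) x)"
        unfolding hermite1_recurrence P_def by (simp only: algebra_simps)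
      finally show ?thesis ..
    qed
    then show ?thesis using both by simp
  qed
  moreover have "(\<lambda>k. x * (\<theta> ^ k * (hermite1 k x)\<^sup>2)) sums (x * hermite_diagonal \<theta> x)"
    unfolding hermite_diagonal_def using summable_power_hermite1_sq[OF assms, of x]
    by (simp add: sums_mult summable_sums)
  ultimately have "x * hermite_diagonal \<theta> x = (1 + \<theta>) * (\<Sum>k. P k x)"
    by (simp add: sums_iff algebra_simps)
  then have "(\<Sum>k. P k x) = x * hermite_diagonal \<theta> x / (1 + \<theta>)"
    using assms by (simp add: eq_divide_eq mult.commute del: distrib_right_numeral)
  then have "(\<Sum>k. f' k x) = 2 * \<theta> / (1 + \<theta>) * x * hermite_diagonal \<theta> x"
    unfolding shift by simp
  then show ?thesis using D by simp
qed

lemma hermite1_at_0_le_1: "\<bar>hermite1 k 0\<bar> \<le> 1"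
  using hermite1_bound[of 0 0 k] by (simp add: hermite_majorant_def)

text \<open>
  By the differential equation the quotient of the diagonal and the exponential is constant.
\<close>

theorem hermite_diagonal_eq:
  assumes "0 < \<theta>" "\<theta> < 1"
  shows "hermite_diagonal \<theta> x = hermite_diagonal \<theta> 0 * exp (\<theta> / (1 + \<theta>) * x\<^sup>2)"
proof -
  let ?h = "\<lambda>x. hermite_diagonal \<theta> x * exp (- (\<theta> / (1 + \<theta>) * x\<^sup>2))"
  have "(?h has_field_derivative 0) (at y)" for y
  proof -
    define c where "c = \<theta> / (1 + \<theta>)"
    have "(hermite_diagonal \<theta> has_field_derivative 2 * c * y * hermite_diagonal \<theta> y) (at y)"
      using hermite_diagonal_has_derivative[OF assms, of y] by (simp add: c_def)
    then show ?thesis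
      unfolding c_def[symmetric] by (auto intro!: derivative_eq_intros simp: algebra_simps)
  qed
  then have "?h x = ?h 0"
    by (intro DERIV_isconst_all) auto
  then show ?thesis by (simp add: exp_minus field_simps)
qed

lemma hermite_diagonal_le:
  assumes "0 < \<theta>" "\<theta> < 1"
  shows "hermite_diagonal \<theta> x \<le> 1 / (1 - \<theta>) * exp (\<theta> / (1 + \<theta>) * x\<^sup>2)"
proof -
  have "hermite_diagonal \<theta> 0 \<le> (\<Sum>k. \<theta> ^ k)"
    unfolding hermite_diagonal_def
  proof (rule suminf_le)
    fix k
    have "(hermite1 k 0)\<^sup>2 \<le> 1" using hermite1_at_0_le_1[of k] by (simp add: abs_square_le_1)
    then show "\<theta> ^ k * (hermite1 k 0)\<^sup>2 \<le> \<theta> ^ k" using assms by (simp add: mult_left_le)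
  qed (use assms summable_power_hermite1_sq[OF assms] in auto)
  also have "\<dots> = 1 / (1 - \<theta>)" using assms by (intro suminf_geometric) auto
  finally show ?thesis
    unfolding hermite_diagonal_eq[OF assms, of x] by (intro mult_right_mono) auto
qed

lemma gauss_exp_square_integrable:
  assumes "\<mu> < 1 / 2"
  shows "integrable lborel (\<lambda>x. exp (\<mu> * x\<^sup>2) * std_normal_density x)"
proof -
  (* The integrand is a multiple of the normal density with this standard deviation. *)
  define \<sigma> where "\<sigma> = 1 / sqrt (1 - 2 * \<mu>)"
  have \<sigma>: "\<sigma> > 0" using assms by (simp add: \<sigma>_def)
  have s2: "\<sigma>\<^sup>2 = 1 / (1 - 2 * \<mu>)" using assms by (simp add: \<sigma>_def power_divide)
  have "integrable lborel (\<lambda>x. \<sigma> * normal_density 0 \<sigma> x)"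
    using \<sigma> by (intro integrable_mult_right integrable_normal_density)
  moreover have "\<sigma> * normal_density 0 \<sigma> x = exp (\<mu> * x\<^sup>2) * std_normal_density x" for x
  proof -
    have "\<sigma> * (1 / sqrt (2 * pi * \<sigma>\<^sup>2)) = 1 / sqrt (2 * pi)"
      using \<sigma> by (simp add: real_sqrt_mult)
    moreover have "exp (- (x - 0)\<^sup>2 / (2 * \<sigma>\<^sup>2)) = exp (\<mu> * x\<^sup>2) * exp (- x\<^sup>2 / 2)"
      unfolding s2 exp_add[symmetric] by (simp add: algebra_simps diff_divide_distrib)
    then have "\<sigma> * (1 / sqrt (2 * pi * \<sigma>\<^sup>2)) * exp (- (x - 0)\<^sup>2 / (2 * \<sigma>\<^sup>2)) =
        1 / sqrt (2 * pi) * (exp (\<mu> * x\<^sup>2) * exp (- x\<^sup>2 / 2))"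
      using calculation by (simp only:)
    then show ?thesis
      by (simp add: normal_density_def)
  qed
  ultimately show ?thesis by simp
qed

text \<open>
  The partial sums of the exponential are even polynomials with nonnegative coefficients, so the comparison of
  moments applies to them.
\<close>

lemma gauss_hermite_exp_square_le:
  assumes "n \<ge> 1" "0 \<le> \<mu>" "\<mu> < 1 / 2"
    and X: "finite X" "\<forall>x\<in>X. w x > 0 \<and> poly (hermite_poly n) x = 0"
    and exact: "\<forall>p. degree p < 2 * n \<longrightarrow> (\<Sum>x\<in>X. w x * poly p x) = gauss_mean p"
  shows "(\<Sum>x\<in>X. w x * exp (\<mu> * x\<^sup>2)) \<le> (\<integral>x. exp (\<mu> * x\<^sup>2) * std_normal_density x \<partial>lborel)"
proof -
  let ?I = "\<integral>x. exp (\<mu> * x\<^sup>2) * std_normal_density x \<partial>lborel"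
  define t where "t N x = (\<Sum>i<N. (\<mu> * x\<^sup>2) ^ i / fact i)" for N and x :: real
  have partial: "(\<Sum>x\<in>X. w x * t N x) \<le> ?I" for N
  proof -
    define p where "p = (\<Sum>i<N. smult (\<mu> ^ i / fact i) (monom 1 (2 * i)))"
    have p: "poly p x = t N x" for x
      by (simp add: p_def t_def poly_sum poly_monom power_mult_distrib power_mult)
    have "(\<Sum>x\<in>X. w x * t N x) = (\<Sum>i<N. \<mu> ^ i / fact i * (\<Sum>x\<in>X. w x * x ^ (2 * i)))"
      unfolding t_def sum_distrib_left
      by (subst sum.swap) (simp add: power_mult_distrib power_mult[symmetric] mult_ac)
    also have "\<dots> \<le> (\<Sum>i<N. \<mu> ^ i / fact i * gauss_mean (monom 1 (2 * i)))"
      using assms(1,2) X exact by (intro sum_mono mult_left_mono gauss_hermite_moment_le) auto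
    also have "\<dots> = gauss_mean p" by (simp add: p_def gauss_mean_sum gauss_mean_smult)
    also have "\<dots> \<le> ?I"
      unfolding gauss_mean_def
    proof (rule integral_mono[OF integrable_poly_gauss gauss_exp_square_integrable[OF assms(3)]])
      fix x
      have s: "(\<lambda>i. (\<mu> * x\<^sup>2) ^ i / fact i) sums exp (\<mu> * x\<^sup>2)"
        using exp_converges[of "\<mu> * x\<^sup>2"] by (simp add: divide_inverse mult.commute)
      have "t N x \<le> exp (\<mu> * x\<^sup>2)"
        unfolding t_def sums_unique[OF s] using assms(2)
        by (intro sum_le_suminf sums_summable[OF s]) auto
      then show "poly p x * std_normal_density x \<le> exp (\<mu> * x\<^sup>2) * std_normal_density x"
        unfolding p by (intro mult_right_mono) auto
    qed
    finally show ?thesis .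
  qed
  have "(\<lambda>N. \<Sum>x\<in>X. w x * t N x) \<longlonglongrightarrow> (\<Sum>x\<in>X. w x * exp (\<mu> * x\<^sup>2))"
  proof (intro tendsto_intros)
    fix x
    show "(\<lambda>N. t N x) \<longlonglongrightarrow> exp (\<mu> * x\<^sup>2)"
      using exp_converges[of "\<mu> * x\<^sup>2"] by (simp add: sums_def t_def divide_inverse mult.commute)
  qed
  then show ?thesis using partial by (intro LIMSEQ_le_const2) auto
qed

definition error_constant :: "real \<Rightarrow> real" where
  "error_constant \<theta> =
     1 / (1 - \<theta>) * (\<integral>x. exp (\<theta> / (1 + \<theta>) * x\<^sup>2) * std_normal_density x \<partial>lborel)"

text \<open>
  As the weights are positive with sum 1, \<open>A(H\<^sub>k)\<^sup>2 \<le> A(H\<^sub>k\<^sup>2)\<close>; so the series is at most \<open>A\<close> applied to the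
  diagonal of Mehler's kernel, a bound that does not involve the number of nodes.
\<close>

theorem gauss_hermite_error_series:
  assumes "0 < \<theta>" "\<theta> < 1" "n \<ge> 1"
  shows "\<exists>X w. finite X \<and> card X = n \<and>
     (\<forall>k<2 * n. (\<Sum>x\<in>X. w x * hermite1 k x) = (if k = 0 then 1 else 0)) \<and>
     summable (\<lambda>k. \<theta> ^ k * (\<Sum>x\<in>X. w x * hermite1 k x)\<^sup>2) \<and>
     (\<Sum>k. \<theta> ^ k * (\<Sum>x\<in>X. w x * hermite1 k x)\<^sup>2) \<le> error_constant \<theta>"
proof -
  obtain X w where X: "finite X" "card X = n" "\<forall>x\<in>X. w x > 0 \<and> poly (hermite_poly n) x = 0"
    and exact: "\<forall>p. degree p < 2 * n \<longrightarrow> (\<Sum>x\<in>X. w x * poly p x) = gauss_mean p"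
    using gauss_hermite_rule[OF assms(3)] by blast
  have ex: "(\<Sum>x\<in>X. w x * hermite1 k x) = (if k = 0 then 1 else 0)" if "k < 2 * n" for k
    using exact that by (auto simp: hermite1_eq_poly degree_hermite_poly gauss_mean_hermite simp del:
        hermite_poly.simps)
  have w1: "sum w X = 1" using ex[of 0] assms by (simp add: hermite1_0)
  have sq: "(\<Sum>x\<in>X. w x * hermite1 k x)\<^sup>2 \<le> (\<Sum>x\<in>X. w x * (hermite1 k x)\<^sup>2)" for k
  proof -
    have "(\<Sum>x\<in>X. w x * hermite1 k x)\<^sup>2 = (\<Sum>x\<in>X. sqrt (w x) * (sqrt (w x) * hermite1 k x))\<^sup>2"
      using X by (intro arg_cong[where f="\<lambda>z. z\<^sup>2"] sum.cong) (auto simp: mult.assoc[symmetric] less_imp_le)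
    also have "\<dots> \<le> (\<Sum>x\<in>X. (sqrt (w x))\<^sup>2) * (\<Sum>x\<in>X. (sqrt (w x) * hermite1 k x)\<^sup>2)"
      by (rule Cauchy_Schwarz_ineq_sum)
    also have "(\<Sum>x\<in>X. (sqrt (w x))\<^sup>2) = sum w X" using X by (intro sum.cong) (auto simp: less_imp_le)
    also have "(\<Sum>x\<in>X. (sqrt (w x) * hermite1 k x)\<^sup>2) = (\<Sum>x\<in>X. w x * (hermite1 k x)\<^sup>2)"
      using X by (intro sum.cong) (auto simp: less_imp_le power_mult_distrib)
    finally show ?thesis using w1 by simp
  qed
  have sums: "(\<lambda>k. \<Sum>x\<in>X. w x * (\<theta> ^ k * (hermite1 k x)\<^sup>2)) sums (\<Sum>x\<in>X. w x * hermite_diagonal \<theta> x)"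
    unfolding hermite_diagonal_def
    by (intro sums_sum sums_mult summable_sums summable_power_hermite1_sq assms)
  have le: "\<theta> ^ k * (\<Sum>x\<in>X. w x * hermite1 k x)\<^sup>2 \<le> (\<Sum>x\<in>X. w x * (\<theta> ^ k * (hermite1 k x)\<^sup>2))" for k
  proof -
    have "\<theta> ^ k * (\<Sum>x\<in>X. w x * hermite1 k x)\<^sup>2 \<le> \<theta> ^ k * (\<Sum>x\<in>X. w x * (hermite1 k x)\<^sup>2)"
      using sq assms by (intro mult_left_mono) auto
    then show ?thesis by (simp add: sum_distrib_left mult_ac)
  qed
  have summ: "summable (\<lambda>k. \<theta> ^ k * (\<Sum>x\<in>X. w x * hermite1 k x)\<^sup>2)"
    by (rule summable_comparison_test'[OF sums_summable[OF sums], of 0]) (use le assms in auto)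
  have "(\<Sum>k. \<theta> ^ k * (\<Sum>x\<in>X. w x * hermite1 k x)\<^sup>2) \<le> (\<Sum>x\<in>X. w x * hermite_diagonal \<theta> x)"
    unfolding sums_unique[OF sums] by (rule suminf_le[OF le summ sums_summable[OF sums]])
  also have "\<dots> \<le> (\<Sum>x\<in>X. w x * (1 / (1 - \<theta>) * exp (\<theta> / (1 + \<theta>) * x\<^sup>2)))"
    using X by (intro sum_mono mult_left_mono hermite_diagonal_le assms) (auto simp: less_imp_le)
  also have "\<dots> = 1 / (1 - \<theta>) * (\<Sum>x\<in>X. w x * exp (\<theta> / (1 + \<theta>) * x\<^sup>2))"
    unfolding sum_distrib_left by (simp only: mult_ac)
  also have "\<dots> \<le> error_constant \<theta>"
    unfolding error_constant_def
    using assms X exact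
    by (intro mult_left_mono gauss_hermite_exp_square_le[where n = n]) (auto simp: field_simps)
  finally show ?thesis using X ex summ by (intro exI[of _ X] exI[of _ w]) auto
qed

section \<open>Sums over infinite index sets\<close>

lemma Cauchy_Schwarz_summable_on:
  fixes f g :: "'a \<Rightarrow> real"
  assumes f: "(\<lambda>k. (f k)\<^sup>2) summable_on A" and g: "(\<lambda>k. (g k)\<^sup>2) summable_on A"
  shows "(\<lambda>k. \<bar>f k * g k\<bar>) summable_on A"
    and "(\<lambda>k. f k * g k) summable_on A"
    and "\<bar>\<Sum>\<^sub>\<infinity>k\<in>A. f k * g k\<bar> \<le> sqrt (\<Sum>\<^sub>\<infinity>k\<in>A. (f k)\<^sup>2) * sqrt (\<Sum>\<^sub>\<infinity>k\<in>A. (g k)\<^sup>2)"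
proof -
  show 1: "(\<lambda>k. \<bar>f k * g k\<bar>) summable_on A"
  proof (rule summable_on_comparison_test[OF summable_on_add[OF f g]])
    fix k
    have "0 \<le> (\<bar>f k\<bar> - \<bar>g k\<bar>)\<^sup>2" by simp
    then have "2 * (\<bar>f k\<bar> * \<bar>g k\<bar>) \<le> (f k)\<^sup>2 + (g k)\<^sup>2"
      unfolding power2_diff by (simp add: mult.assoc)
    moreover have "0 \<le> \<bar>f k\<bar> * \<bar>g k\<bar>" by simp
    ultimately show "\<bar>f k * g k\<bar> \<le> (f k)\<^sup>2 + (g k)\<^sup>2"
      unfolding abs_mult by linarith
  qed simp
  then show 2: "(\<lambda>k. f k * g k) summable_on A"
    by (subst summable_on_iff_abs_summable_on_real) simp
  have "\<bar>\<Sum>\<^sub>\<infinity>k\<in>A. f k * g k\<bar> \<le> (\<Sum>\<^sub>\<infinity>k\<in>A. \<bar>f k * g k\<bar>)"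
    using norm_infsum_bound[of "\<lambda>k. f k * g k" A] 1 by simp
  also have "\<dots> \<le> sqrt (\<Sum>\<^sub>\<infinity>k\<in>A. (f k)\<^sup>2) * sqrt (\<Sum>\<^sub>\<infinity>k\<in>A. (g k)\<^sup>2)"
  proof (rule infsum_le_finite_sums[OF 1])
    fix F assume F: "finite F" "F \<subseteq> A"
    have "(\<Sum>k\<in>F. \<bar>f k * g k\<bar>) \<le> L2_set f F * L2_set g F"
      by (simp add: abs_mult L2_set_mult_ineq)
    also have "\<dots> \<le> sqrt (\<Sum>\<^sub>\<infinity>k\<in>A. (f k)\<^sup>2) * sqrt (\<Sum>\<^sub>\<infinity>k\<in>A. (g k)\<^sup>2)"
      unfolding L2_set_def using F f g
      by (intro mult_mono real_sqrt_le_mono finite_sum_le_infsum) (auto intro!: sum_nonneg infsum_nonneg)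
    finally show "(\<Sum>k\<in>F. \<bar>f k * g k\<bar>) \<le> sqrt (\<Sum>\<^sub>\<infinity>k\<in>A. (f k)\<^sup>2) * sqrt (\<Sum>\<^sub>\<infinity>k\<in>A. (g k)\<^sup>2)" .
  qed
  finally show "\<bar>\<Sum>\<^sub>\<infinity>k\<in>A. f k * g k\<bar> \<le> sqrt (\<Sum>\<^sub>\<infinity>k\<in>A. (f k)\<^sup>2) * sqrt (\<Sum>\<^sub>\<infinity>k\<in>A. (g k)\<^sup>2)" .
qed

text \<open>
  All series over multi-indices below are of this form: a product of one-dimensional factors.
\<close>

lemma summable_on_prod_PiE:
  fixes f :: "'i \<Rightarrow> nat \<Rightarrow> real"
  assumes fin: "finite A" and nn: "\<And>j n. j \<in> A \<Longrightarrow> f j n \<ge> 0" and sm: "\<And>j. j \<in> A \<Longrightarrow> summable (f j)"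
  shows "(\<lambda>k. \<Prod>j\<in>A. f j (k j)) summable_on (A \<rightarrow>\<^sub>E UNIV)"
    and "(\<Sum>\<^sub>\<infinity>k\<in>A \<rightarrow>\<^sub>E UNIV. \<Prod>j\<in>A. f j (k j)) = (\<Prod>j\<in>A. \<Sum>n. f j n)"
proof -
  show "(\<lambda>k. \<Prod>j\<in>A. f j (k j)) summable_on (A \<rightarrow>\<^sub>E UNIV)"
  proof (rule nonneg_bdd_above_summable_on)
    show "bdd_above (sum (\<lambda>k. \<Prod>j\<in>A. f j (k j)) ` {F. F \<subseteq> A \<rightarrow>\<^sub>E UNIV \<and> finite F})"
    proof (rule bdd_aboveI2)
      fix F assume "F \<in> {F. F \<subseteq> A \<rightarrow>\<^sub>E (UNIV::nat set) \<and> finite F}"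
      then have F: "F \<subseteq> A \<rightarrow>\<^sub>E UNIV" "finite F" by auto
      (* A box that contains the finite set F, so that the finite sum factorises. *)
      define N where "N = Suc (Max (insert 0 (\<Union>k\<in>F. k ` A)))"
      have le: "k j < N" if "k \<in> F" "j \<in> A" for k j
        unfolding N_def less_Suc_eq_le using that F fin by (intro Max_ge) auto
      have sub: "F \<subseteq> A \<rightarrow>\<^sub>E {..<N}"
      proof
        fix k assume "k \<in> F"
        then show "k \<in> A \<rightarrow>\<^sub>E {..<N}" using F(1) le by (auto simp: PiE_iff subset_iff)
      qed
      have "(\<Sum>k\<in>F. \<Prod>j\<in>A. f j (k j)) \<le> (\<Sum>k\<in>A \<rightarrow>\<^sub>E {..<N}. \<Prod>j\<in>A. f j (k j))"
        using sub nn fin by (intro sum_mono2) (auto intro!: finite_PiE prod_nonneg)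
      also have "\<dots> = (\<Prod>j\<in>A. \<Sum>n<N. f j n)"
        using fin by (subst prod_sum_PiE) auto
      also have "\<dots> \<le> (\<Prod>j\<in>A. \<Sum>n. f j n)"
        using nn sm by (intro prod_mono conjI sum_nonneg sum_le_suminf) auto
      finally show "(\<Sum>k\<in>F. \<Prod>j\<in>A. f j (k j)) \<le> (\<Prod>j\<in>A. \<Sum>n. f j n)" .
    qed
  qed (use nn in \<open>auto intro!: prod_nonneg\<close>)
  have s: "f j summable_on UNIV" if "j \<in> A" for j
    using sm nn that by (simp add: summable_on_UNIV_nonneg_real_iff)
  have "(\<Sum>\<^sub>\<infinity>k\<in>A \<rightarrow>\<^sub>E UNIV. \<Prod>j\<in>A. f j (k j)) = (\<Prod>j\<in>A. infsum (f j) UNIV)"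
    using s by (intro infsum_prod_PiE_abs[OF fin]) (subst summable_on_iff_abs_summable_on_real[symmetric], simp)
  also have "\<dots> = (\<Prod>j\<in>A. \<Sum>n. f j n)"
  proof (rule prod.cong[OF refl])
    fix j assume "j \<in> A"
    then have "f j sums infsum (f j) UNIV" using s by (intro has_sum_imp_sums) auto
    then show "infsum (f j) UNIV = (\<Sum>n. f j n)" by (rule sums_unique)
  qed
  finally show "(\<Sum>\<^sub>\<infinity>k\<in>A \<rightarrow>\<^sub>E UNIV. \<Prod>j\<in>A. f j (k j)) = (\<Prod>j\<in>A. \<Sum>n. f j n)" .
qed

text \<open>
  An unordered sum over a countable set is reduced to a series by enumerating the set.
\<close>

lemma integral_infsum:
  fixes g :: "'i \<Rightarrow> 'a \<Rightarrow> real"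
  assumes A: "countable A" and int: "\<And>l. l \<in> A \<Longrightarrow> integrable M (g l)"
    and norms: "(\<lambda>l. \<integral>x. \<bar>g l x\<bar> \<partial>M) summable_on A"
    and pw: "\<And>x. x \<in> space M \<Longrightarrow> (\<lambda>l. g l x) summable_on A"
  shows "(\<integral>x. (\<Sum>\<^sub>\<infinity>l\<in>A. g l x) \<partial>M) = (\<Sum>\<^sub>\<infinity>l\<in>A. \<integral>x. g l x \<partial>M)"
proof (cases "finite A")
  case True
  then show ?thesis using int by simp
next
  case False
  define e where "e = from_nat_into A"
  have bij: "bij_betw e UNIV A" unfolding e_def using A False by (rule bij_betw_from_nat_into)
  have eA: "e n \<in> A" for n using bij by (auto simp: bij_betw_def)
  have reindex: "infsum h A = (\<Sum>n. h (e n))" "summable (\<lambda>n. h (e n))"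
    if "h summable_on A" for h :: "'i \<Rightarrow> real"
  proof -
    have "((\<lambda>n. h (e n)) has_sum infsum h A) UNIV"
      using that bij by (subst has_sum_reindex_bij_betw) auto
    then have "(\<lambda>n. h (e n)) sums infsum h A" by (rule has_sum_imp_sums)
    then show "infsum h A = (\<Sum>n. h (e n))" "summable (\<lambda>n. h (e n))" by (auto simp: sums_iff)
  qed
  have "(\<integral>x. (\<Sum>\<^sub>\<infinity>l\<in>A. g l x) \<partial>M) = (\<integral>x. (\<Sum>n. g (e n) x) \<partial>M)"
    by (intro Bochner_Integration.integral_cong refl reindex(1) pw)
  also have "\<dots> = (\<Sum>n. \<integral>x. g (e n) x \<partial>M)"
  proof (rule integral_suminf)
    show "AE x in M. summable (\<lambda>i. norm (g (e i) x))"
    proof (rule AE_I2)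
      fix x assume "x \<in> space M"
      then have "(\<lambda>l. norm (g l x)) summable_on A"
        using pw by (subst summable_on_iff_abs_summable_on_real[symmetric])
      then show "summable (\<lambda>i. norm (g (e i) x))" by (rule reindex(2))
    qed
    show "summable (\<lambda>i. \<integral>x. norm (g (e i) x) \<partial>M)"
      using reindex(2)[OF norms] by simp
  qed (use int eA in auto)
  also have "\<dots> = (\<Sum>\<^sub>\<infinity>l\<in>A. \<integral>x. g l x \<partial>M)"
  proof (rule reindex(1)[symmetric])
    have "(\<lambda>l. norm (\<integral>x. g l x \<partial>M)) summable_on A"
      by (rule summable_on_comparison_test[OF norms])
        (use integral_norm_bound[of M] in auto)
    then show "(\<lambda>l. \<integral>x. g l x \<partial>M) summable_on A"
      by (subst summable_on_iff_abs_summable_on_real)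
  qed
  finally show ?thesis .
qed

section \<open>Gaussian integrals of products\<close>

lemma gauss_density_eq_prod: "gauss_density s x = (\<Prod>j=1..s. std_normal_density (x j))"
proof -
  have "(2 * pi) powr (- (real s / 2)) = (1 / sqrt (2 * pi)) ^ s"
  proof -
    have "(2 * pi) powr (- (real s / 2)) = ((2 * pi) powr (- (1 / 2))) powr real s"
      by (simp add: powr_powr)
    also have "(2 * pi) powr (- (1 / 2)) = 1 / sqrt (2 * pi)"
      unfolding powr_minus_divide by (subst powr_half_sqrt) (auto intro: mult_nonneg_nonneg)
    finally show ?thesis by (simp add: powr_realpow)
  qed
  moreover have "exp (- (\<Sum>j=1..s. x j * x j) / 2) = (\<Prod>j=1..s. exp (- (x j)\<^sup>2 / 2))"
  proof -
    have "- (\<Sum>j=1..s. x j * x j) / 2 = (\<Sum>j=1..s. - (x j)\<^sup>2 / 2)"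
      unfolding sum_divide_distrib[symmetric] sum_negf power2_eq_square ..
    then show ?thesis by (simp only: exp_sum finite_atLeastAtMost)
  qed
  moreover have "(\<Prod>j=1..s. std_normal_density (x j)) = (\<Prod>j=1..s. 1 / sqrt (2 * pi) * exp (- (x j)\<^sup>2 / 2))"
    unfolding normal_density_def by (intro prod.cong) simp_all
  ultimately show ?thesis
    unfolding gauss_density_def prod.distrib prod_constant card_atLeastAtMost by simp
qed

interpretation lborel_product: product_sigma_finite "\<lambda>_::nat. lborel :: real measure" ..

lemma gauss_integral_prod_poly:
  shows "integrable (\<Pi>\<^sub>M j\<in>{1..s}. lborel) (\<lambda>x. (\<Prod>j=1..s. poly (p j) (x j)) * gauss_density s x)"
    and "gauss_integral s (\<lambda>x. \<Prod>j=1..s. poly (p j) (x j)) = (\<Prod>j=1..s. gauss_mean (p j))"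
proof -
  have eq: "(\<Prod>j=1..s. poly (p j) (x j)) * gauss_density s x =
      (\<Prod>j\<in>{1..s}. poly (p j) (x j) * std_normal_density (x j))" for x
    by (simp add: gauss_density_eq_prod prod.distrib)
  show "integrable (\<Pi>\<^sub>M j\<in>{1..s}. lborel) (\<lambda>x. (\<Prod>j=1..s. poly (p j) (x j)) * gauss_density s x)"
    unfolding eq by (rule lborel_product.product_integrable_prod[of "{1..s}"
        "\<lambda>j x. poly (p j) x * std_normal_density x"])
      (auto intro: integrable_poly_gauss)
  show "gauss_integral s (\<lambda>x. \<Prod>j=1..s. poly (p j) (x j)) = (\<Prod>j=1..s. gauss_mean (p j))"
    unfolding gauss_integral_def eq gauss_mean_def
    by (rule lborel_product.product_integral_prod[of "{1..s}" "\<lambda>j x. poly (p j) x * std_normal_density x"])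
      (auto intro: integrable_poly_gauss)
qed

lemma hermite_eq_prod_poly: "hermite s k x = (\<Prod>j=1..s. poly (hermite_poly (k j)) (x j))"
  by (simp add: hermite_def hermite1_eq_poly)

lemma hermite_product_eq_prod_poly:
  "hermite s k x * hermite s l x = (\<Prod>j=1..s. poly (hermite_poly (k j) * hermite_poly (l j)) (x j))"
  by (simp add: hermite_eq_prod_poly prod.distrib)

lemma integrable_hermite_product:
  "integrable (\<Pi>\<^sub>M j\<in>{1..s}. lborel) (\<lambda>x. hermite s k x * hermite s l x * gauss_density s x)"
  unfolding hermite_product_eq_prod_poly by (rule gauss_integral_prod_poly(1))

lemma multi_indices_eqI:
  "k \<in> multi_indices s \<Longrightarrow> l \<in> multi_indices s \<Longrightarrow> (\<And>j. j \<in> {1..s} \<Longrightarrow> k j = l j) \<Longrightarrow> k = l"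
  unfolding multi_indices_def by (rule PiE_ext) auto

lemma gauss_integral_hermite_product:
  assumes "k \<in> multi_indices s" "l \<in> multi_indices s"
  shows "gauss_integral s (\<lambda>x. hermite s k x * hermite s l x) = (if k = l then 1 else 0)"
proof -
  have "gauss_integral s (\<lambda>x. hermite s k x * hermite s l x) = (\<Prod>j=1..s. if k j = l j then 1 else 0)"
    unfolding hermite_product_eq_prod_poly gauss_integral_prod_poly(2) gauss_mean_orthonormal ..
  also have "\<dots> = (if k = l then 1 else 0)"
  proof (cases "k = l")
    case False
    then obtain j where "j \<in> {1..s}" "k j \<noteq> l j"
      using multi_indices_eqI[OF assms] by blast
    then show ?thesis using False by (auto intro!: prod_zero)
  qed simp
  finally show ?thesis .
qed

lemma gauss_density_nonneg: "gauss_density s x \<ge> 0"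
  unfolding gauss_density_def by simp

text \<open>
  By \<open>2 \<bar>u v\<bar> \<le> u\<^sup>2 + v\<^sup>2\<close> and orthonormality. The bound is independent of the indices and thus justifies
  integrating Hermite series termwise.
\<close>

lemma gauss_integral_abs_hermite_product_le:
  assumes "k \<in> multi_indices s" "l \<in> multi_indices s"
  shows "(\<integral>x. \<bar>hermite s k x * hermite s l x * gauss_density s x\<bar> \<partial>(\<Pi>\<^sub>M j\<in>{1..s}. lborel)) \<le> 1"
proof -
  let ?M = "\<Pi>\<^sub>M j\<in>{1..s}. lborel :: real measure" and ?d = "gauss_density s"
  let ?g = "\<lambda>x. (hermite s k x * hermite s k x * ?d x + hermite s l x * hermite s l x * ?d x) / 2"
  have "(\<integral>x. \<bar>hermite s k x * hermite s l x * ?d x\<bar> \<partial>?M) \<le> (\<integral>x. ?g x \<partial>?M)"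
  proof (rule integral_mono)
    fix x
    have "2 * \<bar>hermite s k x * hermite s l x\<bar> \<le> hermite s k x * hermite s k x + hermite s l x * hermite s l x"
      using sum_squares_bound[of "\<bar>hermite s k x\<bar>" "\<bar>hermite s l x\<bar>"]
      by (simp add: power2_eq_square abs_mult)
    from mult_right_mono[OF this gauss_density_nonneg[of s x]]
    show "\<bar>hermite s k x * hermite s l x * ?d x\<bar> \<le> ?g x"
      using gauss_density_nonneg[of s x] by (simp add: abs_mult algebra_simps)
  qed (intro integrable_abs integrable_divide_zero impI Bochner_Integration.integrable_add
      integrable_hermite_product)+
  also have "\<dots> = (1 + 1) / 2"
    unfolding integral_divide_zero
      Bochner_Integration.integral_add[OF integrable_hermite_product integrable_hermite_product]
    using gauss_integral_hermite_product[OF assms(1) assms(1)] gauss_integral_hermite_product[OF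
        assms(2) assms(2)]
    by (simp add: gauss_integral_def)
  finally show ?thesis by simp
qed

section \<open>Reproducing kernel Hilbert spaces are determined by kernel and inner product\<close>

lemma nonneg_quadratic_imp_discriminant:
  fixes A B C :: real
  assumes "\<And>t. 0 \<le> A - 2 * t * B + t\<^sup>2 * C" and "0 \<le> C"
  shows "B\<^sup>2 \<le> A * C"
proof (cases "C = 0")
  case True
  have "B = 0"
  proof (rule ccontr)
    assume "B \<noteq> 0"
    then show False using assms(1)[of "(A + 1) / (2 * B)"] True by simp
  qed
  then show ?thesis using True by simp
next
  case False
  then have "0 < C" using assms(2) by simp
  have "0 \<le> (A - 2 * (B / C) * B + (B / C)\<^sup>2 * C) * C"
    by (intro mult_nonneg_nonneg assms)
  also have "\<dots> = A * C - B\<^sup>2" using False by (simp add: field_simps power2_eq_square)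
  finally show ?thesis by simp
qed

context hilbert_function_space
begin

lemma diff_mem: "f \<in> H \<Longrightarrow> g \<in> H \<Longrightarrow> (\<lambda>x. f x - g x) \<in> H"
  using add_mem[of f "\<lambda>x. (-1) * g x"] scale_mem[of g "-1"] by simp

lemma ip_diff_left: "f \<in> H \<Longrightarrow> g \<in> H \<Longrightarrow> h \<in> H \<Longrightarrow> ip (\<lambda>x. f x - g x) h = ip f h - ip g h"
  using ip_add[of f "\<lambda>x. (-1) * g x" h] scale_mem[of g "-1"] ip_scale[of g h "-1"] by simp

lemma ip_zero: "h \<in> H \<Longrightarrow> ip (\<lambda>x. 0) h = 0"
  using ip_scale[OF zero_mem, of h 0] by simp

lemma ip_nonneg: "f \<in> H \<Longrightarrow> ip f f \<ge> 0"
  using ip_pos[of f] ip_zero[OF zero_mem] by (cases "f = (\<lambda>x. 0)") auto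

lemma ip_diff_scaled:
  assumes "f \<in> H" "g \<in> H"
  shows "ip (\<lambda>x. f x - t * g x) (\<lambda>x. f x - t * g x) = ip f f - 2 * t * ip f g + t\<^sup>2 * ip g g"
proof -
  let ?g = "\<lambda>x. t * g x"
  have g: "?g \<in> H" and d: "(\<lambda>x. f x - ?g x) \<in> H"
    using assms scale_mem diff_mem[of f ?g] by auto
  have "ip (\<lambda>x. f x - ?g x) (\<lambda>x. f x - ?g x) = ip f (\<lambda>x. f x - ?g x) - t * ip g (\<lambda>x. f x - ?g x)"
    using ip_diff_left[OF assms(1) g d] ip_scale[OF assms(2) d] by simp
  also have "ip f (\<lambda>x. f x - ?g x) = ip f f - t * ip f g"
    using ip_sym[OF assms(1) d] ip_diff_left[OF assms(1) g assms(1)] ip_scale[OF assms(2,1)] ip_sym[OF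
        assms] by simp
  also have "ip g (\<lambda>x. f x - ?g x) = ip f g - t * ip g g"
    using ip_sym[OF assms(2) d] ip_diff_left[OF assms(1) g assms(2)] ip_scale[OF assms(2,2)] by simp
  finally show ?thesis by (simp add: algebra_simps power2_eq_square)
qed

lemma parallelogram:
  assumes "f \<in> H" "g \<in> H"
  shows "ip (\<lambda>x. f x - g x) (\<lambda>x. f x - g x) =
    2 * ip f f + 2 * ip g g - ip (\<lambda>x. f x + g x) (\<lambda>x. f x + g x)"
  using ip_diff_scaled[OF assms, of 1] ip_diff_scaled[OF assms, of "-1"] by simp

end

text \<open>
  Uniqueness of the space for a given kernel and inner product, in the case of an inclusion. The distance from
  \<open>f\<close> to \<open>H'\<close> has a minimising sequence \<open>G\<close> in \<open>H'\<close>, which is Cauchy by the parallelogram law and has a limit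
  \<open>g\<close> in \<open>H'\<close>. Along \<open>G\<close> the difference to \<open>f\<close> becomes orthogonal to \<open>H'\<close>, in particular to the kernel
  sections, so \<open>f\<close> and \<open>g\<close> agree at every point.
\<close>

lemma rkhs_subset_eq:
  assumes "rkhs X K H' ip" "rkhs X K H ip" "H' \<subseteq> H"
  shows "H' = H"
proof
  interpret S: rkhs X K H' ip by fact
  interpret L: rkhs X K H ip by fact
  show "H \<subseteq> H'"
  proof
    fix f assume f: "f \<in> H"
    define N where "N h = ip h h" for h :: "'a \<Rightarrow> real"
    define D where "D = (\<lambda>g. N (\<lambda>x. f x - g x)) ` H'"
    define d where "d = Inf D"
    have sub: "\<And>h. h \<in> H' \<Longrightarrow> h \<in> H" using assms(3) by blast
    have fd: "(\<lambda>x. f x - g x) \<in> H" if "g \<in> H'" for g using L.diff_mem f sub that by blast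
    have bdd: "bdd_below D"
      unfolding D_def N_def by (intro bdd_belowI2[of _ 0] L.ip_nonneg fd)
    have d_le: "d \<le> N (\<lambda>x. f x - g x)" if "g \<in> H'" for g
      unfolding d_def using that bdd by (intro cInf_lower) (auto simp: D_def)
    have ex: "\<exists>g\<in>H'. N (\<lambda>x. f x - g x) < d + inverse (real (Suc n))" for n
    proof -
      have "Inf D < d + inverse (real (Suc n))" by (simp add: d_def)
      moreover have "D \<noteq> {}" using S.zero_mem by (auto simp: D_def)
      ultimately obtain y where "y \<in> D" "y < d + inverse (real (Suc n))"
        using cInf_lessD by blast
      then show ?thesis by (auto simp: D_def)
    qed
    then obtain G where G: "\<And>n. G n \<in> H'" "\<And>n. N (\<lambda>x. f x - G n x) < d + inverse (real (Suc n))"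
      by metis
    have cauchy: "N (\<lambda>x. G m x - G n x) \<le> 2 * inverse (real (Suc m)) + 2 * inverse (real (Suc n))" for m n
    proof -
      (* The midpoint of G m and G n is in H', so it is not closer to f than d. *)
      let ?u = "\<lambda>x. f x - G n x" and ?v = "\<lambda>x. f x - G m x" and ?h = "\<lambda>x. (1/2) * (G m x + G n x)"
      have h: "?h \<in> H'" using G S.add_mem S.scale_mem by blast
      have "N (\<lambda>x. ?u x - ?v x) = 2 * N ?u + 2 * N ?v - N (\<lambda>x. ?u x + ?v x)"
        unfolding N_def by (rule L.parallelogram) (use fd G in auto)
      also have "(\<lambda>x. ?u x - ?v x) = (\<lambda>x. G m x - G n x)" by auto
      also have "(\<lambda>x. ?u x + ?v x) = (\<lambda>x. 2 * (f x - ?h x))" by (auto simp: field_simps)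
      also have "N (\<lambda>x. 2 * (f x - ?h x)) = 4 * N (\<lambda>x. f x - ?h x)"
      proof -
        have m: "(\<lambda>x. f x - ?h x) \<in> H" using fd h by blast
        then have m2: "(\<lambda>x. 2 * (f x - ?h x)) \<in> H" by (rule L.scale_mem)
        have "ip (\<lambda>x. 2 * (f x - ?h x)) (\<lambda>x. 2 * (f x - ?h x)) = 2 * ip (\<lambda>x. f x - ?h x) (\<lambda>x. 2 * (f x - ?h x))"
          by (rule L.ip_scale[OF m m2])
        also have "ip (\<lambda>x. f x - ?h x) (\<lambda>x. 2 * (f x - ?h x)) = ip (\<lambda>x. 2 * (f x - ?h x)) (\<lambda>x. f x - ?h x)"
          by (rule L.ip_sym[OF m m2])
        also have "\<dots> = 2 * ip (\<lambda>x. f x - ?h x) (\<lambda>x. f x - ?h x)"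
          by (rule L.ip_scale[OF m m])
        finally show ?thesis unfolding N_def by simp
      qed
      finally show ?thesis using d_le[OF h] G(2)[of n] G(2)[of m] by linarith
    qed
    have "\<exists>g\<in>H'. (\<lambda>n. sqrt (ip (\<lambda>x. G n x - g x) (\<lambda>x. G n x - g x))) \<longlonglongrightarrow> 0"
    proof (rule S.complete[OF G(1)])
      fix e :: real assume e: "e > 0"
      obtain M where M: "inverse (real (Suc M)) < e\<^sup>2 / 4"
        using reals_Archimedean[of "e\<^sup>2 / 4"] e by auto
      show "\<exists>N. \<forall>m\<ge>N. \<forall>n\<ge>N. sqrt (ip (\<lambda>x. G m x - G n x) (\<lambda>x. G m x - G n x)) < e"
      proof (intro exI[of _ M] allI impI)
        fix m n assume mn: "m \<ge> M" "n \<ge> M"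
        have "inverse (real (Suc m)) \<le> inverse (real (Suc M))" "inverse (real (Suc n)) \<le> inverse (real (Suc M))"
          using mn by auto
        then have "N (\<lambda>x. G m x - G n x) < e\<^sup>2"
          using cauchy[of m n] M by linarith
        then show "sqrt (ip (\<lambda>x. G m x - G n x) (\<lambda>x. G m x - G n x)) < e"
          unfolding N_def using e by (metis less_le real_sqrt_less_iff real_sqrt_unique)
      qed
    qed
    then obtain g where g: "g \<in> H'" and lim: "(\<lambda>n. sqrt (N (\<lambda>x. G n x - g x))) \<longlonglongrightarrow> 0"
      unfolding N_def by blast
    have "f y = g y" for y
    proof (cases "y \<in> X")
      case False
      then show ?thesis using L.zero_outside[OF f] S.zero_outside[OF g] by simp
    next
      case True
      let ?k = "kernel_section X K y"
      have k: "?k \<in> H'" "?k \<in> H" using S.kernel_mem L.kernel_mem True by auto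
      have Nk: "N ?k \<ge> 0" unfolding N_def using L.ip_nonneg[OF k(2)] .
      have 1: "(f y - G n y)\<^sup>2 \<le> inverse (real (Suc n)) * N ?k" for n
      proof -
        let ?u = "\<lambda>x. f x - G n x"
        have u: "?u \<in> H" using fd G by blast
        have "(ip ?u ?k)\<^sup>2 \<le> (N ?u - d) * N ?k"
        proof (rule nonneg_quadratic_imp_discriminant[OF _ Nk])
          fix t
          have "(\<lambda>x. G n x + t * ?k x) \<in> H'" using S.add_mem[OF G(1) S.scale_mem[OF k(1)]] .
          from d_le[OF this] have "d \<le> N (\<lambda>x. ?u x - t * ?k x)"
            by (simp add: algebra_simps)
          also have "\<dots> = N ?u - 2 * t * ip ?u ?k + t\<^sup>2 * N ?k"
            unfolding N_def by (rule L.ip_diff_scaled[OF u k(2)])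
          finally show "0 \<le> N ?u - d - 2 * t * ip ?u ?k + t\<^sup>2 * N ?k" by simp
        qed
        also have "\<dots> \<le> inverse (real (Suc n)) * N ?k"
          using G(2)[of n] Nk by (intro mult_right_mono) auto
        finally show ?thesis using L.reproducing[OF u True] by simp
      qed
      have 2: "\<bar>G n y - g y\<bar> \<le> sqrt (N (\<lambda>x. G n x - g x)) * sqrt (N ?k)" for n
      proof -
        let ?u = "\<lambda>x. G n x - g x"
        have u: "?u \<in> H" using S.diff_mem[OF G(1) g] sub by blast
        have "(ip ?u ?k)\<^sup>2 \<le> N ?u * N ?k"
        proof (rule nonneg_quadratic_imp_discriminant[OF _ Nk])
          fix t
          have "(\<lambda>x. ?u x - t * ?k x) \<in> H" using L.diff_mem[OF u L.scale_mem[OF k(2)]] .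
          from L.ip_nonneg[OF this]
          show "0 \<le> N ?u - 2 * t * ip ?u ?k + t\<^sup>2 * N ?k"
            unfolding N_def L.ip_diff_scaled[OF u k(2)] .
        qed
        then have "\<bar>ip ?u ?k\<bar> \<le> sqrt (N ?u * N ?k)" using real_le_rsqrt by (simp add: real_le_rsqrt)
        then show ?thesis using L.reproducing[OF u True] by (simp add: real_sqrt_mult)
      qed
      have "(\<lambda>n. (f y - G n y)\<^sup>2) \<longlonglongrightarrow> 0"
      proof (rule tendsto_sandwich[OF _ _ tendsto_const])
        have "(\<lambda>n. inverse (real (Suc n)) * N ?k) \<longlonglongrightarrow> 0 * N ?k"
          by (intro tendsto_intros LIMSEQ_inverse_real_of_nat)
        then show "(\<lambda>n. inverse (real (Suc n)) * N ?k) \<longlonglongrightarrow> 0" by simp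
      qed (use 1 in auto)
      then have "(\<lambda>n. f y - G n y) \<longlonglongrightarrow> 0"
        using tendsto_real_sqrt[of "\<lambda>n. (f y - G n y)\<^sup>2" 0] tendsto_rabs_zero_iff[of "\<lambda>n. f y - G n y"] by simp
      moreover have "(\<lambda>n. G n y - g y) \<longlonglongrightarrow> 0"
      proof (rule Lim_null_comparison)
        show "(\<lambda>n. sqrt (N (\<lambda>x. G n x - g x)) * sqrt (N ?k)) \<longlonglongrightarrow> 0"
          using tendsto_mult[OF lim tendsto_const[of "sqrt (N ?k)"]] by simp
      qed (use 2 in auto)
      ultimately have "(\<lambda>n. (f y - G n y) + (G n y - g y)) \<longlonglongrightarrow> 0 + 0" by (rule tendsto_add)
      then have "(\<lambda>n::nat. f y - g y) \<longlonglongrightarrow> 0" by simp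
      then show ?thesis by (simp add: LIMSEQ_const_iff)
    qed
    then have "f = g" by auto
    then show "f \<in> H'" using g by simp
  qed
qed fact

section \<open>The Hermite space\<close>

locale hermite_weights =
  fixes \<omega> :: real and a b :: "nat \<Rightarrow> real" and s :: nat
  assumes omega: "0 < \<omega>" "\<omega> < 1"
    and a_ge_1: "\<And>j. j \<in> {1..s} \<Longrightarrow> 1 \<le> a j"
    and b_ge_1: "\<And>j. j \<in> {1..s} \<Longrightarrow> 1 \<le> b j"
begin

definition weight1 :: "nat \<Rightarrow> nat \<Rightarrow> real" where
  "weight1 j n = \<omega> powr (a j * real n powr b j)"

definition weight :: "(nat \<Rightarrow> nat) \<Rightarrow> real" where
  "weight k = \<omega> powr weight_exponent a b s k"

lemma weight_eq_prod: "weight k = (\<Prod>j=1..s. weight1 j (k j))"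
  unfolding weight_def weight1_def weight_exponent_def using omega by (simp add: powr_sum)

lemma weight_pos: "weight k > 0" and weight1_pos: "weight1 j n > 0"
  unfolding weight_def weight1_def using omega by simp_all

lemma weight1_0 [simp]: "weight1 j 0 = 1"
  unfolding weight1_def using omega by simp

lemma powr_minus_weight: "\<omega> powr (- weight_exponent a b s k) = 1 / weight k"
  unfolding weight_def by (simp add: powr_minus_divide)

lemma weight_exponent1_ge:
  assumes "j \<in> {1..s}"
  shows "real n \<le> a j * real n powr b j"
proof (cases "n = 0")
  case False
  have "real n = 1 * real n powr 1" using False by simp
  also have "\<dots> \<le> a j * real n powr b j"
    using a_ge_1[OF assms] b_ge_1[OF assms] False by (intro mult_mono powr_mono) auto
  finally show ?thesis .
qed simp

lemma weight1_le_power: "j \<in> {1..s} \<Longrightarrow> weight1 j n \<le> \<omega> ^ n"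
  unfolding weight1_def using omega weight_exponent1_ge[of j n]
  by (simp add: powr_realpow[symmetric] powr_mono')

lemma summable_weight1: "j \<in> {1..s} \<Longrightarrow> summable (weight1 j)"
  using omega weight1_le_power weight1_pos
  by (intro summable_comparison_test'[OF summable_geometric[of \<omega>], of 0]) (auto simp: less_imp_le)

lemma summable_weight1_hermite1_sq: "j \<in> {1..s} \<Longrightarrow> summable (\<lambda>n. weight1 j n * (hermite1 n x)\<^sup>2)"
  using weight1_le_power weight1_pos
  by (intro summable_comparison_test'[OF summable_power_hermite1_sq[OF omega, of x], of 0])
    (auto simp: less_imp_le abs_mult intro!: mult_right_mono)

lemma weight_summable: "weight summable_on multi_indices s"
  unfolding weight_eq_prod multi_indices_def
  by (rule summable_on_prod_PiE(1)) (auto intro: less_imp_le weight1_pos summable_weight1)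

lemma weight_hermite_sq_summable: "(\<lambda>k. weight k * (hermite s k x)\<^sup>2) summable_on multi_indices s"
proof -
  have "weight k * (hermite s k x)\<^sup>2 = (\<Prod>j\<in>{1..s}. weight1 j (k j) * (hermite1 (k j) (x j))\<^sup>2)" for k
    unfolding weight_eq_prod hermite_def by (simp add: prod.distrib prod_power_distrib)
  moreover have "(\<lambda>k. \<Prod>j\<in>{1..s}. weight1 j (k j) * (hermite1 (k j) (x j))\<^sup>2) summable_on multi_indices s"
    unfolding multi_indices_def
    by (rule summable_on_prod_PiE(1)[where f = "\<lambda>j n. weight1 j n * (hermite1 n (x j))\<^sup>2"])
      (auto intro!: mult_nonneg_nonneg less_imp_le[OF weight1_pos] summable_weight1_hermite1_sq)
  ultimately show ?thesis by simp
qed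

text \<open>
  Only the values on \<open>multi_indices s\<close> matter; elsewhere a coefficient family is arbitrary.
\<close>

definition coeff_space :: "((nat \<Rightarrow> nat) \<Rightarrow> real) set" where
  "coeff_space = {c. (\<lambda>k. (c k)\<^sup>2 / weight k) summable_on multi_indices s}"

lemma coeff_space_mult_summable:
  assumes "c \<in> coeff_space" "(\<lambda>k. weight k * (h k)\<^sup>2) summable_on multi_indices s"
  shows "(\<lambda>k. \<bar>c k * h k\<bar>) summable_on multi_indices s"
    and "(\<lambda>k. c k * h k) summable_on multi_indices s"
    and "\<bar>\<Sum>\<^sub>\<infinity>k\<in>multi_indices s. c k * h k\<bar> \<le>
      sqrt (\<Sum>\<^sub>\<infinity>k\<in>multi_indices s. (c k)\<^sup>2 / weight k) * sqrt (\<Sum>\<^sub>\<infinity>k\<in>multi_indices s. weight k * (h k)\<^sup>2)"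
proof -
  let ?f = "\<lambda>k. c k / sqrt (weight k)" and ?g = "\<lambda>k. sqrt (weight k) * h k"
  have sq: "(?f k)\<^sup>2 = (c k)\<^sup>2 / weight k" "(?g k)\<^sup>2 = weight k * (h k)\<^sup>2"
      and prod: "?f k * ?g k = c k * h k" for k
    using weight_pos[of k] by (simp_all add: power_divide power_mult_distrib)
  have f: "(\<lambda>k. (?f k)\<^sup>2) summable_on multi_indices s" and g: "(\<lambda>k. (?g k)\<^sup>2) summable_on multi_indices s"
    using assms unfolding sq coeff_space_def by auto
  from Cauchy_Schwarz_summable_on[OF f g]
  show "(\<lambda>k. \<bar>c k * h k\<bar>) summable_on multi_indices s"
    "(\<lambda>k. c k * h k) summable_on multi_indices s"
    "\<bar>\<Sum>\<^sub>\<infinity>k\<in>multi_indices s. c k * h k\<bar> \<le>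
      sqrt (\<Sum>\<^sub>\<infinity>k\<in>multi_indices s. (c k)\<^sup>2 / weight k) * sqrt (\<Sum>\<^sub>\<infinity>k\<in>multi_indices s. weight k * (h k)\<^sup>2)"
    unfolding sq prod by auto
qed

lemma coeff_space_hermite_summable:
  "c \<in> coeff_space \<Longrightarrow> (\<lambda>k. c k * hermite s k x) summable_on multi_indices s"
  by (rule coeff_space_mult_summable(2)[OF _ weight_hermite_sq_summable])

lemma coeff_space_abs_summable: "c \<in> coeff_space \<Longrightarrow> (\<lambda>k. \<bar>c k\<bar>) summable_on multi_indices s"
  using coeff_space_mult_summable(1)[of c "\<lambda>_. 1"] weight_summable by simp

lemma coeff_space_scale: "c \<in> coeff_space \<Longrightarrow> (\<lambda>k. r * c k) \<in> coeff_space"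
  unfolding coeff_space_def
  using summable_on_cmult_right[of "\<lambda>k. (c k)\<^sup>2 / weight k" _ "r\<^sup>2"] by (simp add: power_mult_distrib)

lemma coeff_space_add:
  assumes "c \<in> coeff_space" "d \<in> coeff_space"
  shows "(\<lambda>k. c k + d k) \<in> coeff_space"
proof -
  have sum: "(\<lambda>k. 2 * ((c k)\<^sup>2 / weight k + (d k)\<^sup>2 / weight k)) summable_on multi_indices s"
    using assms unfolding coeff_space_def by (intro summable_on_cmult_right summable_on_add) auto
  show ?thesis unfolding coeff_space_def mem_Collect_eq
  proof (rule summable_on_comparison_test[OF sum])
    fix k
    have "0 \<le> (c k - d k)\<^sup>2" by simp
    then have "(c k + d k)\<^sup>2 \<le> 2 * ((c k)\<^sup>2 + (d k)\<^sup>2)"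
      unfolding power2_sum power2_diff by (simp add: algebra_simps)
    then have "(c k + d k)\<^sup>2 / weight k \<le> 2 * ((c k)\<^sup>2 + (d k)\<^sup>2) / weight k"
      using weight_pos[of k] by (intro divide_right_mono) (auto simp: less_imp_le)
    then show "(c k + d k)\<^sup>2 / weight k \<le> 2 * ((c k)\<^sup>2 / weight k + (d k)\<^sup>2 / weight k)"
      by (simp add: add_divide_distrib)
  qed (use weight_pos in \<open>simp add: less_imp_le\<close>)
qed

lemma coeff_space_finite_support:
  assumes "finite {k \<in> multi_indices s. c k \<noteq> 0}"
  shows "c \<in> coeff_space"
  unfolding coeff_space_def mem_Collect_eq
  by (rule finite_nonzero_values_imp_summable_on) (use assms in \<open>auto elim!: rev_finite_subset\<close>)

definition hermite_series :: "((nat \<Rightarrow> nat) \<Rightarrow> real) \<Rightarrow> (nat \<Rightarrow> real) \<Rightarrow> real" where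
  "hermite_series c x = (if x \<in> points s then \<Sum>\<^sub>\<infinity>k\<in>multi_indices s. c k * hermite s k x else 0)"

lemma hermite_series_cong:
  "(\<And>k. k \<in> multi_indices s \<Longrightarrow> c k = d k) \<Longrightarrow> hermite_series c = hermite_series d"
  unfolding hermite_series_def by (auto simp: fun_eq_iff intro!: infsum_cong)

lemma hermite_series_add:
  "c \<in> coeff_space \<Longrightarrow> d \<in> coeff_space \<Longrightarrow>
    hermite_series (\<lambda>k. c k + d k) = (\<lambda>x. hermite_series c x + hermite_series d x)"
  unfolding hermite_series_def
  by (auto simp: fun_eq_iff distrib_right infsum_add coeff_space_hermite_summable)

lemma hermite_series_scale: "hermite_series (\<lambda>k. r * c k) = (\<lambda>x. r * hermite_series c x)"
  unfolding hermite_series_def by (auto simp: fun_eq_iff mult.assoc infsum_cmult_right')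

lemma countable_multi_indices: "countable (multi_indices s)"
  unfolding multi_indices_def by (intro countable_PiE) auto

lemma space_lborel_product: "space (\<Pi>\<^sub>M j\<in>{1..s}. lborel :: real measure) = points s"
  by (simp add: space_PiM points_def)

text \<open>
  Termwise integration: the integrals of the absolute values are at most \<open>\<bar>c l\<bar>\<close>, which is summable.
\<close>

lemma hermite_coeff_series:
  assumes c: "c \<in> coeff_space" and k: "k \<in> multi_indices s"
  shows "hermite_coeff s (hermite_series c) k = c k"
proof -
  let ?M = "\<Pi>\<^sub>M j\<in>{1..s}. lborel :: real measure"
  let ?g = "\<lambda>l x. c l * (hermite s l x * hermite s k x * gauss_density s x)"
  have "hermite_coeff s (hermite_series c) k = (\<integral>x. (\<Sum>\<^sub>\<infinity>l\<in>multi_indices s. ?g l x) \<partial>?M)"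
    unfolding hermite_coeff_def gauss_integral_def
  proof (rule Bochner_Integration.integral_cong[OF refl])
    fix x assume "x \<in> space ?M"
    then have "hermite_series c x = (\<Sum>\<^sub>\<infinity>l\<in>multi_indices s. c l * hermite s l x)"
      unfolding space_lborel_product hermite_series_def by simp
    then show "hermite_series c x * hermite s k x * gauss_density s x = (\<Sum>\<^sub>\<infinity>l\<in>multi_indices s. ?g l x)"
      by (simp add: infsum_cmult_left'[symmetric] mult.assoc)
  qed
  also have "\<dots> = (\<Sum>\<^sub>\<infinity>l\<in>multi_indices s. \<integral>x. ?g l x \<partial>?M)"
  proof (rule integral_infsum[OF countable_multi_indices])
    show "integrable ?M (?g l)" for l
      by (intro integrable_mult_right integrable_hermite_product)
    show "(\<lambda>l. \<integral>x. \<bar>?g l x\<bar> \<partial>?M) summable_on multi_indices s"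
    proof (rule summable_on_comparison_test[OF coeff_space_abs_summable[OF c]])
      fix l assume l: "l \<in> multi_indices s"
      have "(\<integral>x. \<bar>?g l x\<bar> \<partial>?M) = \<bar>c l\<bar> * (\<integral>x. \<bar>hermite s l x * hermite s k x * gauss_density s x\<bar> \<partial>?M)"
        unfolding abs_mult[of "c l"] by (rule integral_mult_right_zero)
      also have "\<dots> \<le> \<bar>c l\<bar> * 1"
        by (intro mult_left_mono gauss_integral_abs_hermite_product_le l k) auto
      finally show "(\<integral>x. \<bar>?g l x\<bar> \<partial>?M) \<le> \<bar>c l\<bar>" by simp
    qed auto
    fix x
    have "(\<lambda>l. c l * hermite s l x * (hermite s k x * gauss_density s x)) summable_on multi_indices s"
      by (intro summable_on_cmult_left coeff_space_hermite_summable[OF c])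
    then show "(\<lambda>l. ?g l x) summable_on multi_indices s" by (simp add: mult.assoc)
  qed
  also have "\<dots> = (\<Sum>\<^sub>\<infinity>l\<in>multi_indices s. if l = k then c k else 0)"
  proof (rule infsum_cong)
    fix l assume l: "l \<in> multi_indices s"
    have "(\<integral>x. ?g l x \<partial>?M) = c l * gauss_integral s (\<lambda>x. hermite s l x * hermite s k x)"
      unfolding gauss_integral_def by (rule integral_mult_right_zero)
    also have "\<dots> = (if l = k then c k else 0)"
      unfolding gauss_integral_hermite_product[OF l k] by simp
    finally show "(\<integral>x. ?g l x \<partial>?M) = (if l = k then c k else 0)" .
  qed
  also have "\<dots> = (\<Sum>\<^sub>\<infinity>l\<in>{k}. if l = k then c k else 0)"
    by (rule infsum_cong_neutral) (use k in auto)
  finally show ?thesis by simp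
qed

definition series_space :: "((nat \<Rightarrow> real) \<Rightarrow> real) set" where
  "series_space = hermite_series ` coeff_space"

lemma series_spaceE:
  assumes "f \<in> series_space"
  shows "hermite_coeff s f \<in> coeff_space" "f = hermite_series (hermite_coeff s f)"
proof -
  obtain c where c: "c \<in> coeff_space" "f = hermite_series c"
    using assms unfolding series_space_def by auto
  have eq: "hermite_coeff s f k = c k" if "k \<in> multi_indices s" for k
    using hermite_coeff_series[OF c(1) that] c(2) by simp
  have "(\<lambda>k. (hermite_coeff s f k)\<^sup>2 / weight k) summable_on multi_indices s \<longleftrightarrow>
      (\<lambda>k. (c k)\<^sup>2 / weight k) summable_on multi_indices s"
    by (rule summable_on_cong) (simp add: eq)
  then show "hermite_coeff s f \<in> coeff_space"
    using c(1) by (simp add: coeff_space_def)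
  have "hermite_series (hermite_coeff s f) = hermite_series c"
    by (rule hermite_series_cong) (rule eq)
  then show "f = hermite_series (hermite_coeff s f)" using c(2) by simp
qed

abbreviation "ip \<equiv> hermite_ip \<omega> a b s"
abbreviation "K \<equiv> hermite_kernel \<omega> a b s"

lemma ip_eq: "ip f g = (\<Sum>\<^sub>\<infinity>k\<in>multi_indices s. hermite_coeff s f k * hermite_coeff s g k / weight k)"
  unfolding hermite_ip_def powr_minus_weight by (simp add: mult_ac)

lemma ip_self_eq: "ip f f = (\<Sum>\<^sub>\<infinity>k\<in>multi_indices s. (hermite_coeff s f k)\<^sup>2 / weight k)"
  unfolding ip_eq power2_eq_square ..

lemma ip_series_self:
  assumes "c \<in> coeff_space"
  shows "ip (hermite_series c) (hermite_series c) = (\<Sum>\<^sub>\<infinity>k\<in>multi_indices s. (c k)\<^sup>2 / weight k)"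
  unfolding ip_self_eq by (rule infsum_cong) (simp add: hermite_coeff_series[OF assms])

lemma series_space_ip_summable:
  assumes "f \<in> series_space" "g \<in> series_space"
  shows "(\<lambda>k. hermite_coeff s f k * hermite_coeff s g k / weight k) summable_on multi_indices s"
proof -
  have "(\<lambda>k. hermite_coeff s f k * (hermite_coeff s g k / weight k)) summable_on multi_indices s"
  proof (rule coeff_space_mult_summable(2))
    show "hermite_coeff s f \<in> coeff_space" using series_spaceE assms by blast
    have "weight k * (hermite_coeff s g k / weight k)\<^sup>2 = (hermite_coeff s g k)\<^sup>2 / weight k" for k
      using weight_pos[of k] by (simp add: power2_eq_square)
    then show "(\<lambda>k. weight k * (hermite_coeff s g k / weight k)\<^sup>2) summable_on multi_indices s"
      using series_spaceE(1)[OF assms(2)] by (simp add: coeff_space_def)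
  qed
  then show ?thesis by simp
qed

lemma hermite_coeff_add:
  assumes "f \<in> series_space" "g \<in> series_space" "k \<in> multi_indices s"
  shows "hermite_coeff s (\<lambda>x. f x + g x) k = hermite_coeff s f k + hermite_coeff s g k"
proof -
  note f = series_spaceE[OF assms(1)] and g = series_spaceE[OF assms(2)]
  have "(\<lambda>x. f x + g x) = hermite_series (\<lambda>k. hermite_coeff s f k + hermite_coeff s g k)"
    using hermite_series_add[OF f(1) g(1)] f(2) g(2) by simp
  then show ?thesis using hermite_coeff_series[OF coeff_space_add[OF f(1) g(1)] assms(3)] by simp
qed

lemma hermite_coeff_scale: "hermite_coeff s (\<lambda>x. r * f x) k = r * hermite_coeff s f k"
  unfolding hermite_coeff_def gauss_integral_def mult.assoc by (rule integral_mult_right_zero)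

lemma series_space_add: "f \<in> series_space \<Longrightarrow> g \<in> series_space \<Longrightarrow> (\<lambda>x. f x + g x) \<in> series_space"
  unfolding series_space_def by (auto simp: hermite_series_add[symmetric] intro!: imageI coeff_space_add)

lemma series_space_scale: "f \<in> series_space \<Longrightarrow> (\<lambda>x. r * f x) \<in> series_space"
  unfolding series_space_def by (auto simp: hermite_series_scale[symmetric] intro!: imageI coeff_space_scale)

lemma hermite_series_diff:
  assumes "c \<in> coeff_space" "d \<in> coeff_space"
  shows "hermite_series (\<lambda>k. c k - d k) = (\<lambda>x. hermite_series c x - hermite_series d x)"
  using hermite_series_add[OF assms(1) coeff_space_scale[OF assms(2), of "-1"]] hermite_series_scale[of "-1" d]
  by (simp add: fun_eq_iff)

lemma coeff_space_diff:
  assumes "c \<in> coeff_space" "d \<in> coeff_space"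
  shows "(\<lambda>k. c k - d k) \<in> coeff_space"
  using coeff_space_add[OF assms(1) coeff_space_scale[OF assms(2), of "-1"]] by simp

text \<open>
  Completeness of a weighted sequence space: the coefficients converge one by one,
      and finite partial sums of the
  squared distance pass to the limit.
\<close>

lemma series_space_complete:
  fixes F :: "nat \<Rightarrow> (nat \<Rightarrow> real) \<Rightarrow> real"
  assumes F: "\<And>n. F n \<in> series_space"
    and cauchy: "\<And>e. e > 0 \<Longrightarrow> \<exists>N. \<forall>m\<ge>N. \<forall>n\<ge>N. sqrt (ip (\<lambda>x. F m x - F n x) (\<lambda>x. F m x - F n x)) < e"
  shows "\<exists>f\<in>series_space. (\<lambda>n. sqrt (ip (\<lambda>x. F n x - f x) (\<lambda>x. F n x - f x))) \<longlonglongrightarrow> 0"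
proof -
  define c where "c n = hermite_coeff s (F n)" for n
  have c: "c n \<in> coeff_space" and Fc: "F n = hermite_series (c n)" for n
    using series_spaceE[OF F[of n]] by (auto simp: c_def)
  have ipd: "ip (\<lambda>x. F m x - F n x) (\<lambda>x. F m x - F n x) =
      (\<Sum>\<^sub>\<infinity>k\<in>multi_indices s. (c m k - c n k)\<^sup>2 / weight k)" for m n
    using ip_series_self[OF coeff_space_diff[OF c[of m] c[of n]]] hermite_series_diff[OF c[of m] c[of n]]
    by (simp add: Fc)
  have nn: "(x k)\<^sup>2 / weight k \<ge> 0" for x :: "(nat \<Rightarrow> nat) \<Rightarrow> real" and k
    using weight_pos[of k] by simp
  have fin: "\<exists>N. \<forall>m\<ge>N. \<forall>n\<ge>N. \<forall>A. finite A \<longrightarrow> A \<subseteq> multi_indices s \<longrightarrow> (\<Sum>k\<in>A. (c m k - c n k)\<^sup>2 / weight k) \<le> e\<^sup>2"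
    if e: "e > 0" for e
  proof -
    obtain N where N: "\<And>m n. m \<ge> N \<Longrightarrow> n \<ge> N \<Longrightarrow> sqrt (ip (\<lambda>x. F m x - F n x) (\<lambda>x. F m x - F n x)) < e"
      using cauchy[OF e] by blast
    show ?thesis
    proof (intro exI[of _ N] allI impI)
      fix m n A assume mn: "m \<ge> N" "n \<ge> N" and A: "finite A" "A \<subseteq> multi_indices s"
      have "(\<Sum>k\<in>A. (c m k - c n k)\<^sup>2 / weight k) \<le> (\<Sum>\<^sub>\<infinity>k\<in>multi_indices s. (c m k - c n k)\<^sup>2 / weight k)"
        using coeff_space_diff[OF c c, of m n] A nn[of "\<lambda>k. c m k - c n k"]
        by (intro finite_sum_le_infsum) (auto simp: coeff_space_def)
      also have "\<dots> < e\<^sup>2" using N[OF mn] e unfolding ipd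
        by (metis less_le real_sqrt_less_iff real_sqrt_unique)
      finally show "(\<Sum>k\<in>A. (c m k - c n k)\<^sup>2 / weight k) \<le> e\<^sup>2" by simp
    qed
  qed
  have "convergent (\<lambda>n. c n k)" if k: "k \<in> multi_indices s" for k
  proof -
    have "Cauchy (\<lambda>n. c n k)"
    proof (rule metric_CauchyI)
      fix e :: real assume e: "e > 0"
      define e' where "e' = e / (2 * sqrt (weight k))"
      have e': "e' > 0" using e weight_pos[of k] by (simp add: e'_def)
      obtain N where N': "\<forall>m\<ge>N. \<forall>n\<ge>N. \<forall>A. finite A \<longrightarrow> A \<subseteq> multi_indices s \<longrightarrow>
          (\<Sum>k\<in>A. (c m k - c n k)\<^sup>2 / weight k) \<le> e'\<^sup>2"
        using fin[OF e'] by (elim exE) (rule that)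
      note N = N'[rule_format]
      show "\<exists>N. \<forall>m\<ge>N. \<forall>n\<ge>N. dist (c m k) (c n k) < e"
      proof (intro exI[of _ N] allI impI)
        fix m n assume "m \<ge> N" "n \<ge> N"
        from N[OF this, of "{k}"] k have "(c m k - c n k)\<^sup>2 / weight k \<le> e'\<^sup>2" by simp
        then have "(c m k - c n k)\<^sup>2 \<le> (e / 2)\<^sup>2"
          using weight_pos[of k] by (simp add: e'_def power_divide power_mult_distrib field_simps)
        then have "\<bar>c m k - c n k\<bar> \<le> \<bar>e / 2\<bar>" by (simp only: abs_le_square_iff)
        then show "dist (c m k) (c n k) < e" using e by (simp add: dist_real_def)
      qed
    qed
    then show ?thesis by (simp add: Cauchy_convergent_iff)
  qed
  then have lim: "(\<lambda>n. c n k) \<longlonglongrightarrow> lim (\<lambda>n. c n k)" if "k \<in> multi_indices s" for k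
    using that by (simp add: convergent_LIMSEQ_iff)
  define d where "d k = lim (\<lambda>n. c n k)" for k
  have tail: "\<exists>N. \<forall>m\<ge>N. (\<lambda>k. c m k - d k) \<in> coeff_space \<and>
      (\<Sum>\<^sub>\<infinity>k\<in>multi_indices s. (c m k - d k)\<^sup>2 / weight k) \<le> e\<^sup>2" if e: "e > 0" for e
  proof -
    obtain N where N': "\<forall>m\<ge>N. \<forall>n\<ge>N. \<forall>A. finite A \<longrightarrow> A \<subseteq> multi_indices s \<longrightarrow>
        (\<Sum>k\<in>A. (c m k - c n k)\<^sup>2 / weight k) \<le> e\<^sup>2"
      using fin[OF e] by (elim exE) (rule that)
    note N = N'[rule_format]
    show ?thesis
    proof (intro exI[of _ N] allI impI)
      fix m assume m: "m \<ge> N"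
      have part: "(\<Sum>k\<in>A. (c m k - d k)\<^sup>2 / weight k) \<le> e\<^sup>2" if A: "finite A" "A \<subseteq> multi_indices s" for A
      proof (rule LIMSEQ_le_const2)
        show "(\<lambda>n. \<Sum>k\<in>A. (c m k - c n k)\<^sup>2 / weight k) \<longlonglongrightarrow> (\<Sum>k\<in>A. (c m k - d k)\<^sup>2 / weight k)"
        proof (intro tendsto_sum tendsto_divide tendsto_power tendsto_diff tendsto_const)
          fix k assume "k \<in> A"
          then show "(\<lambda>n. c n k) \<longlonglongrightarrow> d k" unfolding d_def using A(2) lim by blast
          show "weight k \<noteq> 0" using weight_pos[of k] by simp
        qed
        show "\<exists>N. \<forall>n\<ge>N. (\<Sum>k\<in>A. (c m k - c n k)\<^sup>2 / weight k) \<le> e\<^sup>2"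
          using N[OF m _ A] by blast
      qed
      have "(\<lambda>k. (c m k - d k)\<^sup>2 / weight k) summable_on multi_indices s"
      proof (rule nonneg_bdd_above_summable_on)
        show "bdd_above (sum (\<lambda>k. (c m k - d k)\<^sup>2 / weight k) ` {A. A \<subseteq> multi_indices s \<and> finite A})"
          by (rule bdd_aboveI2[of _ _ "e\<^sup>2"]) (use part in blast)
      qed (rule nn)
      then show "(\<lambda>k. c m k - d k) \<in> coeff_space \<and>
          (\<Sum>\<^sub>\<infinity>k\<in>multi_indices s. (c m k - d k)\<^sup>2 / weight k) \<le> e\<^sup>2"
        using part by (auto simp: coeff_space_def intro!: infsum_le_finite_sums)
    qed
  qed
  obtain m where "(\<lambda>k. c m k - d k) \<in> coeff_space" using tail[of 1] by auto
  from coeff_space_diff[OF c[of m] this] have d: "d \<in> coeff_space" by simp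
  show ?thesis
  proof (rule bexI)
    show "hermite_series d \<in> series_space" unfolding series_space_def using d by simp
    show "(\<lambda>n. sqrt (ip (\<lambda>x. F n x - hermite_series d x) (\<lambda>x. F n x - hermite_series d x))) \<longlonglongrightarrow> 0"
    proof (rule LIMSEQ_I)
      fix r :: real assume r: "r > 0"
      obtain N where N: "\<And>m. m \<ge> N \<Longrightarrow> (\<Sum>\<^sub>\<infinity>k\<in>multi_indices s. (c m k - d k)\<^sup>2 / weight k) \<le> (r / 2)\<^sup>2"
        using tail[of "r / 2"] r by auto
      show "\<exists>no. \<forall>n\<ge>no. norm (sqrt (ip (\<lambda>x. F n x - hermite_series d x) (\<lambda>x. F n x - hermite_series d
          x)) - 0) < r"
      proof (intro exI[of _ N] allI impI)
        fix n assume "n \<ge> N"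
        have eq: "ip (\<lambda>x. F n x - hermite_series d x) (\<lambda>x. F n x - hermite_series d x) =
            (\<Sum>\<^sub>\<infinity>k\<in>multi_indices s. (c n k - d k)\<^sup>2 / weight k)"
          using ip_series_self[OF coeff_space_diff[OF c[of n] d]] hermite_series_diff[OF c[of n] d]
              by (simp add: Fc)
        have "sqrt (\<Sum>\<^sub>\<infinity>k\<in>multi_indices s. (c n k - d k)\<^sup>2 / weight k) \<le> r / 2"
          using N[OF \<open>n \<ge> N\<close>] r by (intro real_le_lsqrt) (auto intro!: infsum_nonneg nn)
        moreover have "0 \<le> (\<Sum>\<^sub>\<infinity>k\<in>multi_indices s. (c n k - d k)\<^sup>2 / weight k)"
          by (intro infsum_nonneg nn)
        ultimately show "norm (sqrt (ip (\<lambda>x. F n x - hermite_series d x) (\<lambda>x. F n x - hermite_series d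
            x)) - 0) < r"
          using r unfolding eq by simp
      qed
    qed
  qed
qed

lemma kernel_section_eq_series:
  assumes "y \<in> points s"
  shows "(\<lambda>k. weight k * hermite s k y) \<in> coeff_space"
    and "kernel_section (points s) K y = hermite_series (\<lambda>k. weight k * hermite s k y)"
proof -
  have "(weight k * hermite s k y)\<^sup>2 / weight k = weight k * (hermite s k y)\<^sup>2" for k
    using weight_pos[of k] by (simp add: power2_eq_square)
  then show "(\<lambda>k. weight k * hermite s k y) \<in> coeff_space"
    unfolding coeff_space_def using weight_hermite_sq_summable by simp
  show "kernel_section (points s) K y = hermite_series (\<lambda>k. weight k * hermite s k y)"
    unfolding kernel_section_def hermite_series_def hermite_kernel_def weight_def[symmetric]
    by (simp add: fun_eq_iff mult_ac)
qed

lemma reproducing_series: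
  assumes y: "y \<in> points s"
  shows "ip f (kernel_section (points s) K y) = hermite_series (hermite_coeff s f) y"
proof -
  have "ip f (kernel_section (points s) K y) =
      (\<Sum>\<^sub>\<infinity>k\<in>multi_indices s. hermite_coeff s f k * hermite s k y)"
    unfolding ip_eq kernel_section_eq_series(2)[OF y]
  proof (rule infsum_cong)
    fix k assume k: "k \<in> multi_indices s"
    show "hermite_coeff s f k * hermite_coeff s (hermite_series (\<lambda>k. weight k * hermite s k y)) k / weight k =
        hermite_coeff s f k * hermite s k y"
      unfolding hermite_coeff_series[OF kernel_section_eq_series(1)[OF y] k] using weight_pos[of k] by simp
  qed
  then show ?thesis using y by (simp add: hermite_series_def)
qed

lemma series_space_rkhs: "rkhs (points s) K series_space ip"
proof
  show "f x = 0" if "f \<in> series_space" "x \<notin> points s" for f x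
    using that by (auto simp: series_space_def hermite_series_def)
  have "(\<lambda>k. 0) \<in> coeff_space" by (simp add: coeff_space_def)
  moreover have "hermite_series (\<lambda>k. 0) = (\<lambda>x. 0)" by (auto simp: hermite_series_def)
  ultimately show "(\<lambda>x. 0) \<in> series_space" unfolding series_space_def by (metis imageI)
  show "(\<lambda>x. f x + g x) \<in> series_space" if "f \<in> series_space" "g \<in> series_space" for f g
    using that by (rule series_space_add)
  show "(\<lambda>x. c * f x) \<in> series_space" if "f \<in> series_space" for c f
    using that by (rule series_space_scale)
  show "ip f g = ip g f" for f g unfolding ip_eq by (simp add: mult.commute)
  show "ip (\<lambda>x. f x + g x) h = ip f h + ip g h"
    if "f \<in> series_space" "g \<in> series_space" "h \<in> series_space" for f g h
  proof -
    have "ip (\<lambda>x. f x + g x) h = (\<Sum>\<^sub>\<infinity>k\<in>multi_indices s.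
        hermite_coeff s f k * hermite_coeff s h k / weight k + hermite_coeff s g k * hermite_coeff s h k
            / weight k)"
      unfolding ip_eq by (rule infsum_cong)
        (simp add: hermite_coeff_add[OF that(1,2)] distrib_right add_divide_distrib)
    then show ?thesis
      unfolding ip_eq using series_space_ip_summable that by (simp add: infsum_add)
  qed
  show "ip (\<lambda>x. c * f x) g = c * ip f g" for c f g
    unfolding ip_eq hermite_coeff_scale infsum_cmult_right'[symmetric] by (simp add: mult.assoc)
  show "ip f f > 0" if f: "f \<in> series_space" "f \<noteq> (\<lambda>x. 0)" for f
  proof -
    have "\<exists>k\<in>multi_indices s. hermite_coeff s f k \<noteq> 0"
    proof (rule ccontr)
      assume "\<not> ?thesis"
      then have "hermite_series (hermite_coeff s f) = hermite_series (\<lambda>_. 0)"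
        by (intro hermite_series_cong) auto
      then show False using series_spaceE(2)[OF f(1)] f(2) by (auto simp: hermite_series_def)
    qed
    then obtain k where k: "k \<in> multi_indices s" "hermite_coeff s f k \<noteq> 0" by blast
    have "0 < (hermite_coeff s f k)\<^sup>2 / weight k" using k weight_pos[of k] by simp
    also have "\<dots> = (\<Sum>k\<in>{k}. (hermite_coeff s f k)\<^sup>2 / weight k)" by simp
    also have "\<dots> \<le> ip f f"
      unfolding ip_self_eq using series_spaceE(1)[OF f(1)] k weight_pos
      by (intro finite_sum_le_infsum) (auto simp: coeff_space_def less_imp_le)
    finally show ?thesis .
  qed
  show "kernel_section (points s) K y \<in> series_space" if "y \<in> points s" for y
    unfolding kernel_section_eq_series(2)[OF that] series_space_def
    using kernel_section_eq_series(1)[OF that] by simp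
  show "f y = ip f (kernel_section (points s) K y)" if "f \<in> series_space" "y \<in> points s" for f y
    using series_spaceE(2)[OF that(1)] reproducing_series[OF that(2), of f] by simp
qed (rule series_space_complete)

text \<open>
  Because the inner product is given by Hermite coefficients, the reproducing property already expresses every
  element of any candidate space as its Hermite series. Such a space is therefore contained in the space of all
  series, and equality holds by \<open>rkhs_subset_eq\<close>.
\<close>

theorem hermite_space_eq: "hermite_space \<omega> a b s = series_space"
  unfolding hermite_space_def
proof (rule the_equality)
  show "rkhs (points s) K series_space ip" by (rule series_space_rkhs)
next
  fix H assume H: "rkhs (points s) K H ip"
  interpret H: rkhs "points s" K H ip by fact
  have "H \<subseteq> series_space"
  proof
    fix f assume f: "f \<in> H"
    show "f \<in> series_space"
    proof (cases "f = (\<lambda>x. 0)")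
      case True
      interpret S: rkhs "points s" K series_space ip by (rule series_space_rkhs)
      show ?thesis unfolding True by (rule S.zero_mem)
    next
      case False
      have "ip f f > 0" using H.ip_pos[OF f False] .
      then have "(\<lambda>k. (hermite_coeff s f k)\<^sup>2 / weight k) summable_on multi_indices s"
        unfolding ip_self_eq using infsum_not_exists by fastforce
      then have "hermite_coeff s f \<in> coeff_space" by (simp add: coeff_space_def)
      moreover have "f x = hermite_series (hermite_coeff s f) x" for x
        using H.reproducing[OF f, of x] reproducing_series[of x f] H.zero_outside[OF f, of x]
        by (cases "x \<in> points s") (auto simp: hermite_series_def)
      then have "f = hermite_series (hermite_coeff s f)" by auto
      ultimately show ?thesis unfolding series_space_def by blast
    qed
  qed
  then show "H = series_space" by (rule rkhs_subset_eq[OF H series_space_rkhs])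
qed

end

section \<open>Auxiliary linear algebra\<close>

text \<open>
  More unknowns than equations. Gaussian elimination: solve the last equation for one unknown \<open>p\<close>
      and substitute.
\<close>

lemma underdetermined_system_solution:
  fixes v :: "nat \<Rightarrow> 'k \<Rightarrow> real"
  assumes "finite \<Lambda>" "n < card \<Lambda>"
  shows "\<exists>d. (\<exists>k\<in>\<Lambda>. d k \<noteq> 0) \<and> (\<forall>i\<in>{1..n}. (\<Sum>k\<in>\<Lambda>. d k * v i k) = 0)"
  using assms
proof (induction n arbitrary: \<Lambda> v)
  case 0
  then have "\<Lambda> \<noteq> {}" by auto
  then show ?case by (intro exI[of _ "\<lambda>_. 1"]) auto
next
  case (Suc n)
  have split: "{1..Suc n} = insert (Suc n) {1..n}" by auto
  show ?case
  proof (cases "\<forall>k\<in>\<Lambda>. v (Suc n) k = 0")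
    case True
    obtain d where "\<exists>k\<in>\<Lambda>. d k \<noteq> 0" "\<forall>i\<in>{1..n}. (\<Sum>k\<in>\<Lambda>. d k * v i k) = 0"
      using Suc.IH[of \<Lambda> v] Suc.prems by auto
    then show ?thesis unfolding split using True by (intro exI[of _ d]) auto
  next
    case False
    then obtain p where p: "p \<in> \<Lambda>" "v (Suc n) p \<noteq> 0" by blast
    define v' where "v' i k = v i k - v i p * v (Suc n) k / v (Suc n) p" for i k
    have "n < card (\<Lambda> - {p})" using Suc.prems p by simp
    then obtain d where d: "\<exists>k\<in>\<Lambda> - {p}. d k \<noteq> 0" "\<And>i. i \<in> {1..n} \<Longrightarrow> (\<Sum>k\<in>\<Lambda> - {p}. d k * v' i k) = 0"
      using Suc.IH[of "\<Lambda> - {p}" v'] Suc.prems(1) by blast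
    define r where "r = - (\<Sum>k\<in>\<Lambda> - {p}. d k * v (Suc n) k) / v (Suc n) p"
    define e where "e = d(p := r)"
    have sum: "(\<Sum>k\<in>\<Lambda>. e k * v i k) = r * v i p + (\<Sum>k\<in>\<Lambda> - {p}. d k * v i k)" for i
      using Suc.prems p by (subst sum.remove[of _ p]) (auto simp: e_def intro!: sum.cong)
    have "(\<Sum>k\<in>\<Lambda>. e k * v i k) = 0" if i: "i \<in> {1..Suc n}" for i
    proof (cases "i = Suc n")
      case True
      then show ?thesis unfolding sum using p by (simp add: r_def)
    next
      case False
      then have "0 = (\<Sum>k\<in>\<Lambda> - {p}. d k * v' i k)" using d(2) i by simp
      also have "\<dots> = (\<Sum>k\<in>\<Lambda> - {p}. d k * v i k) - v i p / v (Suc n) p * (\<Sum>k\<in>\<Lambda> - {p}. d k * v (Suc n) k)"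
        unfolding v'_def sum_distrib_left sum_subtractf[symmetric] by (intro sum.cong) (auto simp:
            algebra_simps)
      also have "\<dots> = r * v i p + (\<Sum>k\<in>\<Lambda> - {p}. d k * v i k)"
        by (simp add: r_def)
      finally show ?thesis unfolding sum by simp
    qed
    moreover have "\<exists>k\<in>\<Lambda>. e k \<noteq> 0" using d(1) by (auto simp: e_def)
    ultimately show ?thesis by blast
  qed
qed

section \<open>Products of Hermite polynomials in the Hermite basis\<close>

definition hermite_linearization :: "nat \<Rightarrow> nat \<Rightarrow> nat \<Rightarrow> real" where
  "hermite_linearization k l m = gauss_mean (hermite_poly k * (hermite_poly l * hermite_poly m))"

text \<open>
  Subtracting a multiple of \<open>H\<^sub>N\<close> lowers the degree, which gives some expansion; orthonormality identifies its
  coefficients.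
\<close>

lemma poly_hermite_expansion:
  "degree p \<le> N \<Longrightarrow> p = (\<Sum>m\<le>N. smult (gauss_mean (p * hermite_poly m)) (hermite_poly m))"
proof -
  have ex: "\<exists>e. p = (\<Sum>m\<le>N. smult (e m) (hermite_poly m))" if "degree p \<le> N" for p and N :: nat
    using that
  proof (induction N arbitrary: p)
    case 0
    then obtain c where "p = [:c:]" by (metis degree_eq_zeroE le_zero_eq)
    then show ?case by (intro exI[of _ "\<lambda>_. c"]) (simp add: one_pCons)
  next
    case (Suc N)
    define r where "r = coeff p (Suc N) / lead_coeff (hermite_poly (Suc N))"
    let ?q = "p - smult r (hermite_poly (Suc N))"
    have lc: "lead_coeff (hermite_poly (Suc N)) \<noteq> 0" using hermite_poly_nonzero[of "Suc N"]
        by (simp del: hermite_poly.simps)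
    have "degree ?q \<le> N"
    proof (rule degree_le, intro allI impI)
      fix i assume i: "N < i"
      show "coeff ?q i = 0"
      proof (cases "i = Suc N")
        case True
        then show ?thesis using lc unfolding r_def degree_hermite_poly by (simp del: hermite_poly.simps)
      next
        case False
        then have "degree p < i" "degree (hermite_poly (Suc N)) < i"
          using i Suc.prems degree_hermite_poly[of "Suc N"] by auto
        then show ?thesis by (simp add: coeff_eq_0 del: hermite_poly.simps)
      qed
    qed
    then obtain e where e: "?q = (\<Sum>m\<le>N. smult (e m) (hermite_poly m))" using Suc.IH by blast
    have "p = ?q + smult r (hermite_poly (Suc N))" by simp
    also have "\<dots> = (\<Sum>m\<le>Suc N. smult ((e(Suc N := r)) m) (hermite_poly m))"
      unfolding e sum.atMost_Suc by simp
    finally show ?case by blast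
  qed
  assume "degree p \<le> N"
  then obtain e where e: "p = (\<Sum>m\<le>N. smult (e m) (hermite_poly m))" using ex by blast
  have "gauss_mean (p * hermite_poly m) = e m" if "m \<le> N" for m
  proof -
    have "gauss_mean (p * hermite_poly m) = (\<Sum>l\<le>N. e l * gauss_mean (hermite_poly l * hermite_poly m))"
      by (subst e) (simp add: sum_distrib_right gauss_mean_sum gauss_mean_smult)
    also have "\<dots> = (\<Sum>l\<le>N. if l = m then e m else 0)"
      unfolding gauss_mean_orthonormal by (intro sum.cong) auto
    finally show ?thesis using that by simp
  qed
  then have "(\<Sum>m\<le>N. smult (gauss_mean (p * hermite_poly m)) (hermite_poly m)) =
      (\<Sum>m\<le>N. smult (e m) (hermite_poly m))"
    by (intro sum.cong) auto
  then show "p = (\<Sum>m\<le>N. smult (gauss_mean (p * hermite_poly m)) (hermite_poly m))" using e by simp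
qed

lemma hermite1_product_expansion:
  assumes "k \<le> t" "l \<le> t"
  shows "hermite1 k x * hermite1 l x = (\<Sum>m\<le>2 * t. hermite_linearization k l m * hermite1 m x)"
proof -
  have "degree (hermite_poly k * hermite_poly l) \<le> 2 * t"
    using degree_mult_le[of "hermite_poly k" "hermite_poly l"] assms by (simp add: degree_hermite_poly)
  from arg_cong[OF poly_hermite_expansion[OF this], of "\<lambda>p. poly p x"]
  show ?thesis
    by (simp add: poly_sum hermite1_eq_poly hermite_linearization_def mult.assoc del: hermite_poly.simps)
qed

lemma hermite_linearization_0: "hermite_linearization k l 0 = (if k = l then 1 else 0)"
  unfolding hermite_linearization_def by (simp add: gauss_mean_orthonormal)

text \<open>
  The quantity \<open>D(t)\<close> of the lower estimate: an upper bound for the squared \<open>L\<^sup>2\<close> norm of \<open>f\<^sup>2\<close> when \<open>f\<close> is a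
  normalised combination of the Hermite polynomials of degree at most \<open>t\<close>.
\<close>

definition linearization_norm :: "nat \<Rightarrow> real" where
  "linearization_norm t = (\<Sum>m\<le>2 * t. \<Sum>k\<le>t. \<Sum>l\<le>t. (hermite_linearization k l m)\<^sup>2)"

lemma linearization_norm_ge_1: "linearization_norm t \<ge> 1"
proof -
  have "1 = (\<Sum>m\<in>{0}. \<Sum>k\<in>{0}. \<Sum>l\<in>{0::nat}. (hermite_linearization k l m)\<^sup>2)"
    by (simp add: hermite_linearization_0)
  also have "\<dots> \<le> (\<Sum>m\<in>{0}. \<Sum>k\<in>{0}. \<Sum>l\<le>t. (hermite_linearization k l m)\<^sup>2)"
    by (intro sum_mono sum_mono2) auto
  also have "\<dots> \<le> (\<Sum>m\<in>{0}. \<Sum>k\<le>t. \<Sum>l\<le>t. (hermite_linearization k l m)\<^sup>2)"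
    by (intro sum_mono sum_mono2) (auto intro!: sum_nonneg)
  also have "\<dots> \<le> linearization_norm t"
    unfolding linearization_norm_def by (intro sum_mono2) (auto intro!: sum_nonneg)
  finally show ?thesis .
qed

lemma linearization_norm_le: "linearization_norm t \<le> (3 * real t + 3) ^ (2 * t + 3)"
proof -
  let ?B = "3 * real t + 3"
  have summand: "(hermite_linearization k l m)\<^sup>2 \<le> ?B ^ (2 * t)" if "k \<le> t" "l \<le> t" "m \<le> 2 * t" for k l m
  proof -
    have "hermite_linearization k l m \<le> real (l + m) ^ k"
      unfolding hermite_linearization_def using gauss_mean_triple_bounds by blast
    also have "\<dots> \<le> ?B ^ k" using that by (intro power_mono) auto
    also have "\<dots> \<le> ?B ^ t" using that by (intro power_increasing) auto
    finally have "(hermite_linearization k l m)\<^sup>2 \<le> (?B ^ t)\<^sup>2"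
      using gauss_mean_triple_bounds[of k l m] by (intro power_mono) (auto simp: hermite_linearization_def)
    then show ?thesis by (simp add: power_mult[symmetric] mult.commute)
  qed
  have "linearization_norm t \<le> (\<Sum>m\<le>2 * t. \<Sum>k\<le>t. \<Sum>l\<le>t. ?B ^ (2 * t))"
    unfolding linearization_norm_def by (intro sum_mono summand) auto
  also have "\<dots> = (2 * real t + 1) * ((real t + 1) * ((real t + 1) * ?B ^ (2 * t)))"
    by (simp add: algebra_simps)
  also have "\<dots> \<le> ?B * (?B * (?B * ?B ^ (2 * t)))"
    by (intro mult_mono) auto
  also have "\<dots> = ?B ^ (2 * t + 3)" by (simp add: power_add eval_nat_numeral)
  finally show ?thesis .
qed

section \<open>Worst-case errors\<close>

definition zero_index :: "nat \<Rightarrow> nat \<Rightarrow> nat" where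
  "zero_index s = (\<lambda>j\<in>{1..s}. 0)"

lemma zero_index_mem: "zero_index s \<in> multi_indices s"
  unfolding zero_index_def multi_indices_def by (simp add: restrict_PiE_iff)

lemma gauss_integral_eq_coeff: "gauss_integral s f = hermite_coeff s f (zero_index s)"
  unfolding hermite_coeff_def by (simp add: hermite_def zero_index_def hermite1_0)

context hermite_weights
begin

interpretation rkhs "points s" K series_space ip by (rule series_space_rkhs)

text \<open>
  The error of the rule on \<open>H\<^sub>k\<close>; up to the weights, these are the coefficients of the function representing the
  error functional.
\<close>

definition representer_coeff :: "nat \<Rightarrow> (nat \<Rightarrow> real) \<Rightarrow> (nat \<Rightarrow> nat \<Rightarrow> real) \<Rightarrow> (nat \<Rightarrow> nat) \<Rightarrow> real" where
  "representer_coeff n \<alpha> x k = (if k = zero_index s then 1 else 0) - (\<Sum>i=1..n. \<alpha> i * hermite s k (x i))"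

lemma representer_coeff_summable:
  assumes "\<And>i. i \<in> {1..n} \<Longrightarrow> x i \<in> points s"
  shows "(\<lambda>k. weight k * (representer_coeff n \<alpha> x k)\<^sup>2) summable_on multi_indices s"
proof -
  have sum: "(\<lambda>k. \<Sum>i=1..n. \<alpha> i * (weight k * hermite s k (x i))) \<in> coeff_space"
    using assms
  proof (induction n)
    case 0
    then show ?case by (simp add: coeff_space_def)
  next
    case (Suc n)
    have "(\<lambda>k. (\<Sum>i=1..n. \<alpha> i * (weight k * hermite s k (x i))) + \<alpha> (Suc n) * (weight k * hermite s k (x
        (Suc n)))) \<in> coeff_space"
      using Suc by (intro coeff_space_add coeff_space_scale kernel_section_eq_series(1)) auto
    then show ?case by simp
  qed
  have one: "(\<lambda>k. if k = zero_index s then weight k else 0) \<in> coeff_space"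
    by (rule coeff_space_finite_support) (rule finite_subset[of _ "{zero_index s}"], auto)
  have "(\<lambda>k. weight k * representer_coeff n \<alpha> x k) \<in> coeff_space"
  proof -
    have "(\<lambda>k. weight k * representer_coeff n \<alpha> x k) =
        (\<lambda>k. (if k = zero_index s then weight k else 0) - (\<Sum>i=1..n. \<alpha> i * (weight k * hermite s k (x i))))"
      by (auto simp: representer_coeff_def right_diff_distrib sum_distrib_left mult_ac)
    then show ?thesis using coeff_space_diff[OF one sum] by simp
  qed
  moreover have "(weight k * representer_coeff n \<alpha> x k)\<^sup>2 / weight k =
      weight k * (representer_coeff n \<alpha> x k)\<^sup>2" for k
    using weight_pos[of k] by (simp add: power2_eq_square)
  ultimately show ?thesis unfolding coeff_space_def by simp
qed

lemma integration_error_le: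
  assumes nodes: "\<And>i. i \<in> {1..n} \<Longrightarrow> x i \<in> points s" and f: "f \<in> series_space"
  shows "\<bar>gauss_integral s f - linear_algorithm n \<alpha> x f\<bar> \<le>
    hermite_norm \<omega> a b s f * sqrt (\<Sum>\<^sub>\<infinity>k\<in>multi_indices s. weight k * (representer_coeff n \<alpha> x k)\<^sup>2)"
proof -
  define c where "c = hermite_coeff s f"
  have c: "c \<in> coeff_space" and fc: "f = hermite_series c" unfolding c_def using series_spaceE[OF f] by auto
  have I: "((\<lambda>k. c k * (if k = zero_index s then 1 else 0)) has_sum gauss_integral s f) (multi_indices s)"
  proof -
    have "((\<lambda>k. c k) has_sum c (zero_index s)) {zero_index s}" by (simp add: has_sum_finite_iff)
    then have "((\<lambda>k. c k * (if k = zero_index s then 1 else 0)) has_sum c (zero_index s)) (multi_indices s)"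
      by (rule has_sum_cong_neutral[THEN iffD1, rotated -1]) (use zero_index_mem in auto)
    then show ?thesis by (simp add: gauss_integral_eq_coeff c_def)
  qed
  have A: "((\<lambda>k. \<Sum>i=1..n. \<alpha> i * (c k * hermite s k (x i))) has_sum linear_algorithm n \<alpha> x f) (multi_indices s)"
    using nodes
  proof (induction n)
    case 0
    then show ?case by (simp add: linear_algorithm_def)
  next
    case (Suc n)
    have "((\<lambda>k. c k * hermite s k (x (Suc n))) has_sum f (x (Suc n))) (multi_indices s)"
      using coeff_space_hermite_summable[OF c] Suc.prems[of "Suc n"] unfolding fc hermite_series_def by simp
    from has_sum_add[OF Suc.IH has_sum_cmult_right[OF this, of "\<alpha> (Suc n)"]] Suc.prems
    show ?case by (simp add: linear_algorithm_def)
  qed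
  have "((\<lambda>k. c k * representer_coeff n \<alpha> x k) has_sum (gauss_integral s f - linear_algorithm n \<alpha> x f))
      (multi_indices s)"
  proof -
    have "((\<lambda>k. c k * (if k = zero_index s then 1 else 0) + - (\<Sum>i=1..n. \<alpha> i * (c k * hermite s k (x
        i)))) has_sum
        (gauss_integral s f + - linear_algorithm n \<alpha> x f)) (multi_indices s)"
      by (intro has_sum_add I has_sum_uminusI A)
    then show ?thesis
      by (simp add: representer_coeff_def right_diff_distrib sum_distrib_left mult_ac)
  qed
  then have "gauss_integral s f - linear_algorithm n \<alpha> x f =
      (\<Sum>\<^sub>\<infinity>k\<in>multi_indices s. c k * representer_coeff n \<alpha> x k)"
    by (simp add: has_sum_iff)
  then show ?thesis
    using coeff_space_mult_summable(3)[OF c representer_coeff_summable, of n x \<alpha>] nodes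
    by (simp add: hermite_norm_def ip_self_eq c_def)
qed

text \<open>
  The first statement is what makes the supremum in the definition of the worst-case error meaningful.
\<close>

lemma worst_case_error_bdd_above:
  assumes nodes: "\<And>i. i \<in> {1..n} \<Longrightarrow> x i \<in> points s"
  shows "bdd_above ((\<lambda>f. \<bar>gauss_integral s f - linear_algorithm n \<alpha> x f\<bar>) `
      {f \<in> hermite_space \<omega> a b s. hermite_norm \<omega> a b s f \<le> 1})"
    and "worst_case_error \<omega> a b s (linear_algorithm n \<alpha> x) \<le>
      sqrt (\<Sum>\<^sub>\<infinity>k\<in>multi_indices s. weight k * (representer_coeff n \<alpha> x k)\<^sup>2)"
proof -
  let ?R = "sqrt (\<Sum>\<^sub>\<infinity>k\<in>multi_indices s. weight k * (representer_coeff n \<alpha> x k)\<^sup>2)"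
  have R: "?R \<ge> 0" using weight_pos by (auto intro!: infsum_nonneg mult_nonneg_nonneg simp: less_imp_le)
  have le: "\<bar>gauss_integral s f - linear_algorithm n \<alpha> x f\<bar> \<le> ?R"
    if "f \<in> {f \<in> hermite_space \<omega> a b s. hermite_norm \<omega> a b s f \<le> 1}" for f
  proof -
    have "\<bar>gauss_integral s f - linear_algorithm n \<alpha> x f\<bar> \<le> hermite_norm \<omega> a b s f * ?R"
      using that by (intro integration_error_le nodes) (auto simp: hermite_space_eq)
    also have "\<dots> \<le> 1 * ?R" using that R by (intro mult_right_mono) auto
    finally show ?thesis by simp
  qed
  then show "bdd_above ((\<lambda>f. \<bar>gauss_integral s f - linear_algorithm n \<alpha> x f\<bar>) `
      {f \<in> hermite_space \<omega> a b s. hermite_norm \<omega> a b s f \<le> 1})"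
    by (intro bdd_aboveI2)
  have "(\<lambda>x. 0) \<in> {f \<in> hermite_space \<omega> a b s. hermite_norm \<omega> a b s f \<le> 1}"
    using zero_mem ip_zero[OF zero_mem] by (simp add: hermite_space_eq hermite_norm_def)
  then show "worst_case_error \<omega> a b s (linear_algorithm n \<alpha> x) \<le> ?R"
    unfolding worst_case_error_def using le by (intro cSUP_least) auto
qed

text \<open>
  Rescaling \<open>g\<close> to norm 1 gives a member of the unit ball.
\<close>

lemma worst_case_error_ge:
  assumes nodes: "\<And>i. i \<in> {1..n} \<Longrightarrow> x i \<in> points s"
    and g: "g \<in> series_space" "g \<noteq> (\<lambda>x. 0)"
  shows "\<bar>gauss_integral s g - linear_algorithm n \<alpha> x g\<bar> / hermite_norm \<omega> a b s g \<le>
      worst_case_error \<omega> a b s (linear_algorithm n \<alpha> x)"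
proof -
  let ?N = "hermite_norm \<omega> a b s g"
  have N: "?N > 0" using ip_pos[OF g] by (simp add: hermite_norm_def)
  let ?f = "\<lambda>x. (1 / ?N) * g x"
  have f: "?f \<in> series_space" by (rule scale_mem[OF g(1)])
  have "ip ?f ?f = (1 / ?N) * ((1 / ?N) * ip g g)"
    using ip_scale[OF g(1) f, of "1 / ?N"] ip_sym[OF g(1) f] ip_scale[OF g(1) g(1), of "1 / ?N"] by simp
  also have "ip g g = ?N * ?N" unfolding hermite_norm_def using ip_pos[OF g] by simp
  finally have "hermite_norm \<omega> a b s ?f = 1" using N by (simp add: hermite_norm_def)
  then have mem: "?f \<in> {f \<in> hermite_space \<omega> a b s. hermite_norm \<omega> a b s f \<le> 1}"
    using f by (simp add: hermite_space_eq)
  have "gauss_integral s ?f - linear_algorithm n \<alpha> x ?f =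
      (1 / ?N) * (gauss_integral s g - linear_algorithm n \<alpha> x g)"
    unfolding gauss_integral_eq_coeff hermite_coeff_scale linear_algorithm_def right_diff_distrib
        sum_distrib_left
    by (simp add: mult_ac)
  then have "\<bar>gauss_integral s g - linear_algorithm n \<alpha> x g\<bar> / ?N =
      \<bar>gauss_integral s ?f - linear_algorithm n \<alpha> x ?f\<bar>"
    using N by (simp add: abs_mult)
  also have "\<dots> \<le> worst_case_error \<omega> a b s (linear_algorithm n \<alpha> x)"
    unfolding worst_case_error_def by (rule cSUP_upper[OF mem worst_case_error_bdd_above(1)[OF nodes]])
  finally show ?thesis .
qed

lemma worst_case_error_nonneg:
  assumes nodes: "\<And>i. i \<in> {1..n} \<Longrightarrow> x i \<in> points s"
  shows "0 \<le> worst_case_error \<omega> a b s (linear_algorithm n \<alpha> x)"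
proof -
  have mem: "(\<lambda>x. 0) \<in> {f \<in> hermite_space \<omega> a b s. hermite_norm \<omega> a b s f \<le> 1}"
    using zero_mem ip_zero[OF zero_mem] by (simp add: hermite_space_eq hermite_norm_def)
  have "0 \<le> \<bar>gauss_integral s (\<lambda>x. 0) - linear_algorithm n \<alpha> x (\<lambda>x. 0)\<bar>" by simp
  also have "\<dots> \<le> worst_case_error \<omega> a b s (linear_algorithm n \<alpha> x)"
    unfolding worst_case_error_def by (rule cSUP_upper[OF mem worst_case_error_bdd_above(1)[OF nodes]])
  finally show ?thesis .
qed

abbreviation "error_set n \<equiv>
  {worst_case_error \<omega> a b s (linear_algorithm n \<alpha> x) | \<alpha> x. \<forall>i\<in>{1..n}. x i \<in> points s}"

lemma point_exists: "(\<lambda>j\<in>{1..s}. 0) \<in> points s"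
  by (simp add: points_def restrict_PiE_iff)

lemma error_set_nonempty: "error_set n \<noteq> {}"
proof -
  have "worst_case_error \<omega> a b s (linear_algorithm n (\<lambda>_. 0) (\<lambda>_. \<lambda>j\<in>{1..s}. 0)) \<in> error_set n"
    by (rule CollectI, rule exI[of _ "\<lambda>_. 0"], rule exI[of _ "\<lambda>_. \<lambda>j\<in>{1..s}. 0"]) (use point_exists in auto)
  then show ?thesis by (metis empty_iff)
qed

lemma error_set_bdd_below: "bdd_below (error_set n)"
  by (intro bdd_belowI[of _ 0]) (auto intro!: worst_case_error_nonneg)

lemma min_error_le:
  assumes "\<And>i. i \<in> {1..n} \<Longrightarrow> x i \<in> points s"
  shows "min_error \<omega> a b n s \<le> worst_case_error \<omega> a b s (linear_algorithm n \<alpha> x)"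
  unfolding min_error_def by (rule cInf_lower[OF _ error_set_bdd_below]) (use assms in blast)

lemma min_error_nonneg: "0 \<le> min_error \<omega> a b n s"
  unfolding min_error_def
  by (rule cInf_greatest[OF error_set_nonempty]) (auto intro!: worst_case_error_nonneg)

text \<open>
  Additional nodes may be given weight 0.
\<close>

lemma min_error_antimono:
  assumes "m \<le> n"
  shows "min_error \<omega> a b n s \<le> min_error \<omega> a b m s"
  unfolding min_error_def
proof (rule cInf_superset_mono[OF error_set_nonempty error_set_bdd_below])
  show "error_set m \<subseteq> error_set n"
  proof
    fix e assume "e \<in> error_set m"
    then obtain \<alpha> x where e: "e = worst_case_error \<omega> a b s (linear_algorithm m \<alpha> x)"
      and x: "\<forall>i\<in>{1..m}. x i \<in> points s" by blast
    let ?\<alpha> = "\<lambda>i. if i \<le> m then \<alpha> i else 0" and ?x = "\<lambda>i. if i \<le> m then x i else (\<lambda>j\<in>{1..s}. 0)"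
    have "linear_algorithm n ?\<alpha> ?x f = linear_algorithm m \<alpha> x f" for f
      unfolding linear_algorithm_def using assms by (intro sum.mono_neutral_cong_right) auto
    then have same: "linear_algorithm n ?\<alpha> ?x = linear_algorithm m \<alpha> x" by (rule ext)
    have nodes: "\<forall>i\<in>{1..n}. ?x i \<in> points s" using x point_exists by auto
    have "worst_case_error \<omega> a b s (linear_algorithm n ?\<alpha> ?x) \<in> error_set n"
      using nodes by blast
    then show "e \<in> error_set n" unfolding e same .
  qed
qed

subsection \<open>Upper bound: products of Gauss-Hermite rules\<close>

text \<open>
  For \<open>n \<ge> 2 * m\<close> one half of the exponent \<open>a j * n powr b j\<close> is bounded below by its value at
  \<open>n = 2 * m\<close>, the other half by \<open>n / 2\<close>.
\<close>

lemma one_dimensional_error_series_le: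
  assumes j: "j \<in> {1..s}" and m: "m \<ge> 1" and exact: "\<And>n. n < 2 * m \<Longrightarrow> Q n = (if n = 0 then 1 else 0)"
    and sm: "summable (\<lambda>n. sqrt \<omega> ^ n * (Q n)\<^sup>2)"
    and le: "(\<Sum>n. sqrt \<omega> ^ n * (Q n)\<^sup>2) \<le> M"
  shows "summable (\<lambda>n. weight1 j n * (Q n)\<^sup>2)"
    and "(\<Sum>n. weight1 j n * (Q n)\<^sup>2) \<le> 1 + M * \<omega> powr (a j * (2 * real m) powr b j / 2)"
proof -
  let ?E = "\<omega> powr (a j * (2 * real m) powr b j / 2)"
  have summand: "weight1 j n * (Q n)\<^sup>2 \<le> (if n = 0 then 1 else 0) + ?E * (sqrt \<omega> ^ n * (Q n)\<^sup>2)" for n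
  proof (cases "n < 2 * m")
    case True
    then show ?thesis using exact[OF True] omega by simp
  next
    case False
    let ?e = "a j * real n powr b j"
    have "a j * (2 * real m) powr b j \<le> ?e"
      using False a_ge_1[OF j] b_ge_1[OF j] by (intro mult_left_mono powr_mono2) auto
    then have 1: "\<omega> powr (?e / 2) \<le> ?E" using omega by (intro powr_mono') auto
    have "\<omega> powr (?e / 2) \<le> \<omega> powr (real n / 2)"
      using weight_exponent1_ge[OF j, of n] omega by (intro powr_mono') auto
    also have "\<dots> = sqrt \<omega> ^ n"
      using omega by (simp add: powr_half_sqrt[symmetric] powr_realpow[symmetric] powr_powr)
    finally have 2: "\<omega> powr (?e / 2) \<le> sqrt \<omega> ^ n" .
    have "weight1 j n = \<omega> powr (?e / 2) * \<omega> powr (?e / 2)"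
      unfolding weight1_def by (simp add: powr_add[symmetric])
    also have "\<dots> \<le> ?E * sqrt \<omega> ^ n" using 1 2 by (intro mult_mono) auto
    finally have "weight1 j n * (Q n)\<^sup>2 \<le> ?E * sqrt \<omega> ^ n * (Q n)\<^sup>2" by (intro mult_right_mono) auto
    moreover have "n \<noteq> 0" using False m by auto
    ultimately show ?thesis by (simp add: mult.assoc)
  qed
  have sums: "(\<lambda>n. (if n = 0 then 1 else 0) + ?E * (sqrt \<omega> ^ n * (Q n)\<^sup>2)) sums
      (1 + ?E * (\<Sum>n. sqrt \<omega> ^ n * (Q n)\<^sup>2))"
    by (intro sums_add sums_mult summable_sums sm) (use sums_single[of 0 "\<lambda>_. 1::real"] in simp)
  show 1: "summable (\<lambda>n. weight1 j n * (Q n)\<^sup>2)"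
    by (rule summable_comparison_test'[OF sums_summable[OF sums], of 0])
      (use summand weight1_pos in \<open>auto simp: abs_mult less_imp_le\<close>)
  have "(\<Sum>n. weight1 j n * (Q n)\<^sup>2) \<le> 1 + ?E * (\<Sum>n. sqrt \<omega> ^ n * (Q n)\<^sup>2)"
    unfolding sums_unique[OF sums] by (rule suminf_le[OF summand 1 sums_summable[OF sums]])
  also have "\<dots> \<le> 1 + ?E * M" using le by (intro add_left_mono mult_left_mono) auto
  finally show "(\<Sum>n. weight1 j n * (Q n)\<^sup>2) \<le> 1 + M * ?E" by (simp add: mult.commute)
qed

text \<open>
  The grid of the one-dimensional nodes carries the product rule, whose value on \<open>H\<^sub>k\<close> is the product of the
  one-dimensional values. Hence the squared error series factorises, apart from the term \<open>k = 0\<close>, which is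
  subtracted because constants are integrated exactly.
\<close>

theorem min_error_upper:
  assumes m: "\<And>j. j \<in> {1..s} \<Longrightarrow> m j \<ge> 1" and n: "(\<Prod>j=1..s. m j) \<le> n"
  shows "(min_error \<omega> a b n s)\<^sup>2 \<le>
    (\<Prod>j=1..s. 1 + error_constant (sqrt \<omega>) * \<omega> powr (a j * (2 * real (m j)) powr b j / 2)) - 1"
proof -
  have th: "0 < sqrt \<omega>" "sqrt \<omega> < 1" using omega by auto
  define P where "P j p \<longleftrightarrow> finite (fst p) \<and> card (fst p) = m j \<and>
     (\<forall>k<2 * m j. (\<Sum>x\<in>fst p. snd p x * hermite1 k x) = (if k = 0 then 1 else 0)) \<and>
     summable (\<lambda>k. sqrt \<omega> ^ k * (\<Sum>x\<in>fst p. snd p x * hermite1 k x)\<^sup>2) \<and>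
     (\<Sum>k. sqrt \<omega> ^ k * (\<Sum>x\<in>fst p. snd p x * hermite1 k x)\<^sup>2) \<le> error_constant (sqrt \<omega>)"
    for j and p :: "real set \<times> (real \<Rightarrow> real)"
  have "\<forall>j\<in>{1..s}. \<exists>p. P j p"
    unfolding P_def split_paired_Ex fst_conv snd_conv using gauss_hermite_error_series[OF th m] by blast
  then obtain F where "\<forall>j\<in>{1..s}. P j (F j)" by (rule bchoice[THEN exE])
  then have F: "\<And>j. j \<in> {1..s} \<Longrightarrow> P j (F j)" by blast
  define X where "X j = fst (F j)" for j
  define w where "w j = snd (F j)" for j
  have X: "finite (X j)" "card (X j) = m j"
    and exact: "\<And>k. k < 2 * m j \<Longrightarrow> (\<Sum>x\<in>X j. w j x * hermite1 k x) = (if k = 0 then 1 else 0)"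
    and sm: "summable (\<lambda>k. sqrt \<omega> ^ k * (\<Sum>x\<in>X j. w j x * hermite1 k x)\<^sup>2)"
    and le: "(\<Sum>k. sqrt \<omega> ^ k * (\<Sum>x\<in>X j. w j x * hermite1 k x)\<^sup>2) \<le> error_constant (sqrt \<omega>)"
    if "j \<in> {1..s}" for j
    using F[OF that] unfolding P_def X_def w_def by blast+
  define Q where "Q j k = (\<Sum>x\<in>X j. w j x * hermite1 k x)" for j k
  define G where "G = (\<Pi>\<^sub>E j\<in>{1..s}. X j)"
  have Gfin: "finite G" unfolding G_def using X by (intro finite_PiE) auto
  have Gcard: "card G = (\<Prod>j=1..s. m j)" unfolding G_def using X by (subst card_PiE) auto
  obtain h where h: "bij_betw h {1..card G} G" using ex_bij_betw_nat_finite_1[OF Gfin] by blast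
  define \<alpha> where "\<alpha> i = (\<Prod>j=1..s. w j (h i j))" for i
  have nodes: "h i \<in> points s" if "i \<in> {1..card G}" for i
    using bij_betwE[OF h] that unfolding G_def points_def by (auto simp: PiE_iff)
  have rule: "(\<Sum>i=1..card G. \<alpha> i * hermite s k (h i)) = (\<Prod>j=1..s. Q j (k j))" for k
  proof -
    have "(\<Sum>i=1..card G. \<alpha> i * hermite s k (h i)) = (\<Sum>x\<in>G. \<Prod>j=1..s. w j (x j) * hermite1 (k j) (x j))"
      unfolding \<alpha>_def hermite_def prod.distrib[symmetric] using h by (rule sum.reindex_bij_betw)
    also have "\<dots> = (\<Prod>j=1..s. Q j (k j))"
      unfolding G_def Q_def using X by (intro prod_sum_PiE[symmetric]) auto
    finally show ?thesis .
  qed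
  have Q0: "Q j 0 = 1" if "j \<in> {1..s}" for j
    unfolding Q_def using exact[OF that, of 0] m[OF that] by simp
  let ?f = "\<lambda>j n. weight1 j n * (Q j n)\<^sup>2"
  have f: "summable (?f j)"
     "(\<Sum>n. ?f j n) \<le> 1 + error_constant (sqrt \<omega>) * \<omega> powr (a j * (2 * real (m j)) powr b j / 2)"
    if j: "j \<in> {1..s}" for j
    using one_dimensional_error_series_le[OF j m[OF j], of "Q j"] exact[OF j] sm[OF j] le[OF j]
    unfolding Q_def by auto
  have nn: "?f j n \<ge> 0" for j n using weight1_pos[of j n] by simp
  have prods: "(\<lambda>k. \<Prod>j\<in>{1..s}. ?f j (k j)) summable_on multi_indices s"
    "(\<Sum>\<^sub>\<infinity>k\<in>multi_indices s. \<Prod>j\<in>{1..s}. ?f j (k j)) = (\<Prod>j=1..s. \<Sum>n. ?f j n)"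
    unfolding multi_indices_def using f nn by (intro summable_on_prod_PiE; simp)+
  have rep: "weight k * (representer_coeff (card G) \<alpha> h k)\<^sup>2 =
      (\<Prod>j=1..s. ?f j (k j)) - (if k = zero_index s then 1 else 0)" if k: "k \<in> multi_indices s" for k
  proof -
    have p: "(\<Prod>j=1..s. ?f j (k j)) = weight k * (\<Prod>j=1..s. Q j (k j))\<^sup>2"
      by (simp add: weight_eq_prod prod.distrib prod_power_distrib)
    show ?thesis
    proof (cases "k = zero_index s")
      case True
      then have "(\<Prod>j=1..s. Q j (k j)) = 1" "weight k = 1"
        by (auto simp: weight_eq_prod zero_index_def Q0)
      then show ?thesis unfolding p representer_coeff_def rule using True by simp
    next
      case False
      then show ?thesis unfolding p representer_coeff_def rule by simp
    qed
  qed
  have S_eq: "(\<Sum>\<^sub>\<infinity>k\<in>multi_indices s. weight k * (representer_coeff (card G) \<alpha> h k)\<^sup>2) =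
      (\<Prod>j=1..s. \<Sum>n. ?f j n) - 1"
  proof -
    have "((\<lambda>k. \<Prod>j=1..s. ?f j (k j)) has_sum (\<Prod>j=1..s. \<Sum>n. ?f j n)) (multi_indices s)"
      using prods by (simp add: has_sum_iff)
    moreover have "((\<lambda>k. - (if k = zero_index s then 1 else 0 :: real)) has_sum - 1) (multi_indices s)"
    proof (rule has_sum_uminusI)
      have "((\<lambda>k. 1 :: real) has_sum 1) {zero_index s}" by (simp add: has_sum_finite_iff)
      then show "((\<lambda>k. if k = zero_index s then 1 else 0 :: real) has_sum 1) (multi_indices s)"
        by (rule has_sum_cong_neutral[THEN iffD1, rotated -1]) (use zero_index_mem in auto)
    qed
    ultimately have "((\<lambda>k. (\<Prod>j=1..s. ?f j (k j)) + - (if k = zero_index s then 1 else 0)) has_sum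
        ((\<Prod>j=1..s. \<Sum>n. ?f j n) + - 1)) (multi_indices s)" by (rule has_sum_add)
    then have "((\<lambda>k. weight k * (representer_coeff (card G) \<alpha> h k)\<^sup>2) has_sum
        ((\<Prod>j=1..s. \<Sum>n. ?f j n) + - 1)) (multi_indices s)"
      by (subst has_sum_cong[OF rep]) simp_all
    then show ?thesis by (simp add: has_sum_iff)
  qed
  have prod_le: "(\<Prod>j=1..s. \<Sum>n. ?f j n) \<le>
      (\<Prod>j=1..s. 1 + error_constant (sqrt \<omega>) * \<omega> powr (a j * (2 * real (m j)) powr b j / 2))"
    using f nn by (intro prod_mono) (auto intro!: suminf_nonneg)
  have "min_error \<omega> a b n s \<le>
      sqrt (\<Sum>\<^sub>\<infinity>k\<in>multi_indices s. weight k * (representer_coeff (card G) \<alpha> h k)\<^sup>2)"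
  proof -
    have "min_error \<omega> a b n s \<le> min_error \<omega> a b (card G) s"
      using n Gcard by (intro min_error_antimono) simp
    also have "\<dots> \<le> worst_case_error \<omega> a b s (linear_algorithm (card G) \<alpha> h)"
      by (rule min_error_le[OF nodes])
    also note worst_case_error_bdd_above(2)[OF nodes]
    finally show ?thesis .
  qed
  moreover have S_nn: "0 \<le> (\<Sum>\<^sub>\<infinity>k\<in>multi_indices s. weight k * (representer_coeff (card G) \<alpha> h k)\<^sup>2)"
    using weight_pos by (intro infsum_nonneg mult_nonneg_nonneg) (auto simp: less_imp_le)
  ultimately have "(min_error \<omega> a b n s)\<^sup>2 \<le>
      (sqrt (\<Sum>\<^sub>\<infinity>k\<in>multi_indices s. weight k * (representer_coeff (card G) \<alpha> h k)\<^sup>2))\<^sup>2"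
    using min_error_nonneg by (intro power_mono)
  also have "\<dots> = (\<Prod>j=1..s. \<Sum>n. ?f j n) - 1"
    using S_nn S_eq by simp
  finally show ?thesis using prod_le by linarith
qed

subsection \<open>Lower bound: squares of polynomials vanishing at the nodes\<close>

text \<open>
  For \<open>f = \<Sum>k. d\<^sub>k H\<^sub>k\<close> with \<open>\<Sum>k. d\<^sub>k\<^sup>2 = 1\<close> and \<open>f = 0\<close> at the nodes, the function \<open>g = f\<^sup>2\<close> has integral 1. By
  Cauchy-Schwarz its coefficients satisfy \<open>\<gamma>\<^sub>m\<^sup>2 \<le> \<Sum>k l. C(k,l,m)\<^sup>2\<close> with the coefficients \<open>C\<close> of \<open>H\<^sub>k H\<^sub>l\<close>,
  and both these sums and the weights are products over the coordinates.
\<close>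

theorem min_error_lower:
  assumes n: "n < (\<Prod>j=1..s. t j + 1)"
  shows "sqrt (\<Prod>j=1..s. weight1 j (2 * t j) / linearization_norm (t j)) \<le> min_error \<omega> a b n s"
  unfolding min_error_def
proof (rule cInf_greatest[OF error_set_nonempty])
  fix e assume "e \<in> error_set n"
  then obtain \<alpha> x where e: "e = worst_case_error \<omega> a b s (linear_algorithm n \<alpha> x)"
    and nodes: "\<And>i. i \<in> {1..n} \<Longrightarrow> x i \<in> points s" by blast
  define \<Lambda> where "\<Lambda> = (\<Pi>\<^sub>E j\<in>{1..s}. {..t j})"
  define \<Gamma> where "\<Gamma> = (\<Pi>\<^sub>E j\<in>{1..s}. {..2 * t j})"
  have fin: "finite \<Lambda>" "finite \<Gamma>" unfolding \<Lambda>_def \<Gamma>_def by (auto intro: finite_PiE)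
  have sub: "\<Lambda> \<subseteq> multi_indices s" "\<Gamma> \<subseteq> multi_indices s"
    unfolding \<Lambda>_def \<Gamma>_def multi_indices_def by (auto intro: PiE_mono[THEN subsetD])
  have "card \<Lambda> = (\<Prod>j=1..s. t j + 1)" unfolding \<Lambda>_def by (subst card_PiE) auto
  then have "n < card \<Lambda>" using n by simp
  then obtain d0 where d0: "\<exists>k\<in>\<Lambda>. d0 k \<noteq> 0"
      "\<And>i. i \<in> {1..n} \<Longrightarrow> (\<Sum>k\<in>\<Lambda>. d0 k * hermite s k (x i)) = 0"
    using underdetermined_system_solution[OF fin(1), of n "\<lambda>i k. hermite s k (x i)"] by blast
  define r where "r = (\<Sum>k\<in>\<Lambda>. (d0 k)\<^sup>2)"
  have r: "r > 0" unfolding r_def using d0(1) fin by (auto intro!: sum_pos2)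
  define d where "d k = d0 k / sqrt r" for k
  have d1: "(\<Sum>k\<in>\<Lambda>. (d k)\<^sup>2) = 1"
    using r by (simp add: d_def power_divide sum_divide_distrib[symmetric] r_def[symmetric])
  define f where "f y = (\<Sum>k\<in>\<Lambda>. d k * hermite s k y)" for y
  have f0: "f (x i) = 0" if "i \<in> {1..n}" for i
    using d0(2)[OF that] by (simp add: f_def d_def sum_divide_distrib[symmetric])
  define C where "C k l m = (\<Prod>j=1..s. hermite_linearization (k j) (l j) (m j))" for k l m
  have prod_exp: "hermite s k y * hermite s l y = (\<Sum>m\<in>\<Gamma>. C k l m * hermite s m y)"
    if "k \<in> \<Lambda>" "l \<in> \<Lambda>" for k l y
  proof -
    have "hermite s k y * hermite s l y = (\<Prod>j=1..s. \<Sum>m\<le>2 * t j. hermite_linearization (k j) (l j) m *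
        hermite1 m (y j))"
      unfolding hermite_def prod.distrib[symmetric]
      by (intro prod.cong refl hermite1_product_expansion) (use that in \<open>auto simp: \<Lambda>_def PiE_iff\<close>)
    also have "\<dots> = (\<Sum>m\<in>\<Gamma>. \<Prod>j=1..s. hermite_linearization (k j) (l j) (m j) * hermite1 (m j) (y j))"
      unfolding \<Gamma>_def by (intro prod_sum_PiE) auto
    finally show ?thesis by (simp add: C_def hermite_def prod.distrib)
  qed
  define \<gamma> where "\<gamma> m = (if m \<in> \<Gamma> then \<Sum>k\<in>\<Lambda>. \<Sum>l\<in>\<Lambda>. (d k * d l) * C k l m else 0)" for m
  have \<gamma>: "\<gamma> \<in> coeff_space"
    by (rule coeff_space_finite_support) (rule finite_subset[OF _ fin(2)], auto simp: \<gamma>_def)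
  define g where "g = hermite_series \<gamma>"
  have g_mem: "g \<in> series_space" unfolding g_def series_space_def using \<gamma> by blast
  have g_eq: "g y = (f y)\<^sup>2" if y: "y \<in> points s" for y
  proof -
    have "g y = (\<Sum>\<^sub>\<infinity>m\<in>multi_indices s. \<gamma> m * hermite s m y)" using y by (simp add: g_def hermite_series_def)
    also have "\<dots> = (\<Sum>\<^sub>\<infinity>m\<in>\<Gamma>. \<gamma> m * hermite s m y)"
      by (rule infsum_cong_neutral) (use sub in \<open>auto simp: \<gamma>_def\<close>)
    also have "\<dots> = (\<Sum>m\<in>\<Gamma>. \<gamma> m * hermite s m y)" using fin by simp
    also have "\<dots> = (\<Sum>m\<in>\<Gamma>. \<Sum>k\<in>\<Lambda>. \<Sum>l\<in>\<Lambda>. (d k * d l) * (C k l m * hermite s m y))"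
      by (intro sum.cong) (auto simp: \<gamma>_def sum_distrib_right mult.assoc)
    also have "\<dots> = (\<Sum>k\<in>\<Lambda>. \<Sum>l\<in>\<Lambda>. \<Sum>m\<in>\<Gamma>. (d k * d l) * (C k l m * hermite s m y))"
      by (subst sum.swap, rule sum.cong[OF refl], rule sum.swap)
    also have "\<dots> = (\<Sum>k\<in>\<Lambda>. \<Sum>l\<in>\<Lambda>. (d k * d l) * (hermite s k y * hermite s l y))"
      by (intro sum.cong refl) (simp add: prod_exp sum_distrib_left)
    also have "\<dots> = (f y)\<^sup>2"
      unfolding f_def power2_eq_square sum_product by (simp add: mult_ac)
    finally show ?thesis .
  qed
  have zero_mem: "zero_index s \<in> \<Gamma>" unfolding \<Gamma>_def zero_index_def by (simp add: restrict_PiE_iff)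
  have C0: "C k l (zero_index s) = (if k = l then 1 else 0)" if kl: "k \<in> \<Lambda>" "l \<in> \<Lambda>" for k l
  proof (cases "k = l")
    case False
    then obtain j where "j \<in> {1..s}" "k j \<noteq> l j"
      using multi_indices_eqI[of k s l] kl sub by blast
    then show ?thesis using False
      by (auto simp: C_def zero_index_def hermite_linearization_0 intro!: prod_zero)
  qed (simp add: C_def zero_index_def hermite_linearization_0)
  have I: "gauss_integral s g = 1"
  proof -
    have "gauss_integral s g = \<gamma> (zero_index s)"
      unfolding gauss_integral_eq_coeff g_def by (rule hermite_coeff_series[OF \<gamma> zero_index_mem])
    also have "\<dots> = (\<Sum>k\<in>\<Lambda>. \<Sum>l\<in>\<Lambda>. if k = l then (d k)\<^sup>2 else 0)"
      using zero_mem by (auto simp: \<gamma>_def C0 power2_eq_square intro!: sum.cong)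
    also have "\<dots> = 1" using fin d1 by simp
    finally show ?thesis .
  qed
  have g_nz: "g \<noteq> (\<lambda>x. 0)"
  proof
    assume "g = (\<lambda>x. 0)"
    then have "gauss_integral s g = 0" by (simp add: gauss_integral_def)
    then show False using I by simp
  qed
  have A0: "linear_algorithm n \<alpha> x g = 0"
    unfolding linear_algorithm_def using g_eq[OF nodes] f0 by (intro sum.neutral) auto
  have norm: "ip g g \<le> (\<Prod>j=1..s. linearization_norm (t j) / weight1 j (2 * t j))"
  proof -
    have cs: "(\<gamma> m)\<^sup>2 \<le> (\<Sum>k\<in>\<Lambda>. \<Sum>l\<in>\<Lambda>. (C k l m)\<^sup>2)" if "m \<in> \<Gamma>" for m
    proof -
      have "(\<gamma> m)\<^sup>2 = (\<Sum>p\<in>\<Lambda> \<times> \<Lambda>. (d (fst p) * d (snd p)) * C (fst p) (snd p) m)\<^sup>2"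
        using that by (simp add: \<gamma>_def sum.cartesian_product case_prod_unfold)
      also have "\<dots> \<le> (\<Sum>p\<in>\<Lambda> \<times> \<Lambda>. (d (fst p) * d (snd p))\<^sup>2) * (\<Sum>p\<in>\<Lambda> \<times> \<Lambda>. (C (fst p) (snd p) m)\<^sup>2)"
        by (rule Cauchy_Schwarz_ineq_sum)
      also have "(\<Sum>p\<in>\<Lambda> \<times> \<Lambda>. (d (fst p) * d (snd p))\<^sup>2) = (\<Sum>k\<in>\<Lambda>. (d k)\<^sup>2) * (\<Sum>l\<in>\<Lambda>. (d l)\<^sup>2)"
        by (simp add: sum_product sum.cartesian_product case_prod_unfold power_mult_distrib)
      also have "(\<Sum>p\<in>\<Lambda> \<times> \<Lambda>. (C (fst p) (snd p) m)\<^sup>2) = (\<Sum>k\<in>\<Lambda>. \<Sum>l\<in>\<Lambda>. (C k l m)\<^sup>2)"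
        by (simp add: sum.cartesian_product case_prod_unfold)
      finally show ?thesis using d1 by simp
    qed
    have "ip g g = (\<Sum>\<^sub>\<infinity>m\<in>multi_indices s. (\<gamma> m)\<^sup>2 / weight m)"
      unfolding g_def by (rule ip_series_self[OF \<gamma>])
    also have "\<dots> = (\<Sum>\<^sub>\<infinity>m\<in>\<Gamma>. (\<gamma> m)\<^sup>2 / weight m)"
      by (rule infsum_cong_neutral) (use sub in \<open>auto simp: \<gamma>_def\<close>)
    also have "\<dots> = (\<Sum>m\<in>\<Gamma>. (\<gamma> m)\<^sup>2 / weight m)" using fin by simp
    also have "\<dots> \<le> (\<Sum>m\<in>\<Gamma>. (\<Sum>k\<in>\<Lambda>. \<Sum>l\<in>\<Lambda>. (C k l m)\<^sup>2) / weight m)"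
      using cs weight_pos by (intro sum_mono divide_right_mono) (auto simp: less_imp_le)
    also have "\<dots> = (\<Sum>m\<in>\<Gamma>. \<Prod>j=1..s. (\<Sum>k\<le>t j. \<Sum>l\<le>t j. (hermite_linearization k l (m j))\<^sup>2) / weight1 j (m j))"
    proof (rule sum.cong[OF refl])
      fix m
      have "(\<Sum>k\<in>\<Lambda>. \<Sum>l\<in>\<Lambda>. (C k l m)\<^sup>2) =
          (\<Sum>k\<in>\<Lambda>. \<Sum>l\<in>\<Lambda>. \<Prod>j=1..s. (hermite_linearization (k j) (l j) (m j))\<^sup>2)"
        by (simp add: C_def prod_power_distrib)
      also have "\<dots> = (\<Sum>k\<in>\<Lambda>. \<Prod>j=1..s. \<Sum>l\<le>t j. (hermite_linearization (k j) l (m j))\<^sup>2)"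
        unfolding \<Lambda>_def by (intro sum.cong refl prod_sum_PiE[symmetric]) auto
      also have "\<dots> = (\<Prod>j=1..s. \<Sum>k\<le>t j. \<Sum>l\<le>t j. (hermite_linearization k l (m j))\<^sup>2)"
        unfolding \<Lambda>_def by (intro prod_sum_PiE[symmetric, where f =
            "\<lambda>j k. \<Sum>l\<le>t j. (hermite_linearization k l (m j))\<^sup>2"]) auto
      finally show "(\<Sum>k\<in>\<Lambda>. \<Sum>l\<in>\<Lambda>. (C k l m)\<^sup>2) / weight m =
          (\<Prod>j=1..s. (\<Sum>k\<le>t j. \<Sum>l\<le>t j. (hermite_linearization k l (m j))\<^sup>2) / weight1 j (m j))"
        by (simp add: weight_eq_prod prod_dividef)
    qed
    also have "\<dots> = (\<Prod>j=1..s. \<Sum>m\<le>2 * t j. (\<Sum>k\<le>t j. \<Sum>l\<le>t j. (hermite_linearization k l m)\<^sup>2) / weight1 j m)"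
      unfolding \<Gamma>_def
      by (intro prod_sum_PiE[symmetric, where f =
          "\<lambda>j m. (\<Sum>k\<le>t j. \<Sum>l\<le>t j. (hermite_linearization k l m)\<^sup>2) / weight1 j m"]) auto
    also have "\<dots> \<le> (\<Prod>j=1..s. linearization_norm (t j) / weight1 j (2 * t j))"
    proof (rule prod_mono, intro conjI)
      fix j assume j: "j \<in> {1..s}"
      show "0 \<le> (\<Sum>m\<le>2 * t j. (\<Sum>k\<le>t j. \<Sum>l\<le>t j. (hermite_linearization k l m)\<^sup>2) / weight1 j m)"
        using weight1_pos by (intro sum_nonneg divide_nonneg_nonneg) (auto intro!: sum_nonneg simp: less_imp_le)
      have "weight1 j (2 * t j) \<le> weight1 j m" if "m \<le> 2 * t j" for m
        unfolding weight1_def using omega that a_ge_1[OF j] b_ge_1[OF j]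
        by (intro powr_mono' mult_left_mono powr_mono2) auto
      then show "(\<Sum>m\<le>2 * t j. (\<Sum>k\<le>t j. \<Sum>l\<le>t j. (hermite_linearization k l m)\<^sup>2) / weight1 j m) \<le>
          linearization_norm (t j) / weight1 j (2 * t j)"
        unfolding linearization_norm_def sum_divide_distrib[of _ "{..2 * t j}"]
        using weight1_pos by (intro sum_mono divide_left_mono) (auto intro!: sum_nonneg mult_pos_pos)
    qed
    finally show ?thesis .
  qed
  have "sqrt (\<Prod>j=1..s. weight1 j (2 * t j) / linearization_norm (t j)) =
      1 / sqrt (\<Prod>j=1..s. linearization_norm (t j) / weight1 j (2 * t j))"
    by (simp add: prod_dividef real_sqrt_divide)
  also have "\<dots> \<le> 1 / hermite_norm \<omega> a b s g"
    unfolding hermite_norm_def using norm ip_pos[OF g_mem g_nz] by (intro divide_left_mono) auto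
  also have "\<dots> \<le> e"
    unfolding e using worst_case_error_ge[where n = n and x = x and \<alpha> = \<alpha>, OF nodes g_mem g_nz] I A0 by simp
  finally show "sqrt (\<Prod>j=1..s. weight1 j (2 * t j) / linearization_norm (t j)) \<le> e" .
qed

end

section \<open>Error bounds for weight sequences\<close>

lemma error_constant_nonneg: "\<theta> < 1 \<Longrightarrow> error_constant \<theta> \<ge> 0"
  unfolding error_constant_def by (intro mult_nonneg_nonneg integral_nonneg_AE) auto

text \<open>
  Convexity of \<open>u \<mapsto> (1 + M u)\<^sup>s\<close> on the unit interval.
\<close>

lemma power_deviation_le:
  fixes M u :: real
  assumes "0 \<le> M" "0 \<le> u" "u \<le> 1"
  shows "(1 + M * u) ^ s - 1 \<le> u * ((1 + M) ^ s - 1)"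
proof (induction s)
  case (Suc s)
  have Mu: "M * u \<le> M" using assms by (simp add: mult_left_le)
  have "(1 + M * u) ^ Suc s - 1 = (1 + M * u) * ((1 + M * u) ^ s - 1) + M * u" by (simp add: algebra_simps)
  also have "\<dots> \<le> (1 + M) * (u * ((1 + M) ^ s - 1)) + M * u"
    using Suc Mu assms one_le_power[of "1 + M" s] one_le_power[of "1 + M * u" s]
    by (intro add_right_mono mult_mono) auto
  also have "\<dots> = u * ((1 + M) ^ Suc s - 1)" by (simp add: algebra_simps)
  finally show ?case .
qed simp

lemma powr_unbounded:
  fixes X \<delta> :: real
  assumes "\<delta> > 0"
  shows "\<exists>T\<ge>1. X < T powr \<delta>"
proof (intro exI conjI)
  let ?T = "(\<bar>X\<bar> + 1) powr (1 / \<delta>)"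
  show "1 \<le> ?T" using assms by (intro ge_one_powr_ge_zero) auto
  show "X < ?T powr \<delta>" using assms by (simp add: powr_powr)
qed

lemma ln_le_powr_div:
  fixes x \<sigma> :: real
  assumes "x \<ge> 1" "\<sigma> > 0"
  shows "ln x \<le> x powr \<sigma> / \<sigma>"
proof -
  have "\<sigma> * ln x = ln (x powr \<sigma>)" using assms by (simp add: ln_powr)
  also have "\<dots> \<le> x powr \<sigma>" using assms ln_le_minus_one[of "x powr \<sigma>"] by simp
  finally show ?thesis using assms by (simp add: field_simps)
qed

locale hermite_sequences =
  fixes \<omega> :: real and a b :: "nat \<Rightarrow> real"
  assumes omega: "0 < \<omega>" "\<omega> < 1"
    and a_1: "1 \<le> a 1" and a_mono: "\<And>j. j \<ge> 1 \<Longrightarrow> a j \<le> a (Suc j)"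
    and b_1: "1 \<le> b 1" and b_mono: "\<And>j. j \<ge> 1 \<Longrightarrow> b j \<le> b (Suc j)"
begin

lemma a_le: "1 \<le> i \<Longrightarrow> i \<le> j \<Longrightarrow> a i \<le> a j" and b_le: "1 \<le> i \<Longrightarrow> i \<le> j \<Longrightarrow> b i \<le> b j"
proof -
  show "1 \<le> i \<Longrightarrow> i \<le> j \<Longrightarrow> a i \<le> a j"
  proof (induction j)
    case (Suc j)
    then show ?case using a_mono[of j] by (cases "i = Suc j") auto
  qed simp
  show "1 \<le> i \<Longrightarrow> i \<le> j \<Longrightarrow> b i \<le> b j"
  proof (induction j)
    case (Suc j)
    then show ?case using b_mono[of j] by (cases "i = Suc j") auto
  qed simp
qed

lemma a_ge_1: "j \<ge> 1 \<Longrightarrow> 1 \<le> a j" and b_ge_1: "j \<ge> 1 \<Longrightarrow> 1 \<le> b j"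
  using a_le[of 1 j] a_1 b_le[of 1 j] b_1 by auto

lemma weights: "hermite_weights \<omega> a b s"
  using omega a_ge_1 b_ge_1 by unfold_locales auto

abbreviation "err n s \<equiv> min_error \<omega> a b n s"
abbreviation "info \<epsilon> s \<equiv> info_complexity \<omega> a b \<epsilon> s"

definition B :: "nat \<Rightarrow> real" where "B s = (\<Sum>j=1..s. 1 / b j)"

definition M :: real where "M = error_constant (sqrt \<omega>)"

lemma M_nonneg: "M \<ge> 0"
  unfolding M_def using omega by (intro error_constant_nonneg) auto

lemma B_pos: "s \<ge> 1 \<Longrightarrow> B s > 0"
  unfolding B_def using b_ge_1 by (intro sum_pos) (auto intro: less_le_trans[of 0 1])

lemma prod_powr_eq: "x > 0 \<Longrightarrow> (\<Prod>j=1..s. x powr (p / b j)) = x powr (p * B s)"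
  unfolding B_def sum_distrib_left by (simp add: powr_sum)

lemmas err_upper = hermite_weights.min_error_upper[OF weights, folded M_def]
lemma err_lower:
  assumes "n < (\<Prod>j=1..s. t j + 1)"
  shows "sqrt (\<Prod>j=1..s. \<omega> powr (a j * (2 * real (t j)) powr b j) / linearization_norm (t j)) \<le> err n s"
  using hermite_weights.min_error_lower[OF weights assms]
  by (simp add: hermite_weights.weight1_def[OF weights])

section \<open>Exponential convergence\<close>

lemma err_exponential:
  assumes p: "p > 0" "p * B s \<le> 1" and n: "n \<ge> 1"
  shows "err n s \<le> sqrt ((1 + M) ^ s) * \<omega> powr (real n powr p / 4)"
proof -
  define m where "m j = nat \<lfloor>real n powr (p / b j)\<rfloor>" for j
  have z1: "real n powr (p / b j) \<ge> 1" if "j \<in> {1..s}" for j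
    using n p b_ge_1[of j] that by (intro ge_one_powr_ge_zero) auto
  have m1: "m j \<ge> 1" and m2: "real (m j) \<le> real n powr (p / b j)"
      and m3: "real n powr (p / b j) \<le> 2 * real (m j)"
    if "j \<in> {1..s}" for j
  proof -
    have "1 \<le> \<lfloor>real n powr (p / b j)\<rfloor>" using z1[OF that] by (simp add: le_floor_iff)
    then have "real (m j) = of_int \<lfloor>real n powr (p / b j)\<rfloor>" "1 \<le> real_of_int \<lfloor>real n powr (p / b j)\<rfloor>"
      unfolding m_def by simp_all
    then show "m j \<ge> 1" "real (m j) \<le> real n powr (p / b j)" "real n powr (p / b j) \<le> 2 * real (m j)"
      by linarith+
  qed
  have "real (\<Prod>j=1..s. m j) \<le> (\<Prod>j=1..s. real n powr (p / b j))"
    unfolding of_nat_prod using m2 by (intro prod_mono) auto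
  also have "\<dots> = real n powr (p * B s)" using n by (intro prod_powr_eq) auto
  also have "\<dots> \<le> real n powr 1" using n p by (intro powr_mono) auto
  finally have "real (\<Prod>j=1..s. m j) \<le> real n" using n by (simp del: of_nat_prod)
  then have prod: "(\<Prod>j=1..s. m j) \<le> n" by (simp only: of_nat_le_iff)
  define u where "u = \<omega> powr (real n powr p / 2)"
  have u: "0 \<le> u" "u \<le> 1" using omega by (auto simp: u_def powr_le1)
  have le: "\<omega> powr (a j * (2 * real (m j)) powr b j / 2) \<le> u" if j: "j \<in> {1..s}" for j
  proof -
    have "real n powr p = (real n powr (p / b j)) powr b j"
      using b_ge_1[of j] j by (simp add: powr_powr)
    also have "\<dots> \<le> (2 * real (m j)) powr b j" using m3[OF j] b_ge_1[of j] j by (intro powr_mono2) auto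
    also have "\<dots> \<le> a j * (2 * real (m j)) powr b j" using a_ge_1[of j] j by (simp add: mult_le_cancel_right1)
    finally show ?thesis unfolding u_def using omega by (intro powr_mono') auto
  qed
  have "(err n s)\<^sup>2 \<le> (\<Prod>j=1..s. 1 + M * \<omega> powr (a j * (2 * real (m j)) powr b j / 2)) - 1"
    by (rule err_upper[OF m1 prod])
  also have "\<dots> \<le> (\<Prod>j=1..s. 1 + M * u) - 1"
    using le M_nonneg by (intro diff_right_mono prod_mono) (auto intro!: mult_left_mono)
  also have "\<dots> \<le> u * ((1 + M) ^ s - 1)"
    using power_deviation_le[OF M_nonneg u, of s] by simp
  also have "\<dots> \<le> (1 + M) ^ s * u" using u by (simp add: algebra_simps)
  finally have "err n s \<le> sqrt ((1 + M) ^ s * u)" by (rule real_le_rsqrt)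
  also have "\<dots> = sqrt ((1 + M) ^ s) * \<omega> powr (real n powr p / 4)"
    using omega by (simp add: real_sqrt_mult u_def powr_half_sqrt[symmetric] powr_powr)
  finally show ?thesis .
qed

text \<open>
  Changing the base \<open>q\<close> rescales the exponent by a constant factor, which \<open>C1\<close> absorbs.
\<close>

lemma err_exponential_any_base:
  assumes q: "q \<in> {0<..<1}" and p: "p > 0" "p * B s \<le> 1"
  shows "\<exists>C>0. \<exists>C1>0. \<forall>n\<ge>1. err n s \<le> C * q powr ((real n / C1) powr p)"
proof -
  define \<kappa> where "\<kappa> = ln \<omega> / (4 * ln q)"
  have \<kappa>: "\<kappa> > 0" using omega q by (auto simp: \<kappa>_def intro!: divide_neg_neg)
  define C1 where "C1 = \<kappa> powr (- 1 / p)"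
  have C1: "C1 > 0" using \<kappa> by (simp add: C1_def)
  have eq: "q powr ((real n / C1) powr p) = \<omega> powr (real n powr p / 4)" for n
  proof -
    have "(real n / C1) powr p = real n powr p * \<kappa>"
      using C1 p \<kappa> by (simp add: powr_divide C1_def powr_powr powr_minus_divide powr_mult)
    then show ?thesis using q omega by (simp add: powr_def[of q] powr_def[of \<omega>] \<kappa>_def)
  qed
  have "sqrt ((1 + M) ^ s) > 0" using M_nonneg by simp
  then show ?thesis
    using C1 err_exponential[OF p] unfolding eq[symmetric] by blast
qed

lemma linearization_norm_exp_bound:
  assumes "real t \<le> T" "1 \<le> T"
  shows "exp (- (10 * T * (1 + ln T))) \<le> 1 / linearization_norm t"
proof -
  have e6: "ln (6::real) \<le> 2"
  proof -
    have "(6::real) \<le> (1 + 1 / 2 + (1/2)\<^sup>2 / 2) ^ 4" by (simp add: power2_eq_square eval_nat_numeral)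
    also have "\<dots> \<le> exp (1 / 2) ^ 4"
      using exp_lower_Taylor_quadratic[of "1/2::real"] by (intro power_mono) auto
    also have "\<dots> = exp (2::real)" by (simp add: exp_of_nat_mult[symmetric])
    finally show ?thesis by (metis exp_gt_zero ln_exp ln_le_cancel_iff zero_less_numeral)
  qed
  have l: "ln (3 * real t + 3) \<le> 2 * (1 + ln T)"
  proof -
    have "ln (3 * real t + 3) \<le> ln (6 * T)" using assms by simp
    also have "\<dots> = ln 6 + ln T" using assms by (simp add: ln_mult)
    finally show ?thesis using e6 assms by (smt (verit) ln_ge_zero)
  qed
  have "linearization_norm t \<le> (3 * real t + 3) ^ (2 * t + 3)" by (rule linearization_norm_le)
  also have "\<dots> = exp (real (2 * t + 3) * ln (3 * real t + 3))"
    by (simp add: exp_of_nat_mult exp_ln add_pos_nonneg del: of_nat_add of_nat_mult)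
  also have "\<dots> \<le> exp (5 * T * (2 * (1 + ln T)))"
    using assms l by (subst exp_le_cancel_iff, intro mult_mono) auto
  finally have "linearization_norm t \<le> exp (10 * T * (1 + ln T))" by (simp add: algebra_simps)
  then have "1 / exp (10 * T * (1 + ln T)) \<le> 1 / linearization_norm t"
    using linearization_norm_ge_1[of t] by (intro divide_left_mono) (auto intro!: mult_pos_pos)
  then show ?thesis by (simp add: exp_minus inverse_eq_divide)
qed

text \<open>
  With \<open>t\<^sub>j = \<lfloor>T powr (1 / b\<^sub>j)\<rfloor>\<close> each factor of the lower estimate is \<open>exp (- O(T (1 + ln T)))\<close>, while
  \<open>\<Prod>j. (t\<^sub>j + 1) \<ge> T powr B s\<close>. The logarithm is absorbed into an arbitrarily small power of \<open>T\<close>.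
\<close>

lemma err_lower_growth:
  assumes s: "s \<ge> 1" and \<delta>: "\<delta> > 0"
  shows "\<exists>K>0. \<forall>T\<ge>1. \<exists>N\<ge>2. T powr B s \<le> real N \<and> (\<forall>n<N. exp (- K * T powr (1 + \<delta>)) \<le> err n s)"
proof -
  define \<nu> where "\<nu> = ln (1 / \<omega>)"
  have \<nu>: "\<nu> > 0" using omega by (simp add: \<nu>_def)
  define K0 where "K0 = (\<Sum>j=1..s. \<nu> * a j * 2 powr b j + 10)"
  have K0: "K0 > 0" unfolding K0_def
  proof (rule sum_pos)
    fix j assume "j \<in> {1..s}"
    then have "0 \<le> \<nu> * a j * 2 powr b j" using a_ge_1[of j] \<nu> by (intro mult_nonneg_nonneg) auto
    then show "0 < \<nu> * a j * 2 powr b j + 10" by linarith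
  qed (use s in auto)
  define K where "K = K0 * (1 + 1 / \<delta>) / 2"
  have K: "K > 0" using K0 \<delta> by (auto simp: K_def intro!: mult_pos_pos add_pos_pos)
  show ?thesis
  proof (intro exI[of _ K] conjI allI impI K)
    fix T :: real assume T: "1 \<le> T"
    define t where "t j = nat \<lfloor>T powr (1 / b j)\<rfloor>" for j
    have z: "T powr (1 / b j) \<ge> 1" "T powr (1 / b j) \<le> T" if "j \<in> {1..s}" for j
      using T b_ge_1[of j] that powr_mono[of "1 / b j" 1 T] by (auto intro!: ge_one_powr_ge_zero)
    have t: "t j \<ge> 1" "T powr (1 / b j) \<le> real (t j) + 1" "real (t j) \<le> T powr (1 / b j)" "real (t j) \<le> T"
      if "j \<in> {1..s}" for j
      using z[OF that] unfolding t_def by linarith+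
    define N where "N = (\<Prod>j=1..s. t j + 1)"
    have "T powr B s = (\<Prod>j=1..s. T powr (1 / b j))" using T prod_powr_eq[of T 1 s] by simp
    also have "\<dots> \<le> (\<Prod>j=1..s. real (t j) + 1)" using t by (intro prod_mono) auto
    also have "\<dots> = real N" by (simp add: N_def add.commute)
    finally have TN: "T powr B s \<le> real N" .
    have "(2::nat) \<le> 2 ^ s" using s by (metis One_nat_def self_le_power one_le_numeral power_one_right
        power_increasing)
    also have "2 ^ s = (\<Prod>j=1..s. 2)" by simp
    also have "\<dots> \<le> N" unfolding N_def using t(1) by (intro prod_mono) (auto simp: Suc_le_eq)
    finally have N2: "N \<ge> 2" .
    have "exp (- K * T powr (1 + \<delta>)) \<le> err n s" if n: "n < N" for n
    proof -
      define v where "v = T * (1 + ln T)"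
      have v: "v \<le> (1 + 1 / \<delta>) * T powr (1 + \<delta>)"
      proof -
        have "1 + ln T \<le> T powr \<delta> + T powr \<delta> / \<delta>"
          using ln_le_powr_div[OF T \<delta>] ge_one_powr_ge_zero[OF T, of \<delta>] \<delta> by auto
        then have "T * (1 + ln T) \<le> T * ((1 + 1 / \<delta>) * T powr \<delta>)"
          using T by (intro mult_left_mono) (auto simp: algebra_simps)
        then show ?thesis using T by (simp add: v_def powr_add mult_ac)
      qed
      have Tv: "T \<le> v" using T by (simp add: v_def mult_le_cancel_left1)
      have fac: "exp (- ((\<nu> * a j * 2 powr b j + 10) * v)) \<le>
          \<omega> powr (a j * (2 * real (t j)) powr b j) / linearization_norm (t j)" if j: "j \<in> {1..s}" for j
      proof -
        have "(2 * real (t j)) powr b j = 2 powr b j * real (t j) powr b j" by (simp add: powr_mult)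
        also have "\<dots> \<le> 2 powr b j * (T powr (1 / b j)) powr b j"
          using t[OF j] b_ge_1[of j] j by (intro mult_left_mono powr_mono2) auto
        also have "(T powr (1 / b j)) powr b j = T" using T b_ge_1[of j] j by (simp add: powr_powr)
        also have "2 powr b j * T \<le> 2 powr b j * v" using Tv by (intro mult_left_mono) auto
        finally have "a j * (2 * real (t j)) powr b j \<le> a j * (2 powr b j * v)"
          using a_ge_1[of j] j by (intro mult_left_mono) auto
        then have "\<omega> powr (a j * (2 powr b j * v)) \<le> \<omega> powr (a j * (2 * real (t j)) powr b j)"
          using omega by (intro powr_mono') auto
        moreover have "\<omega> powr (a j * (2 powr b j * v)) = exp (- (\<nu> * a j * 2 powr b j * v))"
          using omega by (simp add: powr_def \<nu>_def ln_div mult_ac)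
        moreover have "exp (- (10 * T * (1 + ln T))) \<le> 1 / linearization_norm (t j)"
          by (rule linearization_norm_exp_bound) (use t[OF j] T in auto)
        ultimately have "exp (- (\<nu> * a j * 2 powr b j * v)) * exp (- (10 * T * (1 + ln T))) \<le>
           \<omega> powr (a j * (2 * real (t j)) powr b j) * (1 / linearization_norm (t j))"
          by (intro mult_mono) auto
        then show ?thesis by (simp add: exp_add[symmetric] v_def algebra_simps)
      qed
      have "exp (- (K * T powr (1 + \<delta>))) \<le> exp (- (K0 * v / 2))"
        using v K0 by (simp add: K_def mult.assoc mult_left_mono)
      also have "\<dots> = sqrt (exp (- (K0 * v)))"
      proof -
        have "exp (- (K0 * v)) = (exp (- (K0 * v / 2)))\<^sup>2"
          by (simp add: exp_of_nat_mult[symmetric])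
        then show ?thesis by simp
      qed
      also have "\<dots> = sqrt (\<Prod>j=1..s. exp (- ((\<nu> * a j * 2 powr b j + 10) * v)))"
        unfolding K0_def sum_distrib_right by (simp add: exp_sum[symmetric] sum_negf)
      also have "\<dots> \<le> sqrt (\<Prod>j=1..s. \<omega> powr (a j * (2 * real (t j)) powr b j) / linearization_norm (t j))"
        using fac by (intro real_sqrt_le_mono prod_mono) auto
      also have "\<dots> \<le> err n s" by (rule err_lower) (use n in \<open>simp add: N_def\<close>)
      finally show ?thesis by simp
    qed
    then show "\<exists>N\<ge>2. T powr B s \<le> real N \<and> (\<forall>n<N. exp (- K * T powr (1 + \<delta>)) \<le> err n s)"
      using TN N2 by blast
  qed
qed

text \<open>
  Otherwise the assumed bound at \<open>n\<close> of order \<open>T powr B s\<close> would decay like \<open>exp (- c T powr (p B s))\<close>, faster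
  than \<open>err_lower_growth\<close> permits.
\<close>

lemma exponential_rate_le:
  assumes s: "s \<ge> 1" and q: "q \<in> {0<..<1}" and p: "p > 0" and C: "C > 0" "C1 > 0"
    and bound: "\<And>n. n \<ge> 1 \<Longrightarrow> err n s \<le> C * q powr ((real n / C1) powr p)"
  shows "p * B s \<le> 1"
proof (rule ccontr)
  assume neg: "\<not> p * B s \<le> 1"
  (* The midpoint between the exponents 1 of the lower estimate and p B s of the assumed bound. *)
  define \<delta> where "\<delta> = (p * B s - 1) / 2"
  have \<delta>: "\<delta> > 0" "p * B s = \<delta> + (1 + \<delta>)" using neg by (auto simp: \<delta>_def field_simps)
  obtain K where K: "K > 0" and low: "\<And>T. T \<ge> 1 \<Longrightarrow>
      \<exists>N\<ge>2. T powr B s \<le> real N \<and> (\<forall>n<N. exp (- K * T powr (1 + \<delta>)) \<le> err n s)"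
    using err_lower_growth[OF s \<delta>(1)] by blast
  define c where "c = - ln q * (1 / (2 * C1)) powr p"
  have c: "c > 0" using q C by (auto simp: c_def mult_neg_pos)
  obtain T where T: "T \<ge> 1" and big: "(\<bar>ln C\<bar> + K) / c < T powr \<delta>"
    using powr_unbounded[OF \<delta>(1)] by blast
  obtain N where N: "N \<ge> 2" "T powr B s \<le> real N" "\<And>n. n < N \<Longrightarrow> exp (- K * T powr (1 + \<delta>)) \<le> err n s"
    using low[OF T] by blast
  have half: "T powr B s / 2 \<le> real (N - 1)" using N(1,2) by (simp add: of_nat_diff)
  have "exp (- K * T powr (1 + \<delta>)) \<le> err (N - 1) s" using N by auto
  also have "\<dots> \<le> C * q powr ((real (N - 1) / C1) powr p)" using N(1) by (intro bound) auto
  also have "\<dots> \<le> C * q powr ((T powr B s / (2 * C1)) powr p)"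
    using half C p q by (intro mult_left_mono powr_mono' powr_mono2) (auto simp: field_simps)
  also have "\<dots> = exp (ln C - c * T powr (p * B s))"
  proof -
    have "(T powr B s / (2 * C1)) powr p = (1 / (2 * C1)) powr p * T powr (p * B s)"
      using C T by (simp add: powr_mult[symmetric] powr_powr[symmetric] mult.commute[of p] powr_divide)
    then show ?thesis using q C by (simp add: powr_def[of q] c_def exp_add mult_ac)
  qed
  finally have "c * T powr (p * B s) \<le> ln C + K * T powr (1 + \<delta>)" by simp
  also have "\<dots> \<le> (\<bar>ln C\<bar> + K) * T powr (1 + \<delta>)"
  proof -
    have "1 \<le> T powr (1 + \<delta>)" using T \<delta> by (intro ge_one_powr_ge_zero) auto
    then have "\<bar>ln C\<bar> * 1 \<le> \<bar>ln C\<bar> * T powr (1 + \<delta>)" by (intro mult_left_mono) auto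
    then show ?thesis by (simp add: distrib_right)
  qed
  finally have "(c * T powr \<delta>) * T powr (1 + \<delta>) \<le> (\<bar>ln C\<bar> + K) * T powr (1 + \<delta>)"
    unfolding \<delta>(2) powr_add[of T \<delta> "1 + \<delta>"] by (simp add: mult.assoc)
  then have "c * T powr \<delta> \<le> \<bar>ln C\<bar> + K" using T by simp
  then show False using big c by (simp add: field_simps)
qed

section \<open>Information complexity\<close>

text \<open>
  The number of nodes in direction \<open>j\<close> for which \<open>a\<^sub>j (2 m) powr b\<^sub>j \<ge> z\<close>. It is 1 as soon as
  \<open>z < a\<^sub>j 2 powr b\<^sub>j\<close>, so that only some of the coordinates contribute to the size of the product rule.
\<close>

definition rule_size :: "real \<Rightarrow> nat \<Rightarrow> nat" where
  "rule_size z j = max 1 (nat \<lfloor>(z / a j) powr (1 / b j)\<rfloor>)"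

text \<open>
  The exponent in direction \<open>j\<close> dominates both \<open>c y\<close> and \<open>a\<^sub>j 2 powr b\<^sub>j\<close>, where \<open>y =
      1 + ln (1 / \<epsilon>)\<close>, hence also
  their mean. So the contribution of \<open>j\<close> splits into a factor \<open>\<omega> powr (c y / 4)\<close>, which for large \<open>c\<close> beats
  \<open>\<epsilon>\<^sup>2\<close>, and a factor that is summable over \<open>j\<close>. The constant \<open>c\<close> depends on \<open>S\<close> but not on \<open>s\<close> and \<open>\<epsilon>\<close>.
\<close>

lemma err_le_of_summable_weights:
  assumes S: "0 < S"
  shows "\<exists>c\<ge>1. \<forall>s. \<forall>\<epsilon>\<in>{0<..<1}. (\<Sum>j=1..s. \<omega> powr (a j * 2 powr b j / 4)) \<le> S \<longrightarrow>
    err (\<Prod>j=1..s. rule_size (c * (1 + ln (1 / \<epsilon>))) j) s \<le> \<epsilon>"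
proof -
  define \<nu> where "\<nu> = ln (1 / \<omega>)"
  have \<nu>: "\<nu> > 0" using omega by (simp add: \<nu>_def)
  have om: "\<omega> powr x = exp (- (\<nu> * x))" for x using omega by (simp add: powr_def \<nu>_def ln_div)
  define Z where "Z = ln (2 * M * S + 1)"
  have MS: "0 \<le> M * S" using S M_nonneg by (intro mult_nonneg_nonneg) auto
  then have "0 < 2 * M * S + 1" by linarith
  then have Z: "Z \<ge> 0" "2 * M * S \<le> exp Z"
    unfolding Z_def using MS by (auto intro!: ln_ge_zero simp: mult.assoc)
  (* So large that \<omega> powr (c y / 4) \<le> exp (- (2 + Z) y), where exp Z compensates the constant 2 M S. *)
  define c where "c = max 1 (4 * (2 + Z) / \<nu>)"
  have c: "c \<ge> 1" "\<nu> * c / 4 \<ge> 2 + Z" using \<nu> by (auto simp: c_def field_simps max_def)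
  show ?thesis
  proof (intro exI[of _ c] conjI c(1) allI ballI impI)
    fix s \<epsilon> assume \<epsilon>: "\<epsilon> \<in> {0<..<1::real}" and Ss: "(\<Sum>j=1..s. \<omega> powr (a j * 2 powr b j / 4)) \<le> S"
    define y where "y = 1 + ln (1 / \<epsilon>)"
    have y: "y \<ge> 1" using \<epsilon> by (auto simp: y_def)
    define m where "m = rule_size (c * y)"
    define x where "x j = M * \<omega> powr (a j * (2 * real (m j)) powr b j / 2)" for j
    have x_nn: "x j \<ge> 0" for j unfolding x_def using M_nonneg by simp
    have x_le: "x j \<le> M * \<omega> powr (c * y / 4) * \<omega> powr (a j * 2 powr b j / 4)" if j: "j \<in> {1..s}" for j
    proof -
      have aj: "a j \<ge> 1" and bj: "b j \<ge> 1" using a_ge_1 b_ge_1 j by auto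
      let ?z = "(c * y / a j) powr (1 / b j)"
      have m1: "m j \<ge> 1" and mz: "?z \<le> 2 * real (m j)"
        unfolding m_def rule_size_def by linarith+
      have "c * y / a j = ?z powr b j" using c y aj bj by (simp add: powr_powr)
      also have "\<dots> \<le> (2 * real (m j)) powr b j" using mz bj by (intro powr_mono2) auto
      finally have 1: "c * y \<le> a j * (2 * real (m j)) powr b j" using aj by (simp add: field_simps)
      have "2 powr b j \<le> (2 * real (m j)) powr b j" using m1 bj by (intro powr_mono2) auto
      then have 2: "a j * 2 powr b j \<le> a j * (2 * real (m j)) powr b j" using aj by simp
      have "c * y / 4 + a j * 2 powr b j / 4 \<le> a j * (2 * real (m j)) powr b j / 2" using 1 2 by linarith
      then have "\<omega> powr (a j * (2 * real (m j)) powr b j / 2) \<le> \<omega> powr (c * y / 4 + a j * 2 powr b j / 4)"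
        using omega by (intro powr_mono') auto
      then show ?thesis unfolding x_def powr_add mult.assoc by (intro mult_left_mono M_nonneg)
    qed
    have "(\<Sum>j=1..s. x j) \<le> M * \<omega> powr (c * y / 4) * (\<Sum>j=1..s. \<omega> powr (a j * 2 powr b j / 4))"
      unfolding sum_distrib_left using x_le by (intro sum_mono) auto
    also have "\<dots> \<le> M * \<omega> powr (c * y / 4) * S"
      using Ss M_nonneg by (intro mult_left_mono) auto
    also have "\<dots> = (2 * M * S) * exp (- (\<nu> * c / 4 * y)) / 2" by (simp add: om)
    also have "\<dots> \<le> exp Z * exp (- ((2 + Z) * y)) / 2"
      using Z MS c y by (intro divide_right_mono mult_mono) (auto intro!: mult_right_mono)
    also have "\<dots> \<le> exp Z * exp (- (2 * (y - 1) + Z)) / 2"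
    proof -
      have "Z * 1 \<le> Z * y" using Z y by (intro mult_left_mono) auto
      then have "2 * (y - 1) + Z \<le> (2 + Z) * y" by (simp add: algebra_simps)
      then show ?thesis by simp
    qed
    also have "\<dots> = exp (- (2 * (y - 1))) / 2" by (simp add: exp_add[symmetric] algebra_simps)
    also have "exp (- (2 * (y - 1))) = \<epsilon>\<^sup>2"
    proof -
      have "- (2 * (y - 1)) = ln (\<epsilon>\<^sup>2)" using \<epsilon> by (simp add: y_def ln_div ln_realpow)
      then show ?thesis using \<epsilon> by simp
    qed
    finally have sum_x: "(\<Sum>j=1..s. x j) \<le> \<epsilon>\<^sup>2 / 2" .
    have e1: "\<epsilon>\<^sup>2 \<le> 1" using \<epsilon> by (simp add: power_le_one)
    have sx0: "0 \<le> (\<Sum>j=1..s. x j)" by (intro sum_nonneg x_nn)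
    have "(err (\<Prod>j=1..s. m j) s)\<^sup>2 \<le> (\<Prod>j=1..s. 1 + x j) - 1"
      unfolding x_def by (rule err_upper) (auto simp: m_def rule_size_def)
    also have "(\<Prod>j=1..s. 1 + x j) \<le> (\<Prod>j=1..s. exp (x j))"
      using x_nn by (intro prod_mono) (auto intro: add_nonneg_nonneg)
    also have "\<dots> = exp (\<Sum>j=1..s. x j)" by (simp add: exp_sum)
    also have "\<dots> \<le> 1 + (\<Sum>j=1..s. x j) + (\<Sum>j=1..s. x j)\<^sup>2"
      using sx0 sum_x e1 by (intro exp_bound) auto
    also have "(\<Sum>j=1..s. x j)\<^sup>2 \<le> (\<Sum>j=1..s. x j) * 1"
      unfolding power2_eq_square using sx0 sum_x e1 by (intro mult_left_mono) auto
    finally have "(err (\<Prod>j=1..s. m j) s)\<^sup>2 \<le> \<epsilon>\<^sup>2" using sum_x by simp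
    then show "err (\<Prod>j=1..s. rule_size (c * (1 + ln (1 / \<epsilon>))) j) s \<le> \<epsilon>"
      unfolding m_def y_def by (rule power2_le_imp_le) (use \<epsilon> in simp)
  qed
qed

lemma info_le: "err n s \<le> \<epsilon> \<Longrightarrow> info \<epsilon> s \<le> n"
  unfolding info_complexity_def by (rule Least_le)

text \<open>
  The least number in the definition of the information complexity exists.
\<close>

lemma err_info_le:
  assumes "\<epsilon> \<in> {0<..<1}"
  shows "err (info \<epsilon> s) s \<le> \<epsilon>"
proof -
  let ?S = "\<Sum>j=1..s. \<omega> powr (a j * 2 powr b j / 4)"
  have "0 < ?S + 1" by (intro add_nonneg_pos sum_nonneg) auto
  from err_le_of_summable_weights[OF this] obtain c where
    c: "\<forall>s'. \<forall>\<epsilon>\<in>{0<..<1}. (\<Sum>j=1..s'. \<omega> powr (a j * 2 powr b j / 4)) \<le> ?S + 1 \<longrightarrow>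
      err (\<Prod>j=1..s'. rule_size (c * (1 + ln (1 / \<epsilon>))) j) s' \<le> \<epsilon>" by (elim exE conjE) (rule that)
  have "err (\<Prod>j=1..s. rule_size (c * (1 + ln (1 / \<epsilon>))) j) s \<le> \<epsilon>"
    by (rule c[rule_format, OF assms]) simp
  then show ?thesis unfolding info_complexity_def by (rule LeastI)
qed

lemma info_ge:
  assumes "\<epsilon> \<in> {0<..<1}" "\<And>n. n < N \<Longrightarrow> \<epsilon> < err n s"
  shows "N \<le> info \<epsilon> s"
  using err_info_le[OF assms(1), of s] assms(2)[of "info \<epsilon> s"] by linarith

text \<open>
  The constant may depend on \<open>s\<close>; this serves polynomial as well as strong polynomial tractability. For
  \<open>\<epsilon> = exp (- K T powr (1 + \<delta>)) / 2\<close> at least \<open>T powr B s\<close> nodes are needed, although \<open>ln (1 / \<epsilon>)\<close> is only of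
  order \<open>T powr (1 + \<delta>)\<close>.
\<close>

lemma tractability_exponent_ge:
  assumes s: "s \<ge> 1" and c: "c \<ge> 0" and \<tau>: "\<tau> \<ge> 0"
    and bound: "\<And>\<epsilon>. \<epsilon> \<in> {0<..<1} \<Longrightarrow> real (info \<epsilon> s) \<le> c * (1 + ln (1 / \<epsilon>)) powr \<tau>"
  shows "B s \<le> \<tau>"
proof (rule ccontr)
  assume neg: "\<not> B s \<le> \<tau>"
  (* Chosen such that (1 + \<delta>) \<tau> is still less than B s, also for \<tau> = 0. *)
  define \<delta> where "\<delta> = (B s - \<tau>) / 2 / (\<tau> + 1)"
  have \<delta>: "\<delta> > 0" using neg \<tau> by (auto simp: \<delta>_def)
  have "\<delta> * \<tau> \<le> \<delta> * (\<tau> + 1)" using \<delta> by simp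
  also have "\<dots> = (B s - \<tau>) / 2"
    using \<tau> by (intro nonzero_eq_divide_eq[THEN iffD1, OF _ \<delta>_def]) simp
  finally have gap: "(1 + \<delta>) * \<tau> < B s" using neg by (simp add: algebra_simps)
  obtain K where K: "K > 0" and low: "\<And>T. T \<ge> 1 \<Longrightarrow>
      \<exists>N\<ge>2. T powr B s \<le> real N \<and> (\<forall>n<N. exp (- K * T powr (1 + \<delta>)) \<le> err n s)"
    using err_lower_growth[OF s \<delta>] by blast
  define d where "d = B s - (1 + \<delta>) * \<tau>"
  have d: "d > 0" using gap by (simp add: d_def)
  obtain T where T: "T \<ge> 1" and big: "c * (2 + K) powr \<tau> < T powr d"
    using powr_unbounded[OF d] by blast
  obtain N where N: "T powr B s \<le> real N" "\<And>n. n < N \<Longrightarrow> exp (- K * T powr (1 + \<delta>)) \<le> err n s"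
    using low[OF T] by blast
  define W where "W = T powr (1 + \<delta>)"
  have W: "W \<ge> 1" unfolding W_def using T \<delta> by (intro ge_one_powr_ge_zero) auto
  define \<epsilon> where "\<epsilon> = exp (- K * W) / 2"
  have "exp (- K * W) \<le> 1" using K W by (simp add: mult_nonneg_nonneg)
  then have "\<epsilon> \<le> 1 / 2" unfolding \<epsilon>_def by linarith
  moreover have "0 < \<epsilon>" by (simp add: \<epsilon>_def)
  ultimately have \<epsilon>: "\<epsilon> \<in> {0<..<1}" by simp
  have "\<epsilon> < exp (- K * W)" by (simp add: \<epsilon>_def)
  then have "N \<le> info \<epsilon> s" using N(2) unfolding W_def by (intro info_ge[OF \<epsilon>]) (auto intro: less_le_trans)
  then have "T powr B s \<le> real (info \<epsilon> s)" using N(1) by linarith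
  also have "\<dots> \<le> c * (1 + ln (1 / \<epsilon>)) powr \<tau>" by (rule bound[OF \<epsilon>])
  also have "\<dots> \<le> c * ((2 + K) * W) powr \<tau>"
  proof -
    have "ln (1 / \<epsilon>) = ln 2 + K * W" by (simp add: \<epsilon>_def ln_div ln_mult)
    moreover have "ln (2::real) \<le> 1" using ln_le_minus_one[of "2::real"] by simp
    moreover have "0 \<le> K * W" "0 \<le> ln (2::real)" using K W by auto
    moreover have "(2 + K) * W = 2 * W + K * W" by (simp add: algebra_simps)
    ultimately have "0 \<le> 1 + ln (1 / \<epsilon>)" "1 + ln (1 / \<epsilon>) \<le> (2 + K) * W" using W by auto
    then show ?thesis using c \<tau> by (intro mult_left_mono powr_mono2) auto
  qed
  also have "\<dots> = (c * (2 + K) powr \<tau>) * T powr ((1 + \<delta>) * \<tau>)"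
    unfolding W_def using T K by (simp add: powr_mult powr_powr mult.assoc)
  finally have "T powr (d + (1 + \<delta>) * \<tau>) \<le> (c * (2 + K) powr \<tau>) * T powr ((1 + \<delta>) * \<tau>)"
    by (simp add: d_def)
  then have "T powr d * T powr ((1 + \<delta>) * \<tau>) \<le> (c * (2 + K) powr \<tau>) * T powr ((1 + \<delta>) * \<tau>)"
    by (simp only: powr_add)
  then have "T powr d \<le> c * (2 + K) powr \<tau>" using T by simp
  then show False using big by simp
qed

lemma omega_powr_le: "u > 0 \<Longrightarrow> \<omega> powr u \<le> 1 / (ln (1 / \<omega>) * u)"
proof -
  assume u: "u > 0"
  have l: "ln (1 / \<omega>) > 0" using omega by simp
  have "ln (1 / \<omega>) * u \<le> exp (ln (1 / \<omega>) * u)"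
    using exp_ge_add_one_self[of "ln (1 / \<omega>) * u"] by linarith
  then have "1 / exp (ln (1 / \<omega>) * u) \<le> 1 / (ln (1 / \<omega>) * u)"
    using l u by (intro divide_left_mono) auto
  moreover have "\<omega> powr u = 1 / exp (ln (1 / \<omega>) * u)"
    using omega by (simp add: powr_def ln_div exp_minus field_simps)
  ultimately show ?thesis by simp
qed

end

section \<open>Tractability\<close>

context hermite_sequences
begin

lemma B_eq_sum_lessThan: "B s = (\<Sum>j<s. 1 / b (Suc j))"
  unfolding B_def by (simp add: sum.atLeast1_atMost_eq)

lemma inverse_b_nonneg: "0 \<le> 1 / b (Suc j)"
  using b_ge_1[of "Suc j"] by simp

lemma B_le_suminf: "summable (\<lambda>j. 1 / b (Suc j)) \<Longrightarrow> B s \<le> (\<Sum>j. 1 / b (Suc j))"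
  unfolding B_eq_sum_lessThan using inverse_b_nonneg by (intro sum_le_suminf) auto

lemma summable_of_B_le:
  assumes "\<And>s. s \<ge> 1 \<Longrightarrow> B s \<le> X"
  shows "summable (\<lambda>j. 1 / b (Suc j))" and "(\<Sum>j. 1 / b (Suc j)) \<le> X"
proof -
  have le: "(\<Sum>j<s. 1 / b (Suc j)) \<le> X" for s
  proof (cases "s = 0")
    case True
    then show ?thesis using assms[of 1] B_pos[of 1] by simp
  next
    case False
    then show ?thesis using assms[of s] B_eq_sum_lessThan[of s] by simp
  qed
  show 1: "summable (\<lambda>j. 1 / b (Suc j))"
    using inverse_b_nonneg le by (rule summableI_nonneg_bounded)
  show "(\<Sum>j. 1 / b (Suc j)) \<le> X" using 1 le by (rule suminf_le_const)
qed

lemma suminf_inverse_b_pos: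
  assumes "summable (\<lambda>j. 1 / b (Suc j))"
  shows "0 < (\<Sum>j. 1 / b (Suc j))"
  using B_le_suminf[OF assms, of 1] B_pos[of 1] by simp

theorem exp_convergence: "EXP \<omega> a b"
proof -
  have B1: "1 / B s > 0" "1 / B s * B s \<le> 1" if "s \<ge> 1" for s using B_pos[OF that] by auto
  have half: "(1 / 2 :: real) \<in> {0<..<1}" by simp
  have "\<forall>s. \<exists>C C1. s \<ge> 1 \<longrightarrow> C > 0 \<and> C1 > 0 \<and> (\<forall>n\<ge>1. err n s \<le> C * (1/2) powr ((real n / C1) powr (1 / B s)))"
    using err_exponential_any_base[OF half B1] by blast
  then obtain C C1 where "\<forall>s. s \<ge> 1 \<longrightarrow> C s > 0 \<and> C1 s > 0 \<and>
      (\<forall>n\<ge>1. err n s \<le> C s * (1/2) powr ((real n / C1 s) powr (1 / B s)))"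
    by metis
  then show ?thesis
    unfolding EXP_def using B1 half
    by (intro bexI[of _ "1/2"] exI[of _ "\<lambda>s. 1 / B s"] exI[of _ C] exI[of _ C1]) auto
qed

theorem exp_rate_eq:
  assumes q: "q \<in> {0<..<1}" and s: "s \<ge> 1"
  shows "exp_rate \<omega> a b q s = ereal (1 / B s)"
  unfolding exp_rate_def
proof (rule antisym)
  let ?P = "{p. p > 0 \<and> (\<exists>C>0. \<exists>C1>0. \<forall>n\<ge>1. err n s \<le> C * q powr ((real n / C1) powr p))}"
  show "(SUP p\<in>?P. ereal p) \<le> ereal (1 / B s)"
  proof (rule SUP_least)
    fix p assume "p \<in> ?P"
    then have "p * B s \<le> 1" using exponential_rate_le[OF s q] by blast
    then show "ereal p \<le> ereal (1 / B s)" using B_pos[OF s] by (simp add: field_simps)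
  qed
  have "1 / B s \<in> ?P"
    using err_exponential_any_base[OF q, of "1 / B s" s] B_pos[OF s] by simp
  then show "ereal (1 / B s) \<le> (SUP p\<in>?P. ereal p)" by (rule SUP_upper)
qed

lemma uniform_rate_mem:
  assumes q: "q \<in> {0<..<1}" and sm: "summable (\<lambda>j. 1 / b (Suc j))"
  shows "\<exists>C C1 :: nat \<Rightarrow> real. (\<forall>s\<ge>1. C s > 0 \<and> C1 s > 0) \<and>
    (\<forall>s\<ge>1. \<forall>n\<ge>1. err n s \<le> C s * q powr ((real n / C1 s) powr (1 / (\<Sum>j. 1 / b (Suc j)))))"
proof -
  let ?B = "\<Sum>j. 1 / b (Suc j)"
  have B: "?B > 0" by (rule suminf_inverse_b_pos[OF sm])
  have "1 / ?B * B s \<le> 1" for s using B_le_suminf[OF sm, of s] B by simp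
  then have "\<exists>C>0. \<exists>C1>0. \<forall>n\<ge>1. err n s \<le> C * q powr ((real n / C1) powr (1 / ?B))" for s
    using B by (intro err_exponential_any_base[OF q]) auto
  then obtain C C1 where "\<And>s. C s > 0 \<and> C1 s > 0 \<and> (\<forall>n\<ge>1. err n s \<le>
      C s * q powr ((real n / C1 s) powr (1 / ?B)))"
    by metis
  then show ?thesis by blast
qed

theorem UEXP_iff: "UEXP \<omega> a b \<longleftrightarrow> summable (\<lambda>j. 1 / b (Suc j))"
proof
  assume "UEXP \<omega> a b"
  then obtain q p C C1 where q: "q \<in> {0<..<1}" and p: "p > 0" and C: "\<forall>s\<ge>1. C s > 0 \<and> C1 s > 0"
    and bound: "\<forall>s\<ge>1. \<forall>n\<ge>1. err n s \<le> C s * q powr ((real n / C1 s) powr p)"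
    unfolding UEXP_def by blast
  have "B s \<le> 1 / p" if s: "s \<ge> 1" for s
  proof -
    have "p * B s \<le> 1"
      using exponential_rate_le[OF s q p, of "C s" "C1 s"] C bound s by blast
    then show ?thesis using p by (simp add: field_simps)
  qed
  then show "summable (\<lambda>j. 1 / b (Suc j))" by (rule summable_of_B_le)
next
  assume sm: "summable (\<lambda>j. 1 / b (Suc j))"
  have half: "(1 / 2 :: real) \<in> {0<..<1}" by simp
  show "UEXP \<omega> a b"
    unfolding UEXP_def
    using uniform_rate_mem[OF half sm] suminf_inverse_b_pos[OF sm] half
    by (intro bexI[of _ "1/2"] exI[of _ "1 / (\<Sum>j. 1 / b (Suc j))"]) auto
qed

theorem uexp_rate_eq:
  assumes q: "q \<in> {0<..<1}" and sm: "summable (\<lambda>j. 1 / b (Suc j))"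
  shows "uexp_rate \<omega> a b q = ereal (1 / (\<Sum>j. 1 / b (Suc j)))"
  unfolding uexp_rate_def
proof (rule antisym)
  let ?B = "\<Sum>j. 1 / b (Suc j)"
  let ?P = "{p. p > 0 \<and> (\<exists>C C1 :: nat \<Rightarrow> real. (\<forall>s\<ge>1. C s > 0 \<and> C1 s > 0) \<and>
      (\<forall>n\<ge>1. \<forall>s\<ge>1. err n s \<le> C s * q powr ((real n / C1 s) powr p)))}"
  have B: "?B > 0" by (rule suminf_inverse_b_pos[OF sm])
  show "(SUP p\<in>?P. ereal p) \<le> ereal (1 / ?B)"
  proof (rule SUP_least)
    fix p assume "p \<in> ?P"
    then obtain C C1 where p: "p > 0" and C: "\<forall>s\<ge>1. C s > 0 \<and> C1 s > 0"
      and bound: "\<forall>n\<ge>1. \<forall>s\<ge>1. err n s \<le> C s * q powr ((real n / C1 s) powr p)" by blast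
    have "B s \<le> 1 / p" if s: "s \<ge> 1" for s
    proof -
      have "p * B s \<le> 1"
        using exponential_rate_le[OF s q p, of "C s" "C1 s"] C bound s by blast
      then show ?thesis using p by (simp add: field_simps)
    qed
    then have "?B \<le> 1 / p" by (rule summable_of_B_le(2))
    then show "ereal p \<le> ereal (1 / ?B)" using p B by (simp add: field_simps)
  qed
  obtain C C1 where "\<forall>s\<ge>1. C s > 0 \<and> C1 s > 0"
    "\<forall>s\<ge>1. \<forall>n\<ge>1. err n s \<le> C s * q powr ((real n / C1 s) powr (1 / ?B))"
    using uniform_rate_mem[OF q sm] by (elim exE conjE) (rule that)
  then have "1 / ?B \<in> ?P"
    using B by (intro CollectI conjI exI[of _ C] exI[of _ C1]) simp_all
  then show "ereal (1 / ?B) \<le> (SUP p\<in>?P. ereal p)" by (rule SUP_upper)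
qed

text \<open>
  Here \<open>\<omega> powr (a\<^sub>j 2 powr b\<^sub>j / 4) = O(1 / b\<^sub>j)\<close> is summable, and the product rule has at most
  \<open>\<Prod>j. (c y) powr (1 / b\<^sub>j)\<close> nodes, so the exponent \<open>\<Sum>j. 1 / b\<^sub>j\<close> itself is attained.
\<close>

lemma EC_SPT_with_suminf:
  assumes sm: "summable (\<lambda>j. 1 / b (Suc j))"
  shows "EC_SPT_with \<omega> a b (\<Sum>j. 1 / b (Suc j))"
proof -
  let ?B = "\<Sum>j. 1 / b (Suc j)"
  have B: "?B > 0" by (rule suminf_inverse_b_pos[OF sm])
  define L where "L = ln (1 / \<omega>)"
  have L: "L > 0" using omega by (simp add: L_def)
  have "\<omega> powr (a j * 2 powr b j / 4) \<le> 8 / L * (1 / b j)" if j: "j \<ge> 1" for j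
  proof -
    have bj: "b j \<ge> 1" and aj: "a j \<ge> 1" using a_ge_1[OF j] b_ge_1[OF j] by auto
    have ln2: "1 / 2 \<le> ln (2::real)"
      using ln_le_minus_one[of "1 / 2 :: real"] by (simp add: ln_div)
    have "b j / 2 \<le> b j * ln 2" using ln2 bj by simp
    also have "\<dots> \<le> exp (b j * ln 2)" using exp_ge_add_one_self[of "b j * ln 2"] by linarith
    also have "\<dots> = 2 powr b j" by (simp add: powr_def)
    also have "\<dots> \<le> a j * 2 powr b j" using aj by (simp add: mult_le_cancel_right1)
    finally have "b j / 8 \<le> a j * 2 powr b j / 4" by simp
    then have "\<omega> powr (a j * 2 powr b j / 4) \<le> \<omega> powr (b j / 8)" using omega by (intro powr_mono') auto
    also have "\<dots> \<le> 1 / (L * (b j / 8))" unfolding L_def by (rule omega_powr_le) (use bj in simp)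
    finally show ?thesis by simp
  qed
  then have sum_le: "(\<Sum>j=1..s. \<omega> powr (a j * 2 powr b j / 4)) \<le> 8 / L * ?B" for s
  proof -
    have "(\<Sum>j=1..s. \<omega> powr (a j * 2 powr b j / 4)) \<le> (\<Sum>j=1..s. 8 / L * (1 / b j))"
      using \<open>\<And>j. j \<ge> 1 \<Longrightarrow> _ j \<le> _\<close> by (intro sum_mono) auto
    also have "\<dots> = 8 / L * B s" unfolding B_def sum_distrib_left ..
    also have "\<dots> \<le> 8 / L * ?B" using B_le_suminf[OF sm, of s] L by (intro mult_left_mono) auto
    finally show ?thesis .
  qed
  have "0 < 8 / L * ?B" using L B by simp
  from err_le_of_summable_weights[OF this] obtain c where c: "c \<ge> 1"
    and err: "\<forall>s. \<forall>\<epsilon>\<in>{0<..<1}. (\<Sum>j=1..s. \<omega> powr (a j * 2 powr b j / 4)) \<le> 8 / L * ?B \<longrightarrow>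
      err (\<Prod>j=1..s. rule_size (c * (1 + ln (1 / \<epsilon>))) j) s \<le> \<epsilon>"
    by (elim exE conjE) (rule that)
  show ?thesis
    unfolding EC_SPT_with_def
  proof (intro exI[of _ "c powr ?B"] conjI allI impI ballI)
    fix s :: nat and \<epsilon> :: real assume \<epsilon>: "\<epsilon> \<in> {0<..<1}"
    define y where "y = 1 + ln (1 / \<epsilon>)"
    have y: "y \<ge> 1" using \<epsilon> by (auto simp: y_def)
    then have cy: "c * y \<ge> 1" using c mult_mono[of 1 c 1 y] by simp
    have "info \<epsilon> s \<le> (\<Prod>j=1..s. rule_size (c * y) j)"
      unfolding y_def by (rule info_le[OF err[rule_format, OF \<epsilon> sum_le]])
    then have "real (info \<epsilon> s) \<le> (\<Prod>j=1..s. real (rule_size (c * y) j))"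
      unfolding of_nat_prod[symmetric] by (simp only: of_nat_le_iff)
    also have "\<dots> \<le> (\<Prod>j=1..s. (c * y) powr (1 / b j))"
    proof (rule prod_mono, intro conjI)
      fix j assume j: "j \<in> {1..s}"
      have bj: "b j \<ge> 1" and aj: "a j \<ge> 1" using a_ge_1[of j] b_ge_1[of j] j by auto
      have "c * y / a j \<le> c * y / 1" using cy aj by (intro divide_left_mono) auto
      then have "(c * y / a j) powr (1 / b j) \<le> (c * y) powr (1 / b j)"
        using cy aj bj by (intro powr_mono2) auto
      moreover have "1 \<le> (c * y) powr (1 / b j)" using cy bj by (intro ge_one_powr_ge_zero) auto
      moreover have "real (nat \<lfloor>(c * y / a j) powr (1 / b j)\<rfloor>) \<le> (c * y / a j) powr (1 / b j)"
        by (rule of_nat_floor) simp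
      ultimately show "real (rule_size (c * y) j) \<le> (c * y) powr (1 / b j)"
        unfolding rule_size_def of_nat_max by (intro max.boundedI) linarith+
    qed simp
    also have "\<dots> = (c * y) powr B s" using cy prod_powr_eq[of "c * y" 1 s] by simp
    also have "\<dots> \<le> (c * y) powr ?B" using cy B_le_suminf[OF sm] by (intro powr_mono) auto
    also have "\<dots> = c powr ?B * y powr ?B" by (rule powr_mult)
    finally show "real (info \<epsilon> s) \<le> c powr ?B * (1 + ln (1 / \<epsilon>)) powr ?B" unfolding y_def .
  qed simp
qed

lemma EC_SPT_with_imp:
  assumes "\<tau> \<ge> 0" "EC_SPT_with \<omega> a b \<tau>"
  shows "summable (\<lambda>j. 1 / b (Suc j))" and "(\<Sum>j. 1 / b (Suc j)) \<le> \<tau>"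
proof -
  obtain c where c: "c \<ge> 0" "\<forall>s\<ge>1. \<forall>\<epsilon>\<in>{0<..<1}. real (info \<epsilon> s) \<le> c * (1 + ln (1 / \<epsilon>)) powr \<tau>"
    using assms(2) unfolding EC_SPT_with_def by (elim exE conjE) (rule that)
  have le: "B s \<le> \<tau>" if "s \<ge> 1" for s
    by (rule tractability_exponent_ge[OF that c(1) assms(1)]) (use c(2) that in blast)
  show "summable (\<lambda>j. 1 / b (Suc j))" "(\<Sum>j. 1 / b (Suc j)) \<le> \<tau>"
    using summable_of_B_le[OF le] by auto
qed

theorem EC_SPT_iff: "EC_SPT \<omega> a b \<longleftrightarrow> summable (\<lambda>j. 1 / b (Suc j))"
proof
  assume "EC_SPT \<omega> a b"
  then obtain \<tau> where "\<tau> \<ge> 0" "EC_SPT_with \<omega> a b \<tau>" unfolding EC_SPT_def by (elim exE conjE) (rule that)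
  then show "summable (\<lambda>j. 1 / b (Suc j))" by (rule EC_SPT_with_imp(1))
next
  assume sm: "summable (\<lambda>j. 1 / b (Suc j))"
  show "EC_SPT \<omega> a b"
    unfolding EC_SPT_def
    by (intro exI[of _ "\<Sum>j. 1 / b (Suc j)"] conjI less_imp_le[OF suminf_inverse_b_pos[OF sm]]
      EC_SPT_with_suminf[OF sm])
qed

theorem EC_PT_iff: "EC_PT \<omega> a b \<longleftrightarrow> summable (\<lambda>j. 1 / b (Suc j))"
proof
  assume "EC_PT \<omega> a b"
  then obtain c \<tau>1 \<tau>2 where c: "c \<ge> 0" "\<tau>2 \<ge> 0" and
    bound: "\<forall>s\<ge>1. \<forall>\<epsilon>\<in>{0<..<1}. real (info \<epsilon> s) \<le> c * real s powr \<tau>1 * (1 + ln (1 / \<epsilon>)) powr \<tau>2"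
    unfolding EC_PT_def by (elim exE conjE) (rule that)
  have "B s \<le> \<tau>2" if "s \<ge> 1" for s
    by (rule tractability_exponent_ge[OF that _ c(2), of "c * real s powr \<tau>1"]) (use c bound that in auto)
  then show "summable (\<lambda>j. 1 / b (Suc j))" by (rule summable_of_B_le)
next
  assume sm: "summable (\<lambda>j. 1 / b (Suc j))"
  obtain c where c: "c \<ge> 0" "\<forall>s\<ge>1. \<forall>\<epsilon>\<in>{0<..<1}. real (info \<epsilon> s) \<le> c * (1 + ln (1 / \<epsilon>)) powr (\<Sum>j. 1 / b (Suc j))"
    using EC_SPT_with_suminf[OF sm] unfolding EC_SPT_with_def by (elim exE conjE) (rule that)
  show "EC_PT \<omega> a b"
    unfolding EC_PT_def
    by (intro exI[of _ c] conjI exI[of _ 0] exI[of _ "\<Sum>j. 1 / b (Suc j)"] c(1) allI impI ballI)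
      (use c(2) suminf_inverse_b_pos[OF sm] in auto)
qed

theorem EC_SPT_exponent_eq:
  assumes sm: "summable (\<lambda>j. 1 / b (Suc j))"
  shows "EC_SPT_exponent \<omega> a b = ereal (\<Sum>j. 1 / b (Suc j))"
  unfolding EC_SPT_exponent_def
proof (rule antisym)
  show "(INF \<tau>\<in>{\<tau>. \<tau> \<ge> 0 \<and> EC_SPT_with \<omega> a b \<tau>}. ereal \<tau>) \<le> ereal (\<Sum>j. 1 / b (Suc j))"
    using EC_SPT_with_suminf[OF sm] suminf_inverse_b_pos[OF sm] by (intro INF_lower) auto
  show "ereal (\<Sum>j. 1 / b (Suc j)) \<le> (INF \<tau>\<in>{\<tau>. \<tau> \<ge> 0 \<and> EC_SPT_with \<omega> a b \<tau>}. ereal \<tau>)"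
    using EC_SPT_with_imp(2) by (intro INF_greatest) auto
qed

subsection \<open>Weak tractability\<close>

abbreviation "wt_filter \<equiv>
  inf (filtercomap (\<lambda>(\<epsilon>, s). real s + ln (1 / \<epsilon>)) at_top) (principal ({0<..<1} \<times> {1..}))"

text \<open>
  As \<open>a\<close> and \<open>b\<close> are nondecreasing, \<open>a\<^sub>j 2 powr b\<^sub>j\<close> either tends to infinity or is bounded by some \<open>Z\<close>. In the
  second case the lower estimate with all \<open>t\<^sub>j = 1\<close> shows that \<open>2\<^sup>s\<close> nodes are needed for
  \<open>\<epsilon> = \<kappa>\<^sup>s / 2\<close>, and along these pairs the quotient in the definition stays away from 0.
\<close>

theorem EC_WT_necessary:
  assumes "EC_WT \<omega> a b"
  shows "filterlim (\<lambda>j. a j * 2 powr b j) at_top sequentially"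
proof (rule ccontr)
  assume "\<not> ?thesis"
  then obtain Z where Z: "\<not> eventually (\<lambda>j. Z \<le> a j * 2 powr b j) sequentially"
    unfolding filterlim_at_top by blast
  have bd: "a j * 2 powr b j \<le> Z" if j: "j \<ge> 1" for j
  proof -
    obtain i where i: "i \<ge> j" "a i * 2 powr b i < Z"
      using Z unfolding eventually_sequentially by (meson not_le)
    have "a j * 2 powr b j \<le> a i * 2 powr b i"
      using a_le[OF j i(1)] b_le[OF j i(1)] a_ge_1[OF j] by (intro mult_mono powr_mono) auto
    then show ?thesis using i by simp
  qed
  define \<kappa> where "\<kappa> = sqrt (\<omega> powr Z / linearization_norm 1)"
  have D: "linearization_norm 1 \<ge> 1" by (rule linearization_norm_ge_1)
  have "0 < a 1 * 2 powr b 1" using a_1 by simp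
  then have Z0: "Z > 0" using bd[of 1] by linarith
  have "\<omega> powr Z < 1" using omega Z0 by (simp add: powr_def mult_pos_neg)
  then have "\<omega> powr Z / linearization_norm 1 < 1" using D by (simp add: divide_less_eq)
  then have \<kappa>: "0 < \<kappa>" "\<kappa> < 1" using omega D by (auto simp: \<kappa>_def)
  define \<epsilon> where "\<epsilon> s = \<kappa> ^ s / 2" for s
  have \<epsilon>: "\<epsilon> s \<in> {0<..<1}" for s
    using \<kappa> power_le_one[of \<kappa> s] by (simp add: \<epsilon>_def)
  have info: "2 ^ s \<le> info (\<epsilon> s) s" for s
  proof (rule info_ge[OF \<epsilon>])
    fix n assume n: "n < (2::nat) ^ s"
    have "\<kappa> ^ s = sqrt (\<Prod>j=1..s. \<omega> powr Z / linearization_norm 1)"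
      by (simp add: \<kappa>_def real_sqrt_power)
    also have "\<dots> \<le> sqrt (\<Prod>j=1..s. \<omega> powr (a j * (2 * real 1) powr b j) / linearization_norm 1)"
      using bd omega D by (intro real_sqrt_le_mono prod_mono conjI divide_right_mono powr_mono') auto
    also have "\<dots> \<le> err n s" by (rule err_lower) (use n in \<open>simp add: numeral_2_eq_2\<close>)
    finally have "\<kappa> ^ s \<le> err n s" .
    moreover have "0 < \<kappa> ^ s" using \<kappa> by simp
    ultimately show "\<epsilon> s < err n s" unfolding \<epsilon>_def by linarith
  qed
  define l where "l = ln 2 / (2 + ln (1 / \<kappa>))"
  have k0: "ln (1 / \<kappa>) > 0" using \<kappa> by simp
  then have l: "l > 0" by (simp add: l_def add_pos_pos)
  have lneps: "ln (1 / \<epsilon> s) = ln 2 + real s * ln (1 / \<kappa>)" for s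
    using \<kappa> by (simp add: \<epsilon>_def ln_div ln_mult ln_realpow)
  have ln2: "0 < ln (2::real)" "ln (2::real) \<le> 1" using ln_le_minus_one[of "2::real"] by auto
  have ratio: "l \<le> ln (real (info (\<epsilon> s) s)) / (real s + ln (1 / \<epsilon> s))" if s: "s \<ge> 1" for s
  proof -
    have den: "real s + ln (1 / \<epsilon> s) \<le> real s * (2 + ln (1 / \<kappa>))" "0 < real s + ln (1 / \<epsilon> s)"
      using s ln2 k0 unfolding lneps by (auto simp: algebra_simps intro: add_pos_nonneg)
    have num: "real s * ln 2 \<le> ln (real (info (\<epsilon> s) s))"
    proof -
      have "real (2 ^ s) \<le> real (info (\<epsilon> s) s)" using info by (simp only: of_nat_le_iff)
      moreover have "0 < info (\<epsilon> s) s" by (rule less_le_trans[OF _ info]) simp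
      ultimately have "ln (2 ^ s) \<le> ln (real (info (\<epsilon> s) s))" by (subst ln_le_cancel_iff) auto
      then show ?thesis by (simp add: ln_realpow)
    qed
    have num0: "0 \<le> ln (real (info (\<epsilon> s) s))"
      using num ln2 mult_nonneg_nonneg[of "real s" "ln 2"] by linarith
    have "l = real s * ln 2 / (real s * (2 + ln (1 / \<kappa>)))" using s by (simp add: l_def)
    also have "\<dots> \<le> ln (real (info (\<epsilon> s) s)) / (real s + ln (1 / \<epsilon> s))"
      using num num0 den ln2 s by (intro frac_le) auto
    finally show ?thesis .
  qed
  (* Also real s + ln (1 / \<epsilon> s) tends to infinity, so the sequence runs through the filter of weak tractability. *)
  have lim: "filterlim (\<lambda>s. (\<epsilon> s, s)) wt_filter sequentially"
    unfolding filterlim_inf filterlim_principal filterlim_filtercomap_iff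
  proof
    show "filterlim ((\<lambda>(\<epsilon>, s). real s + ln (1 / \<epsilon>)) \<circ> (\<lambda>s. (\<epsilon> s, s))) at_top sequentially"
    proof (rule filterlim_at_top_mono[OF filterlim_real_sequentially], rule always_eventually, rule allI)
      fix s :: nat
      have "0 \<le> ln (1 / \<epsilon> s)" using \<epsilon>[of s] by simp
      then show "real s \<le> ((\<lambda>(\<epsilon>, s). real s + ln (1 / \<epsilon>)) \<circ> (\<lambda>s. (\<epsilon> s, s))) s" by simp
    qed
    show "\<forall>\<^sub>F s in sequentially. (\<epsilon> s, s) \<in> {0<..<1} \<times> {1..}"
      using eventually_ge_at_top[of 1] by eventually_elim (use \<epsilon> in auto)
  qed
  have "(\<lambda>s. ln (real (info (\<epsilon> s) s)) / (real s + ln (1 / \<epsilon> s))) \<longlonglongrightarrow> 0"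
    using filterlim_compose[OF assms[unfolded EC_WT_def] lim] by simp
  then have "l \<le> 0" using ratio by (intro LIMSEQ_le_const) auto
  then show False using l by simp
qed

text \<open>
  The growth condition makes the weights \<open>\<omega> powr (a\<^sub>j 2 powr b\<^sub>j / 4)\<close> summable
      and leaves more than one node only
  in the coordinates \<open>j \<le> J = O(y powr (1 / (1 + \<eta>)))\<close>, where \<open>y = 1 + ln (1 / \<epsilon>)\<close>. Each of them has at most
  \<open>c y\<close> nodes, so \<open>ln n(\<epsilon>,s) \<le> J ln (c y) = o(y)\<close> uniformly in \<open>s\<close>.
\<close>

theorem EC_WT_sufficient:
  assumes \<eta>: "\<eta> > 0" and \<beta>: "\<beta> > 0" and grow: "\<And>j. j \<ge> 1 \<Longrightarrow> \<beta> * real j powr (1 + \<eta>) \<le> a j * 2 powr b j"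
  shows "EC_WT \<omega> a b"
proof -
  define L where "L = ln (1 / \<omega>)"
  have L: "L > 0" using omega by (simp add: L_def)
  define r where "r = 1 / (1 + \<eta>)"
  have r: "0 < r" "r < 1" using \<eta> by (auto simp: r_def)
  (* The logarithm of c y is estimated by a power with this exponent; r + \<sigma> remains below 1. *)
  define \<sigma> where "\<sigma> = (1 - r) / 2"
  have \<sigma>: "\<sigma> > 0" "r + \<sigma> < 1" using r by (simp_all add: \<sigma>_def field_simps)
  have smp: "summable (\<lambda>j. real (Suc j) powr (- (1 + \<eta>)))"
    using \<eta> by (subst summable_Suc_iff) (simp add: summable_real_powr_iff)
  define S where "S = 4 / (L * \<beta>) * (\<Sum>j. real (Suc j) powr (- (1 + \<eta>)))"
  have S: "S > 0" unfolding S_def using L \<beta> smp by (intro mult_pos_pos suminf_pos) auto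
  have term_le: "\<omega> powr (a j * 2 powr b j / 4) \<le> 4 / (L * \<beta>) * real j powr (- (1 + \<eta>))" if j: "j \<ge> 1" for j
  proof -
    have "\<omega> powr (a j * 2 powr b j / 4) \<le> \<omega> powr (\<beta> * real j powr (1 + \<eta>) / 4)"
      using grow[OF j] omega by (intro powr_mono') auto
    also have "\<dots> \<le> 1 / (L * (\<beta> * real j powr (1 + \<eta>) / 4))"
      unfolding L_def by (rule omega_powr_le) (use \<beta> j in auto)
    also have "\<dots> = 4 / (L * \<beta>) * real j powr (- (1 + \<eta>))"
      unfolding powr_minus by (simp add: field_simps)
    finally show ?thesis .
  qed
  have sum_le: "(\<Sum>j=1..s. \<omega> powr (a j * 2 powr b j / 4)) \<le> S" for s
  proof -
    have "(\<Sum>j=1..s. \<omega> powr (a j * 2 powr b j / 4)) \<le> (\<Sum>j=1..s. 4 / (L * \<beta>) * real j powr (- (1 + \<eta>)))"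
      using term_le by (intro sum_mono) auto
    also have "\<dots> = 4 / (L * \<beta>) * (\<Sum>j<s. real (Suc j) powr (- (1 + \<eta>)))"
      unfolding sum_distrib_left[symmetric] by (simp add: sum.atLeast1_atMost_eq)
    also have "\<dots> \<le> S"
      unfolding S_def using L \<beta> smp by (intro mult_left_mono sum_le_suminf) auto
    finally show ?thesis .
  qed
  from err_le_of_summable_weights[OF S] obtain c where c: "c \<ge> 1"
    and err: "\<forall>s. \<forall>\<epsilon>\<in>{0<..<1}. (\<Sum>j=1..s. \<omega> powr (a j * 2 powr b j / 4)) \<le> S \<longrightarrow>
      err (\<Prod>j=1..s. rule_size (c * (1 + ln (1 / \<epsilon>))) j) s \<le> \<epsilon>"
    by (elim exE conjE) (rule that)
  define K where "K = (1 / \<beta>) powr r * (c powr (r + \<sigma>) / \<sigma>)"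
  have K: "K \<ge> 0" using \<beta> \<sigma> by (simp add: K_def)
  have ln_info: "\<bar>ln (real (info \<epsilon> s))\<bar> \<le> K * (1 + ln (1 / \<epsilon>)) powr (r + \<sigma>)" if \<epsilon>: "\<epsilon> \<in> {0<..<1}" for \<epsilon> s
  proof -
    define y where "y = 1 + ln (1 / \<epsilon>)"
    have y: "y \<ge> 1" using \<epsilon> by (auto simp: y_def)
    then have cy: "c * y \<ge> 1" using c mult_mono[of 1 c 1 y] by simp
    define J where "J = (c * y / \<beta>) powr r"
    have J: "J \<ge> 0" by (simp add: J_def)
    have size: "ln (real (rule_size (c * y) j)) \<le> (if real j \<le> J then ln (c * y) else 0)" if j: "j \<ge> 1" for j
    proof -
      have bj: "b j \<ge> 1" and aj: "a j \<ge> 1" using a_ge_1[OF j] b_ge_1[OF j] by auto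
      let ?z = "(c * y / a j) powr (1 / b j)"
      show ?thesis
      proof (cases "real j \<le> J")
        case True
        have "c * y / a j \<le> c * y / 1" using cy aj by (intro divide_left_mono) auto
        then have "?z \<le> (c * y) powr (1 / b j)" using cy aj bj by (intro powr_mono2) auto
        also have "\<dots> \<le> (c * y) powr 1" using cy bj by (intro powr_mono) auto
        also have "\<dots> = c * y" using cy by simp
        finally have "?z \<le> c * y" .
        moreover have "real (nat \<lfloor>?z\<rfloor>) \<le> ?z" by (rule of_nat_floor) simp
        ultimately have "real (rule_size (c * y) j) \<le> c * y"
          using cy unfolding rule_size_def of_nat_max by (intro max.boundedI) linarith+
        moreover have "real (rule_size (c * y) j) \<ge> 1" unfolding rule_size_def by simp
        ultimately show ?thesis using True by simp
      next
        case False
        have "c * y / \<beta> = J powr (1 + \<eta>)"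
          using cy \<beta> \<eta> by (simp add: J_def r_def powr_powr)
        also have "\<dots> < real j powr (1 + \<eta>)" using False J \<eta> by (intro powr_less_mono2) auto
        finally have "c * y < \<beta> * real j powr (1 + \<eta>)" using \<beta> by (simp add: field_simps)
        also have "\<dots> \<le> a j * 2 powr b j" by (rule grow[OF j])
        finally have "c * y / a j < 2 powr b j" using aj by (simp add: field_simps)
        then have "?z < (2 powr b j) powr (1 / b j)" using cy aj bj by (intro powr_less_mono2) auto
        also have "\<dots> = 2" using bj by (simp add: powr_powr)
        finally have "nat \<lfloor>?z\<rfloor> \<le> 1" by linarith
        then have "rule_size (c * y) j = 1" unfolding rule_size_def by simp
        then show ?thesis using False by simp
      qed
    qed
    have pos: "1 \<le> rule_size (c * y) j" for j unfolding rule_size_def by simp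
    have "info \<epsilon> s \<le> (\<Prod>j=1..s. rule_size (c * y) j)"
      unfolding y_def by (rule info_le[OF err[rule_format, OF \<epsilon> sum_le]])
    then have le: "real (info \<epsilon> s) \<le> (\<Prod>j=1..s. real (rule_size (c * y) j))"
      unfolding of_nat_prod[symmetric] by (simp only: of_nat_le_iff)
    have lnP: "ln (\<Prod>j=1..s. real (rule_size (c * y) j)) = (\<Sum>j=1..s. ln (real (rule_size (c * y) j)))"
      using pos by (intro ln_prod) (auto simp: less_le_trans[OF _ pos] Suc_le_eq)
    have nonneg: "0 \<le> ln (real (info \<epsilon> s))" by (cases "info \<epsilon> s = 0") (auto simp: Suc_le_eq)
    have "ln (real (info \<epsilon> s)) \<le> (\<Sum>j=1..s. ln (real (rule_size (c * y) j)))"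
    proof (cases "info \<epsilon> s = 0")
      case True
      then show ?thesis using pos by (auto intro!: sum_nonneg)
    next
      case False
      then have "0 < real (info \<epsilon> s)" by simp
      then show ?thesis unfolding lnP[symmetric] using le by (subst ln_le_cancel_iff) auto
    qed
    also have "\<dots> \<le> (\<Sum>j=1..s. if real j \<le> J then ln (c * y) else 0)"
      using size by (intro sum_mono) auto
    also have "\<dots> = real (card {j \<in> {1..s}. real j \<le> J}) * ln (c * y)"
      by (simp add: sum.inter_filter[symmetric])
    also have "\<dots> \<le> J * ln (c * y)"
    proof (rule mult_right_mono)
      have "{j \<in> {1..s}. real j \<le> J} \<subseteq> {1..nat \<lfloor>J\<rfloor>}" by (auto simp: le_nat_floor)
      then have "card {j \<in> {1..s}. real j \<le> J} \<le> nat \<lfloor>J\<rfloor>"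
        using card_mono[of "{1..nat \<lfloor>J\<rfloor>}" "{j \<in> {1..s}. real j \<le> J}"] by simp
      then show "real (card {j \<in> {1..s}. real j \<le> J}) \<le> J" using of_nat_floor[OF J] by linarith
    qed (use cy in simp)
    also have "\<dots> \<le> J * ((c * y) powr \<sigma> / \<sigma>)"
      using ln_le_powr_div[OF cy \<sigma>(1)] J by (intro mult_left_mono) auto
    also have "J = (1 / \<beta>) powr r * (c * y) powr r"
      unfolding J_def using cy \<beta> by (simp add: powr_divide)
    also have "(1 / \<beta>) powr r * (c * y) powr r * ((c * y) powr \<sigma> / \<sigma>) = K * y powr (r + \<sigma>)"
      using c y by (simp add: K_def powr_add powr_mult)
    finally show ?thesis using nonneg unfolding y_def by simp
  qed
  let ?g = "\<lambda>(\<epsilon>, s). real s + ln (1 / \<epsilon>)"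
  have "filterlim ?g at_top wt_filter"
    by (rule filterlim_mono[OF filterlim_filtercomap order_refl inf_le1])
  then have "((\<lambda>z. K * ?g z powr (r + \<sigma> - 1)) \<longlongrightarrow> K * 0) wt_filter"
    using \<sigma> by (intro tendsto_mult tendsto_const tendsto_neg_powr) auto
  then have lim: "((\<lambda>z. K * ?g z powr (r + \<sigma> - 1)) \<longlongrightarrow> 0) wt_filter" by simp
  have "eventually (\<lambda>z. norm ((\<lambda>(\<epsilon>, s). ln (real (info \<epsilon> s)) / (real s + ln (1 / \<epsilon>))) z) \<le>
      K * ?g z powr (r + \<sigma> - 1)) wt_filter"
    unfolding eventually_inf_principal
  proof (rule always_eventually, intro allI impI)
    fix z :: "real \<times> nat" assume z: "z \<in> {0<..<1} \<times> {1..}"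
    obtain \<epsilon> s where zz: "z = (\<epsilon>, s)" by (cases z)
    have \<epsilon>: "\<epsilon> \<in> {0<..<1}" and s: "s \<ge> 1" using z zz by auto
    define G where "G = real s + ln (1 / \<epsilon>)"
    have l0: "0 \<le> ln (1 / \<epsilon>)" using \<epsilon> by simp
    have G: "1 + ln (1 / \<epsilon>) \<le> G" "G > 0" using s l0 unfolding G_def by auto
    have "\<bar>ln (real (info \<epsilon> s))\<bar> \<le> K * (1 + ln (1 / \<epsilon>)) powr (r + \<sigma>)" by (rule ln_info[OF \<epsilon>])
    also have "\<dots> \<le> K * G powr (r + \<sigma>)"
      using G l0 K r \<sigma> by (intro mult_left_mono powr_mono2) auto
    finally have "\<bar>ln (real (info \<epsilon> s))\<bar> / G \<le> K * G powr (r + \<sigma>) / G"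
      using G by (intro divide_right_mono) auto
    also have "\<dots> = K * G powr (r + \<sigma> - 1)" using G by (simp add: powr_diff)
    finally show "norm ((\<lambda>(\<epsilon>, s). ln (real (info \<epsilon> s)) / (real s + ln (1 / \<epsilon>))) z) \<le> K * ?g z powr (r + \<sigma> - 1)"
      unfolding zz by (simp only: prod.case real_norm_def abs_divide G_def[symmetric] abs_of_pos[OF G(2)])
  qed
  then show ?thesis
    unfolding EC_WT_def by (rule Lim_null_comparison[OF _ lim])
qed

end

theorem theorem1:
  fixes \<omega> :: real and a b :: "nat \<Rightarrow> real"
  assumes "0 < \<omega>" and "\<omega> < 1"
    and "1 \<le> a 1" and "\<And>j. j \<ge> 1 \<Longrightarrow> a j \<le> a (Suc j)"
    and "1 \<le> b 1" and "\<And>j. j \<ge> 1 \<Longrightarrow> b j \<le> b (Suc j)"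
  shows
    "(EXP \<omega> a b \<and>
      (\<forall>q\<in>{0<..<1}. \<forall>s\<ge>1. exp_rate \<omega> a b q s = ereal (1 / (\<Sum>j=1..s. 1 / b j)))) \<and>
     ((summable (\<lambda>j. 1 / b (Suc j)) \<longleftrightarrow> UEXP \<omega> a b) \<and>
      (UEXP \<omega> a b \<longleftrightarrow> EC_PT \<omega> a b) \<and>
      (EC_PT \<omega> a b \<longleftrightarrow> EC_SPT \<omega> a b) \<and>
      (summable (\<lambda>j. 1 / b (Suc j)) \<or> UEXP \<omega> a b \<or> EC_PT \<omega> a b \<or> EC_SPT \<omega> a b \<longrightarrow>
         (\<forall>q\<in>{0<..<1}. uexp_rate \<omega> a b q = ereal (1 / (\<Sum>j. 1 / b (Suc j)))) \<and>
         EC_SPT_exponent \<omega> a b = ereal (\<Sum>j. 1 / b (Suc j)))) \<and>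
     (EC_WT \<omega> a b \<longrightarrow> filterlim (\<lambda>j. a j * 2 powr b j) at_top sequentially) \<and>
     ((\<exists>\<eta>>0. \<exists>\<beta>>0. \<forall>j\<ge>1. a j * 2 powr b j \<ge> \<beta> * real j powr (1 + \<eta>)) \<longrightarrow> EC_WT \<omega> a b)"
proof -
  interpret hermite_sequences \<omega> a b
    using assms by unfold_locales auto
  have equiv: "UEXP \<omega> a b \<longleftrightarrow> summable (\<lambda>j. 1 / b (Suc j))"
    "EC_PT \<omega> a b \<longleftrightarrow> summable (\<lambda>j. 1 / b (Suc j))"
    "EC_SPT \<omega> a b \<longleftrightarrow> summable (\<lambda>j. 1 / b (Suc j))"
    by (rule UEXP_iff EC_PT_iff EC_SPT_iff)+
  have rate: "\<forall>q\<in>{0<..<1}. \<forall>s\<ge>1. exp_rate \<omega> a b q s = ereal (1 / (\<Sum>j=1..s. 1 / b j))"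
    using exp_rate_eq unfolding B_def by simp
  have exponents: "(\<forall>q\<in>{0<..<1}. uexp_rate \<omega> a b q = ereal (1 / (\<Sum>j. 1 / b (Suc j)))) \<and>
      EC_SPT_exponent \<omega> a b = ereal (\<Sum>j. 1 / b (Suc j))"
    if "summable (\<lambda>j. 1 / b (Suc j))"
    using uexp_rate_eq[OF _ that] EC_SPT_exponent_eq[OF that] by simp
  have wt: "EC_WT \<omega> a b"
    if "\<exists>\<eta>>0. \<exists>\<beta>>0. \<forall>j\<ge>1. a j * 2 powr b j \<ge> \<beta> * real j powr (1 + \<eta>)"
    using that EC_WT_sufficient by (elim exE conjE) simp
  show ?thesis
    unfolding equiv using exp_convergence rate exponents EC_WT_necessary wt by (intro conjI impI) simp_all
qed

end
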